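(* Let $\Gamma$ be a torsion-free non-amenable (word-)hyperbolic group. Then $\Gamma$ satisfies the ISR property: if $\mathcal{M}$ is a $\Gamma$-invariant von Neumann subalgebra of $L(\Gamma)$, then $\mathcal{M}=L(\Lambda)$ for some normal subgroup $\Lambda\lhd\Gamma$.
   Context: For a discrete group $\Gamma$, let $\lambda:\Gamma\to \mathcal{U}(\ell^2(\Gamma))$ be the left regular representation, $\lambda(s)\delta_t=\delta_{st}$, and let $L(\Gamma)=\overline{\mathrm{span}\{\lambda(s):s\in\Gamma\}}^{\,w.o.t.}\subseteq \mathbb{B}(\ell^2(\Gamma))$ be the group von Neumann algebra. For a subgroup $\Lambda\le\Gamma$, $L(\Lambda)$ is identified with the von Neumann subalgebra of $L(\Gamma)$ generated by $\{\lambda(s):s\in\Lambda\}$. Von Neumann subalgebras are unital (same unit). A von Neumann subalgebra $\mathcal{M}\subseteq L(\Gamma)$ is $\Gamma$-invariant if $\lambda(g)\mathcal{M}\lambda(g)^*=\mathcal{M}$ for all $g\in\Gamma$. A countable discrete group $\Gamma$ satisfies the invariant von Neumann subalgebras rigidity (ISR) property if every $\Gamma$-invariant von Neumann subalgebra of $L(\Gamma)$ is of the form $L(\Lambda)$ for some normal subgroup $\Lambda\lhd\Gamma$. *)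

theory Defs
  imports "HOL-Analysis.Analysis" "HOL-Algebra.Coset" "HOL-Algebra.Generated_Groups"
begin

section \<open>The Hilbert space of square summable functions and its bounded operators\<close>

text \<open>
  The Hilbert space over an index set \<open>X\<close> is represented by the functions on the whole type that
  vanish off \<open>X\<close>. An operator is a function on all of \<open>'a \<Rightarrow> complex\<close>; to make equality of
  functions coincide with equality of operators, operators are required to send everything outside
  the Hilbert space to 0. Pointwise linear combinations and compositions respect this normalization.
\<close>

type_synonym 'a operator = "('a \<Rightarrow> complex) \<Rightarrow> ('a \<Rightarrow> complex)"

definition ell2 :: "'a set \<Rightarrow> ('a \<Rightarrow> complex) set" where
  "ell2 X = {x. (\<forall>t. t \<notin> X \<longrightarrow> x t = 0) \<and> (\<lambda>t. (cmod (x t))\<^sup>2) summable_on X}"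

definition ell2_inner :: "'a set \<Rightarrow> ('a \<Rightarrow> complex) \<Rightarrow> ('a \<Rightarrow> complex) \<Rightarrow> complex" where
  "ell2_inner X x y = (\<Sum>\<^sub>\<infinity>t\<in>X. x t * cnj (y t))"

definition ell2_norm :: "'a set \<Rightarrow> ('a \<Rightarrow> complex) \<Rightarrow> real" where
  "ell2_norm X x = sqrt (\<Sum>\<^sub>\<infinity>t\<in>X. (cmod (x t))\<^sup>2)"

definition bounded_ops :: "'a set \<Rightarrow> 'a operator set" where
  "bounded_ops X = {T.
     (\<forall>x\<in>ell2 X. T x \<in> ell2 X) \<and> (\<forall>x. x \<notin> ell2 X \<longrightarrow> T x = (\<lambda>t. 0)) \<and>
     (\<forall>x\<in>ell2 X. \<forall>y\<in>ell2 X. T (\<lambda>t. x t + y t) = (\<lambda>t. T x t + T y t)) \<and>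
     (\<forall>c. \<forall>x\<in>ell2 X. T (\<lambda>t. c * x t) = (\<lambda>t. c * T x t)) \<and>
     (\<exists>C. \<forall>x\<in>ell2 X. ell2_norm X (T x) \<le> C * ell2_norm X x)}"

definition id_op :: "'a set \<Rightarrow> 'a operator" where
  "id_op X x = (if x \<in> ell2 X then x else (\<lambda>t. 0))"

definition adjoint_op :: "'a set \<Rightarrow> 'a operator \<Rightarrow> 'a operator" where
  "adjoint_op X T = (THE S. S \<in> bounded_ops X \<and>
     (\<forall>x\<in>ell2 X. \<forall>y\<in>ell2 X. ell2_inner X (T x) y = ell2_inner X x (S y)))"

text \<open>
  The weak operator topology: the coarsest topology on the bounded operators for which all matrix
  coefficients are continuous.
\<close>

definition wot :: "'a set \<Rightarrow> 'a operator topology" where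
  "wot X = topology_generated_by
     {{T \<in> bounded_ops X. ell2_inner X (T x) y \<in> U} | x y U. x \<in> ell2 X \<and> y \<in> ell2 X \<and> open U}"

section \<open>Von Neumann algebras\<close>

definition von_neumann_algebra :: "'a set \<Rightarrow> 'a operator set \<Rightarrow> bool" where
  "von_neumann_algebra X M \<longleftrightarrow>
     M \<subseteq> bounded_ops X \<and> id_op X \<in> M \<and>
     (\<forall>S\<in>M. \<forall>T\<in>M. (\<lambda>x t. S x t + T x t) \<in> M) \<and>
     (\<forall>c. \<forall>T\<in>M. (\<lambda>x t. c * T x t) \<in> M) \<and>
     (\<forall>S\<in>M. \<forall>T\<in>M. S \<circ> T \<in> M) \<and>
     (\<forall>T\<in>M. adjoint_op X T \<in> M) \<and>
     closedin (wot X) M"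

definition vn_subalgebra :: "'a set \<Rightarrow> 'a operator set \<Rightarrow> 'a operator set \<Rightarrow> bool" where
  "vn_subalgebra X N M \<longleftrightarrow> von_neumann_algebra X M \<and> M \<subseteq> N"

section \<open>Group von Neumann algebras\<close>

definition left_reg :: "('a, 'b) monoid_scheme \<Rightarrow> 'a \<Rightarrow> 'a operator" where
  "left_reg G s x = (\<lambda>t. if x \<in> ell2 (carrier G) \<and> t \<in> carrier G
                         then x (inv\<^bsub>G\<^esub> s \<otimes>\<^bsub>G\<^esub> t) else 0)"

lemma left_reg_delta:
  fixes G (structure)
  assumes "group G" "s \<in> carrier G" "r \<in> carrier G"
  shows "left_reg G s (\<lambda>t. if t = r then 1 else 0) = (\<lambda>t. if t = s \<otimes> r then 1 else 0)"
proof -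
  interpret group G by fact
  have "(\<lambda>t. (cmod (if t = r then 1 else 0))\<^sup>2) summable_on carrier G"
    by (rule summable_on_cong_neutral[where S = "{r}", THEN iffD1]) (use assms in auto)
  then have "(\<lambda>t. if t = r then 1 else (0::complex)) \<in> ell2 (carrier G)"
    using assms by (auto simp: ell2_def)
  moreover have "inv s \<otimes> t = r \<longleftrightarrow> t = s \<otimes> r" if "t \<in> carrier G" for t
    using assms that by (metis inv_solve_left')
  ultimately show ?thesis
    using assms by (auto simp: left_reg_def fun_eq_iff)
qed

definition group_vn_algebra :: "('a, 'b) monoid_scheme \<Rightarrow> 'a operator set" where
  "group_vn_algebra G = (wot (carrier G)) closure_of
     {(\<lambda>x t. \<Sum>s\<in>F. c s * left_reg G s x t) | F c. finite F \<and> F \<subseteq> carrier G}"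

text \<open>
  For a subgroup \<open>H\<close>, its group von Neumann algebra viewed inside the one of \<open>G\<close>, i.e. the smallest
  von Neumann subalgebra containing the left translations by elements of \<open>H\<close>.
\<close>

definition subgroup_vn_algebra :: "('a, 'b) monoid_scheme \<Rightarrow> 'a set \<Rightarrow> 'a operator set" where
  "subgroup_vn_algebra G H =
     vn_subalgebra (carrier G) (group_vn_algebra G) hull (left_reg G ` H)"

definition invariant_subalgebra :: "('a, 'b) monoid_scheme \<Rightarrow> 'a operator set \<Rightarrow> bool" where
  "invariant_subalgebra G M \<longleftrightarrow>
     vn_subalgebra (carrier G) (group_vn_algebra G) M \<and>
     (\<forall>g\<in>carrier G.
        (\<lambda>T. left_reg G g \<circ> T \<circ> adjoint_op (carrier G) (left_reg G g)) ` M = M)"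

definition ISR_property :: "('a, 'b) monoid_scheme \<Rightarrow> bool" where
  "ISR_property G \<longleftrightarrow>
     (\<forall>M. invariant_subalgebra G M \<longrightarrow> (\<exists>H. H \<lhd> G \<and> M = subgroup_vn_algebra G H))"

section \<open>Torsion-free, amenable and hyperbolic groups\<close>

definition torsion_free :: "('a, 'b) monoid_scheme \<Rightarrow> bool" where
  "torsion_free G \<longleftrightarrow>
     (\<forall>x\<in>carrier G. \<forall>n>0. x [^]\<^bsub>G\<^esub> (n::nat) = \<one>\<^bsub>G\<^esub> \<longrightarrow> x = \<one>\<^bsub>G\<^esub>)"

text \<open>
  Amenability: there is a left invariant mean on the bounded real functions. Functions live on the
  whole type, but positivity only asks for nonnegativity on the carrier, so linearity and
  positivity force the mean to depend only on restrictions to the carrier.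
\<close>

definition invariant_mean :: "('a, 'b) monoid_scheme \<Rightarrow> (('a \<Rightarrow> real) \<Rightarrow> real) \<Rightarrow> bool" where
  "invariant_mean G m \<longleftrightarrow>
     (\<forall>f g. bounded (f ` carrier G) \<longrightarrow> bounded (g ` carrier G) \<longrightarrow>
        m (\<lambda>t. f t + g t) = m f + m g) \<and>
     (\<forall>c f. bounded (f ` carrier G) \<longrightarrow> m (\<lambda>t. c * f t) = c * m f) \<and>
     (\<forall>f. bounded (f ` carrier G) \<longrightarrow> (\<forall>t\<in>carrier G. 0 \<le> f t) \<longrightarrow> 0 \<le> m f) \<and>
     m (\<lambda>t. 1) = 1 \<and>
     (\<forall>s\<in>carrier G. \<forall>f. bounded (f ` carrier G) \<longrightarrow> m (\<lambda>t. f (s \<otimes>\<^bsub>G\<^esub> t)) = m f)"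

definition amenable :: "('a, 'b) monoid_scheme \<Rightarrow> bool" where
  "amenable G \<longleftrightarrow> (\<exists>m. invariant_mean G m)"

text \<open>The word length is meaningful only if \<open>S\<close> generates \<open>G\<close>.\<close>

definition word_length :: "('a, 'b) monoid_scheme \<Rightarrow> 'a set \<Rightarrow> 'a \<Rightarrow> nat" where
  "word_length G S g = (LEAST n. \<exists>w. length w = n \<and> set w \<subseteq> S \<union> m_inv G ` S \<and>
     foldr (\<otimes>\<^bsub>G\<^esub>) w \<one>\<^bsub>G\<^esub> = g)"

definition word_metric :: "('a, 'b) monoid_scheme \<Rightarrow> 'a set \<Rightarrow> 'a \<Rightarrow> 'a \<Rightarrow> real" where
  "word_metric G S g h = real (word_length G S (inv\<^bsub>G\<^esub> g \<otimes>\<^bsub>G\<^esub> h))"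

definition gromov_product :: "('a \<Rightarrow> 'a \<Rightarrow> real) \<Rightarrow> 'a \<Rightarrow> 'a \<Rightarrow> 'a \<Rightarrow> real" where
  "gromov_product d w x y = (d x w + d y w - d x y) / 2"

definition gromov_hyperbolic :: "'a set \<Rightarrow> ('a \<Rightarrow> 'a \<Rightarrow> real) \<Rightarrow> bool" where
  "gromov_hyperbolic X d \<longleftrightarrow> (\<exists>\<delta>\<ge>0. \<forall>w\<in>X. \<forall>x\<in>X. \<forall>y\<in>X. \<forall>z\<in>X.
     gromov_product d w x z \<ge> min (gromov_product d w x y) (gromov_product d w y z) - \<delta>)"

definition hyperbolic_group :: "('a, 'b) monoid_scheme \<Rightarrow> bool" where
  "hyperbolic_group G \<longleftrightarrow> (\<exists>S. finite S \<and> S \<subseteq> carrier G \<and> generate G S = carrier G \<and>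
     gromov_hyperbolic (carrier G) (word_metric G S))"

end

theory Submission
  imports Defs
begin

text \<open>
  Let \<open>K\<close> be the closure of \<open>M \<delta>\<^sub>e\<close> in \<open>\<ell>\<^sup>2(G)\<close>, with projection \<open>P\<close>, and let \<open>\<xi> = P \<delta>\<^sub>g\<close>, \<open>g \<noteq> e\<close>.
  Invariance makes \<open>\<xi>\<close> constant on the orbits of conjugation by \<open>g\<close>, so \<open>\<xi>\<close> is supported on the
  group \<open>C\<close> of elements commuting with some \<open>g\<^sup>n\<close>, \<open>n > 0\<close>. Moreover \<open>x = \<lambda>(g)\<^sup>* \<xi>\<close> commutes, under
  convolution, with all of \<open>K\<close>, in particular with the conjugates of \<open>\<xi>\<close> by every \<open>w \<in> G\<close>.
  If \<open>\<xi>\<close> is not a multiple of \<open>\<delta>\<^sub>g\<close>, comparing coefficients yields, for every \<open>w\<close>, a relation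
  \<open>c w d w\<^sup>-\<^sup>1 = w d' w\<^sup>-\<^sup>1 c'\<close> or \<open>w d w\<^sup>-\<^sup>1 = c\<close> with \<open>c, c', d, d'\<close> in a fixed finite subset of \<open>C - {e}\<close>. Hence
  \<open>P \<delta>\<^sub>g \<in> {0, \<delta>\<^sub>g}\<close> once some \<open>w\<close> violates all these relations, and \<open>M\<close> is then the algebra of
  \<open>{g. P \<delta>\<^sub>g = \<delta>\<^sub>g}\<close>.

  Such a \<open>w\<close> is \<open>y v y\<^sup>-\<^sup>1\<close>, where \<open>y\<close> is a long shortest representative of a coset \<open>C y\<close> and \<open>v\<close>
  is taken from a fixed ball so that \<open>y v y\<^sup>-\<^sup>1\<close> has little cancellation. Both exist because a
  subgroup that fixes a point at infinity has linear growth, whereas a group of linear growth is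
  amenable. All of this rests on one counting principle: if the elements of a finite set
  move a geodesic segment \<open>[e, k]\<close> almost along itself and with small shift, they are conjugated by
  a single element into a ball of fixed radius.
\<close>

section \<open>The Hilbert space of square summable functions as a type\<close>

text \<open>The algebra enters only through \<open>K\<close> and \<open>P\<close>: by a density
  argument, an operator commuting with right translations belongs to \<open>M\<close> as soon as its
  value at \<open>basis \<one>\<close> lies in \<open>K\<close>. Vectors of \<open>K\<close> are not
  known to be bounded convolvers, so a product of two of them is read coefficient by coefficient;
  each coefficient is continuous in both factors, which suffices to pass from \<open>M\<close> to
  \<open>K\<close> and to truncate supports. No boundary is built. That a subgroup fixes a point at
  infinity is expressed by points \<open>p\<close>, one for each \<open>n\<close> and
  \<open>X\<close>, such that \<open>gp p (v \<otimes> p)\<close> is at least \<open>X\<close> for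
  all \<open>v\<close> in the subgroup of length at most \<open>n\<close>. Torsion-freeness makes
  the powers of any \<open>c \<noteq> \<one>\<close> pairwise distinct. If \<open>c\<close> kept a
  long part of a shortest representative \<open>y\<close>, many powers of \<open>c\<close> would do
  so as well, against the counting principle. Non-amenability enters twice, once for
  \<open>y\<close> and once for \<open>v\<close>; the bounds on \<open>v\<close> must not depend on
  \<open>y\<close>, because \<open>y\<close> is taken long compared with them.\<close>

typedef 'a l2 = "ell2 (UNIV :: 'a set)"
  morphisms coef mk
  by (rule exI[of _ "\<lambda>_. 0"]) (simp add: ell2_def)

setup_lifting type_definition_l2

lemma ell2_UNIV_I:
  assumes "\<And>F. finite F \<Longrightarrow> (\<Sum>t\<in>F. (cmod (x t))\<^sup>2) \<le> C"
  shows "x \<in> ell2 UNIV"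
  unfolding ell2_def using assms
  by (auto intro!: nonneg_bdd_above_summable_on bdd_aboveI2[where M = C])

lemma coef_summable: "(\<lambda>t. (cmod (coef x t))\<^sup>2) summable_on A"
  using coef[of x] by (intro summable_on_subset_banach[where A = UNIV and B = A]) (simp_all add: ell2_def)

lemma coef_prod_abs_summable: "(\<lambda>t. norm (coef x t * cnj (coef y t))) summable_on A"
  by (rule abs_summable_product)
    (use coef_summable[of x A] coef_summable[of y A] in \<open>simp_all add: norm_mult power2_eq_square\<close>)

lemma coef_prod_summable: "(\<lambda>t. coef x t * cnj (coef y t)) summable_on A"
  using abs_summable_summable[OF coef_prod_abs_summable] .

lemma ell2_UNIV_add:
  assumes "x \<in> ell2 UNIV" "y \<in> ell2 UNIV"
  shows "(\<lambda>t. x t + y t) \<in> ell2 UNIV"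
proof -
  have "(\<lambda>t. 2 * ((cmod (x t))\<^sup>2 + (cmod (y t))\<^sup>2)) summable_on UNIV"
    using assms by (intro summable_on_cmult_right summable_on_add) (auto simp: ell2_def)
  moreover have "(cmod (x t + y t))\<^sup>2 \<le> 2 * ((cmod (x t))\<^sup>2 + (cmod (y t))\<^sup>2)" for t
  proof -
    have "(cmod (x t + y t))\<^sup>2 \<le> (cmod (x t) + cmod (y t))\<^sup>2"
      by (intro power_mono norm_triangle_ineq) simp
    also have "\<dots> \<le> 2 * ((cmod (x t))\<^sup>2 + (cmod (y t))\<^sup>2)"
      using sum_squares_bound[of "cmod (x t)" "cmod (y t)"] by (simp add: power2_sum)
    finally show ?thesis .
  qed
  ultimately show ?thesis
    using summable_on_comparison_test[of "\<lambda>t. 2 * ((cmod (x t))\<^sup>2 + (cmod (y t))\<^sup>2)" UNIV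
      "\<lambda>t. (cmod (x t + y t))\<^sup>2"] by (simp add: ell2_def)
qed

lemma ell2_UNIV_cmult: "x \<in> ell2 UNIV \<Longrightarrow> (\<lambda>t. c * x t) \<in> ell2 UNIV"
  by (auto simp: ell2_def norm_mult power_mult_distrib intro: summable_on_cmult_right)

text \<open>Indexing by the whole type gives a single type to which the library on real inner
  product spaces applies; an index set \<open>X\<close> reappears as a support condition. The
  complex structure, invisible to the class, returns with \<open>cscale\<close> and
  \<open>cinner\<close>.\<close>

instantiation l2 :: (type) real_inner
begin

lift_definition zero_l2 :: "'a l2" is "\<lambda>_. 0" by (simp add: ell2_def)
lift_definition plus_l2 :: "'a l2 \<Rightarrow> 'a l2 \<Rightarrow> 'a l2" is "\<lambda>x y t. x t + y t" by (rule ell2_UNIV_add)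
lift_definition uminus_l2 :: "'a l2 \<Rightarrow> 'a l2" is "\<lambda>x t. - x t" by (simp add: ell2_def)
lift_definition minus_l2 :: "'a l2 \<Rightarrow> 'a l2 \<Rightarrow> 'a l2" is "\<lambda>x y t. x t - y t"
  using ell2_UNIV_add[OF _ ell2_UNIV_cmult[of _ "-1"]] by simp
lift_definition scaleR_l2 :: "real \<Rightarrow> 'a l2 \<Rightarrow> 'a l2" is "\<lambda>r x t. complex_of_real r * x t"
  by (rule ell2_UNIV_cmult)

definition inner_l2 :: "'a l2 \<Rightarrow> 'a l2 \<Rightarrow> real" where
  "inner_l2 x y = Re (\<Sum>\<^sub>\<infinity>t. coef x t * cnj (coef y t))"
definition norm_l2 :: "'a l2 \<Rightarrow> real" where "norm_l2 x = sqrt (inner x x)"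
definition sgn_l2 :: "'a l2 \<Rightarrow> 'a l2" where "sgn_l2 x = scaleR (inverse (norm x)) x"
definition dist_l2 :: "'a l2 \<Rightarrow> 'a l2 \<Rightarrow> real" where "dist_l2 x y = norm (x - y)"
definition uniformity_l2 :: "('a l2 \<times> 'a l2) filter" where
  "uniformity_l2 = (INF e\<in>{0<..}. principal {(x, y). dist x y < e})"
definition open_l2 :: "'a l2 set \<Rightarrow> bool" where
  "open_l2 U = (\<forall>x\<in>U. eventually (\<lambda>(x', y). x' = x \<longrightarrow> y \<in> U) uniformity)"

lemma inner_l2_self: "inner x x = (\<Sum>\<^sub>\<infinity>t. (cmod (coef x t))\<^sup>2)" for x :: "'a l2"
proof -
  have "inner x x = (\<Sum>\<^sub>\<infinity>t. Re (coef x t * cnj (coef x t)))"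
    unfolding inner_l2_def using coef_prod_summable by (rule infsum_Re[symmetric])
  then show ?thesis by (simp add: complex_norm_square[symmetric])
qed

instance
proof
  fix x y z :: "'a l2" and r s :: real
  show "x + y + z = x + (y + z)" "x + y = y + x" "0 + x = x" "- x + x = 0" "x - y = x + - y"
    "r *\<^sub>R (x + y) = r *\<^sub>R x + r *\<^sub>R y" "(r + s) *\<^sub>R x = r *\<^sub>R x + s *\<^sub>R x" "r *\<^sub>R s *\<^sub>R x = (r * s) *\<^sub>R x"
    "1 *\<^sub>R x = x"
    by (transfer; simp add: algebra_simps)+
  show "inner x y = inner y x"
  proof -
    have "(\<Sum>\<^sub>\<infinity>t. coef y t * cnj (coef x t)) = (\<Sum>\<^sub>\<infinity>t. cnj (coef x t * cnj (coef y t)))"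
      by (simp add: mult.commute)
    then show ?thesis unfolding inner_l2_def by (simp only: infsum_cnj cnj.simps)
  qed
  show "inner (x + y) z = inner x z + inner y z"
    unfolding inner_l2_def plus_l2.rep_eq distrib_right
    by (subst infsum_add[OF coef_prod_summable coef_prod_summable]) simp
  show "inner (r *\<^sub>R x) y = r * inner x y"
    unfolding inner_l2_def scaleR_l2.rep_eq mult.assoc
    by (subst infsum_cmult_right') simp
  show "0 \<le> inner x x" unfolding inner_l2_self by (rule infsum_nonneg) simp
  show "inner x x = 0 \<longleftrightarrow> x = 0"
  proof
    assume "inner x x = 0"
    then have "(cmod (coef x t))\<^sup>2 = 0" for t
      unfolding inner_l2_self
      by (intro nonneg_infsum_le_0D[where A = UNIV and f = "\<lambda>t. (cmod (coef x t))\<^sup>2"]) (auto simp: coef_summable)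
    then have "coef x = coef 0" by (auto simp: zero_l2.rep_eq)
    then show "x = 0" by (simp add: coef_inject)
  qed (simp add: inner_l2_self zero_l2.rep_eq)
qed (simp_all add: norm_l2_def sgn_l2_def dist_l2_def uniformity_l2_def open_l2_def)

end

lemmas coef_simps [simp] = zero_l2.rep_eq plus_l2.rep_eq uminus_l2.rep_eq minus_l2.rep_eq scaleR_l2.rep_eq

lemma l2_eqI: "(\<And>t. coef x t = coef y t) \<Longrightarrow> x = y"
  by (metis coef_inject ext)

lemma coef_sum [simp]: "coef (sum f F) t = (\<Sum>i\<in>F. coef (f i) t)"
  by (induction F rule: infinite_finite_induct) auto

lemma norm_l2_square: "(norm x)\<^sup>2 = (\<Sum>\<^sub>\<infinity>t. (cmod (coef x t))\<^sup>2)"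
  by (simp add: norm_l2_def inner_l2_self infsum_nonneg)

lemma sum_coef_le: "finite F \<Longrightarrow> (\<Sum>t\<in>F. (cmod (coef x t))\<^sup>2) \<le> (norm x)\<^sup>2"
  unfolding norm_l2_square by (rule finite_sum_le_infsum) (auto simp: coef_summable)

lemma norm_l2_leI:
  assumes "\<And>F. finite F \<Longrightarrow> (\<Sum>t\<in>F. (cmod (coef x t))\<^sup>2) \<le> C\<^sup>2" "0 \<le> C"
  shows "norm x \<le> C"
proof -
  have "(norm x)\<^sup>2 \<le> C\<^sup>2" unfolding norm_l2_square
    by (rule infsum_le_finite_sums) (use assms coef_summable in auto)
  then show ?thesis using assms(2) power2_le_imp_le by blast
qed

lemma coef_le_norm: "cmod (coef x t) \<le> norm x"
  using sum_coef_le[of "{t}" x] by (auto intro: power2_le_imp_le)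

lemma bounded_linear_coef: "bounded_linear (\<lambda>x. coef x t)"
  by (rule bounded_linear_intro[where K = 1]) (auto simp: coef_le_norm scaleR_conv_of_real)

text \<open>Coordinates converge. Letting \<open>m\<close> tend to infinity in the Cauchy bound on
  finite partial sums gives both square summability of the limit and convergence in norm.\<close>

instance l2 :: (type) complete_space
proof
  fix X :: "nat \<Rightarrow> 'a l2" assume C: "Cauchy X"
  have "Cauchy (\<lambda>n. coef (X n) t)" for t
    using bounded_linear.Cauchy[OF bounded_linear_coef C] .
  then have "\<exists>y. (\<lambda>n. coef (X n) t) \<longlonglongrightarrow> y" for t by (metis Cauchy_convergent convergent_def)
  then obtain y where y: "\<And>t. (\<lambda>n. coef (X n) t) \<longlonglongrightarrow> y t" by metis
  have close: "\<exists>N. \<forall>n\<ge>N. \<forall>F. finite F \<longrightarrow> (\<Sum>t\<in>F. (cmod (coef (X n) t - y t))\<^sup>2) \<le> e\<^sup>2" if e: "e > 0" for e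
  proof -
    obtain N where N: "\<And>m n. m \<ge> N \<Longrightarrow> n \<ge> N \<Longrightarrow> norm (X n - X m) < e"
      using CauchyD[OF C e] by blast
    have "(\<Sum>t\<in>F. (cmod (coef (X n) t - y t))\<^sup>2) \<le> e\<^sup>2" if "n \<ge> N" "finite F" for n F
    proof (rule tendsto_upperbound)
      show "((\<lambda>m. \<Sum>t\<in>F. (cmod (coef (X n) t - coef (X m) t))\<^sup>2) \<longlongrightarrow>
          (\<Sum>t\<in>F. (cmod (coef (X n) t - y t))\<^sup>2)) sequentially"
        by (intro tendsto_intros y)
      have "(\<Sum>t\<in>F. (cmod (coef (X n) t - coef (X m) t))\<^sup>2) \<le> e\<^sup>2" if "m \<ge> N" for m
      proof -
        have "(\<Sum>t\<in>F. (cmod (coef (X n - X m) t))\<^sup>2) \<le> (norm (X n - X m))\<^sup>2"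
          using sum_coef_le \<open>finite F\<close> by blast
        also have "\<dots> \<le> e\<^sup>2" using N[OF that \<open>n \<ge> N\<close>] by (intro power_mono) auto
        finally show ?thesis by simp
      qed
      then show "\<forall>\<^sub>F m in sequentially. (\<Sum>t\<in>F. (cmod (coef (X n) t - coef (X m) t))\<^sup>2) \<le> e\<^sup>2"
        by (auto simp: eventually_sequentially)
    qed simp
    then show ?thesis by blast
  qed
  obtain N where "\<And>F. finite F \<Longrightarrow> (\<Sum>t\<in>F. (cmod (coef (X N) t - y t))\<^sup>2) \<le> 1\<^sup>2"
    using close[of 1] by auto
  then have "(\<lambda>t. coef (X N) t - y t) \<in> ell2 UNIV" by (rule ell2_UNIV_I)
  then have "(\<lambda>t. coef (X N) t + (-1) * (coef (X N) t - y t)) \<in> ell2 UNIV"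
    by (intro ell2_UNIV_add ell2_UNIV_cmult coef)
  then have y2: "coef (mk y) = y" by (simp add: mk_inverse)
  have "X \<longlonglongrightarrow> mk y"
  proof (rule LIMSEQ_I)
    fix e :: real assume "e > 0"
    then obtain N where N: "\<And>n F. n \<ge> N \<Longrightarrow> finite F \<Longrightarrow> (\<Sum>t\<in>F. (cmod (coef (X n) t - y t))\<^sup>2) \<le> (e / 2)\<^sup>2"
      using close[of "e / 2"] by auto
    have "norm (X n - mk y) \<le> e / 2" if "n \<ge> N" for n
      using N[OF that] \<open>e > 0\<close> by (intro norm_l2_leI) (auto simp: y2)
    then show "\<exists>N. \<forall>n\<ge>N. norm (X n - mk y) < e" using \<open>e > 0\<close> by (metis field_sum_of_halves less_add_same_cancel1 half_gt_zero le_less_trans)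
  qed
  then show "convergent X" by (auto simp: convergent_def)
qed

lift_definition cscale :: "complex \<Rightarrow> 'a l2 \<Rightarrow> 'a l2" is "\<lambda>c x t. c * x t" by (rule ell2_UNIV_cmult)

lift_definition basis :: "'a \<Rightarrow> 'a l2" is "\<lambda>s t. if t = s then 1 else 0"
proof (rule ell2_UNIV_I)
  fix s :: 'a and F :: "'a set" assume "finite F"
  then show "(\<Sum>t\<in>F. (cmod (if t = s then 1 else 0))\<^sup>2) \<le> 1"
    by (simp add: if_distrib[of cmod] if_distrib[of "\<lambda>x. x\<^sup>2"] cong: if_cong)
qed

lemmas coef_simps' [simp] = cscale.rep_eq basis.rep_eq

definition cinner :: "'a l2 \<Rightarrow> 'a l2 \<Rightarrow> complex" where
  "cinner x y = (\<Sum>\<^sub>\<infinity>t. coef x t * cnj (coef y t))"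

lemma inner_eq_Re: "inner x y = Re (cinner x y)"
  by (simp add: inner_l2_def cinner_def)

lemma cinner_cscale_left: "cinner (cscale c x) y = c * cinner x y"
  by (simp add: cinner_def mult.assoc infsum_cmult_right')

lemma cinner_commute: "cinner y x = cnj (cinner x y)"
  by (simp add: cinner_def infsum_cnj[symmetric] mult.commute del: infsum_cnj)

lemma cinner_add_left: "cinner (x + y) z = cinner x z + cinner y z"
  unfolding cinner_def plus_l2.rep_eq distrib_right by (rule infsum_add[OF coef_prod_summable coef_prod_summable])

lemma cinner_zero_left [simp]: "cinner 0 y = 0"
  by (simp add: cinner_def)

text \<open>Adjunction and projection facts come for the real inner product; testing with
  \<open>c = 1\<close> and \<open>c = \<i>\<close> recovers the real and imaginary parts of the
  complex one.\<close>

lemma cinner_eqI: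
  assumes "\<And>c. inner (cscale c x) y = inner (cscale c x') y'"
  shows "cinner x y = cinner x' y'"
  using assms[of 1] assms[of "\<i>"] by (simp add: inner_eq_Re cinner_cscale_left complex_eq_iff)

lemma cinner_basis [simp]: "cinner x (basis t) = coef x t"
proof -
  have "cinner x (basis t) = (\<Sum>\<^sub>\<infinity>s\<in>{t}. coef x s * cnj (coef (basis t) s))"
    unfolding cinner_def by (rule infsum_cong_neutral) auto
  then show ?thesis by simp
qed

lemma norm_cscale [simp]: "norm (cscale c x) = cmod c * norm x"
proof -
  have "(norm (cscale c x))\<^sup>2 = (cmod c * norm x)\<^sup>2"
    unfolding norm_l2_square by (simp add: power_mult_distrib norm_mult infsum_cmult_right' norm_l2_square)
  then show ?thesis by (metis norm_ge_zero power2_eq_imp_eq mult_nonneg_nonneg)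
qed

lemma bounded_linear_cscale: "bounded_linear (cscale c)"
  by (rule bounded_linear_intro[where K = "cmod c"])
    (auto intro!: l2_eqI simp: algebra_simps)

lemma cmod_cinner_le: "cmod (cinner x y) \<le> norm x * norm y"
proof (cases "cinner x y = 0")
  case False
  define c where "c = cnj (cinner x y) / cmod (cinner x y)"
  have c: "cmod c = 1" using False by (simp add: c_def norm_divide)
  have "c * cinner x y = cmod (cinner x y)"
    using False complex_norm_square[of "cinner x y"]
    by (simp add: c_def power2_eq_square field_simps)
  then have "cmod (cinner x y) = inner (cscale c x) y"
    by (simp add: inner_eq_Re cinner_cscale_left)
  also have "\<dots> \<le> norm (cscale c x) * norm y" by (rule norm_cauchy_schwarz)
  finally show ?thesis using c by simp
qed simp

lemma has_sum_basis: "((\<lambda>t. cscale (coef x t) (basis t)) has_sum x) UNIV"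
  unfolding has_sum_def
proof (rule tendstoI)
  fix e :: real assume "e > 0"
  define n2 where "n2 = (norm x)\<^sup>2"
  have "((\<lambda>t. (cmod (coef x t))\<^sup>2) has_sum n2) UNIV"
    unfolding n2_def norm_l2_square using coef_summable by (rule has_sum_infsum)
  then have "\<forall>\<^sub>F F in finite_subsets_at_top UNIV. (\<Sum>t\<in>F. (cmod (coef x t))\<^sup>2) > n2 - (e / 2)\<^sup>2"
    unfolding has_sum_def by (rule order_tendstoD) (use \<open>e > 0\<close> in simp)
  moreover have "\<forall>\<^sub>F F in finite_subsets_at_top (UNIV :: 'a set). finite F"
    by (rule eventually_finite_subsets_at_top_weakI) simp
  ultimately show "\<forall>\<^sub>F F in finite_subsets_at_top UNIV. dist (\<Sum>t\<in>F. cscale (coef x t) (basis t)) x < e"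
  proof eventually_elim
    case (elim F)
    define s where "s = (\<Sum>t\<in>F. cscale (coef x t) (basis t))"
    have s: "coef s t = (if t \<in> F then coef x t else 0)" for t
      using elim(2) by (simp add: s_def if_distrib[of "(*) _"] sum.delta cong: if_cong)
    have "norm (s - x) \<le> e / 2"
    proof (rule norm_l2_leI)
      fix F' :: "'a set" assume F': "finite F'"
      have "(\<Sum>t\<in>F'. (cmod (coef (s - x) t))\<^sup>2) = (\<Sum>t\<in>F' - F. (cmod (coef x t))\<^sup>2)"
        using F' by (intro sum.mono_neutral_cong_right) (auto simp: s)
      also have "\<dots> = (\<Sum>t\<in>F' \<union> F. (cmod (coef x t))\<^sup>2) - (\<Sum>t\<in>F. (cmod (coef x t))\<^sup>2)"
        using F' elim(2) by (simp add: sum_diff[symmetric] Un_Diff)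
      also have "\<dots> \<le> (e / 2)\<^sup>2" using sum_coef_le[of "F' \<union> F" x] F' elim by (simp add: n2_def)
      finally show "(\<Sum>t\<in>F'. (cmod (coef (s - x) t))\<^sup>2) \<le> (e / 2)\<^sup>2" .
    qed (use \<open>e > 0\<close> in simp)
    then show ?case using \<open>e > 0\<close> by (simp add: s_def dist_norm)
  qed
qed

lemma has_sum_linear_image:
  assumes "bounded_linear f" "\<And>c x. f (cscale c x) = cscale c (f x)"
  shows "((\<lambda>t. cscale (coef x t) (f (basis t))) has_sum f x) UNIV"
  using has_sum_bounded_linear[OF assms(1) has_sum_basis[of x]] assms(2) by simp

lemma linear_eq_on_basis:
  assumes "bounded_linear f" "\<And>c x. f (cscale c x) = cscale c (f x)"
    and "bounded_linear g" "\<And>c x. g (cscale c x) = cscale c (g x)"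
    and eq: "\<And>t. t \<in> X \<Longrightarrow> f (basis t) = g (basis t)" and x: "\<And>t. t \<notin> X \<Longrightarrow> coef x t = 0"
  shows "f x = g x"
proof -
  have "cscale (coef x t) (f (basis t)) = cscale (coef x t) (g (basis t))" for t
    using eq[of t] x[of t] by (cases "t \<in> X") (auto intro!: l2_eqI)
  then show ?thesis
    using has_sum_linear_image[OF assms(1,2), of x] has_sum_linear_image[OF assms(3,4), of x]
    by (auto dest: has_sum_unique)
qed

text \<open>Every finite superset \<open>F'\<close> of \<open>F\<close> is allowed, so that further
  prescribed points can be added to the truncation set later.\<close>

lemma finite_truncation:
  assumes "e > 0"
  obtains F where "finite F"
    and "\<And>F' y. F \<subseteq> F' \<Longrightarrow> finite F' \<Longrightarrow> (\<And>t. coef y t = (if t \<in> F' then coef x t else 0)) \<Longrightarrow> norm (x - y) < e"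
proof -
  have "\<forall>\<^sub>F F in finite_subsets_at_top UNIV. dist (\<Sum>t\<in>F. cscale (coef x t) (basis t)) x < e"
    using has_sum_basis[of x] assms unfolding has_sum_def by (rule tendstoD)
  then obtain F where F: "finite F"
    "\<And>F'. F \<subseteq> F' \<Longrightarrow> finite F' \<Longrightarrow> dist (\<Sum>t\<in>F'. cscale (coef x t) (basis t)) x < e"
    by (auto simp: eventually_finite_subsets_at_top)
  show ?thesis
  proof (rule that[OF F(1)])
    fix F' y assume *: "F \<subseteq> F'" "finite F'" "\<And>t. coef y t = (if t \<in> F' then coef x t else 0)"
    then have "y = (\<Sum>t\<in>F'. cscale (coef x t) (basis t))"
      by (intro l2_eqI) (simp add: if_distrib[of "(*) _"] sum.delta cong: if_cong)
    then show "norm (x - y) < e" using F(2)[OF *(1,2)] by (simp add: dist_norm norm_minus_commute)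
  qed
qed

section \<open>Orthogonal projection onto a closed subspace\<close>

lemma orthogonal_projection_exists:
  fixes K :: "'a :: {real_inner, complete_space} set"
  assumes K: "subspace K" "closed K"
  shows "\<exists>p\<in>K. \<forall>k\<in>K. inner (x - p) k = 0"
proof -
  define D where "D = (INF k\<in>K. (norm (x - k))\<^sup>2)"
  have K0: "K \<noteq> {}" using K(1) subspace_0 by auto
  have bdd: "bdd_below ((\<lambda>k. (norm (x - k))\<^sup>2) ` K)" by (auto intro: bdd_belowI[of _ 0])
  have D: "D \<le> (norm (x - k))\<^sup>2" if "k \<in> K" for k unfolding D_def using that bdd by (intro cINF_lower)
  have "\<exists>k\<in>K. (norm (x - k))\<^sup>2 < D + 1 / real (Suc n)" for n
    using cINF_less_iff[OF K0 bdd, of "D + 1 / real (Suc n)"] unfolding D_def[symmetric] by simp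
  then obtain k where k: "\<And>n. k n \<in> K" "\<And>n. (norm (x - k n))\<^sup>2 < D + 1 / real (Suc n)" by metis
  \<comment> \<open>Parallelogram law at the midpoint of \<open>k n\<close> and \<open>k m\<close>,
    whose squared distance to \<open>x\<close> is at least \<open>D\<close>.\<close>
  have par: "(norm (k n - k m))\<^sup>2 \<le> 2 / real (Suc n) + 2 / real (Suc m)" for m n
  proof -
    have "(1/2) *\<^sub>R (k n + k m) \<in> K" using k K(1) by (intro subspace_mul subspace_add) auto
    then have "D \<le> (norm (x - (1/2) *\<^sub>R (k n + k m)))\<^sup>2" by (rule D)
    moreover have "4 * (norm (x - (1/2) *\<^sub>R (k n + k m)))\<^sup>2 + (norm (k n - k m))\<^sup>2
      = 2 * (norm (x - k n))\<^sup>2 + 2 * (norm (x - k m))\<^sup>2"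
      unfolding power2_norm_eq_inner by (simp add: algebra_simps inner_commute)
    ultimately show ?thesis using k(2)[of n] k(2)[of m] by simp
  qed
  have "Cauchy k"
  proof (rule CauchyI)
    fix e :: real assume "e > 0"
    obtain N where N: "4 / e\<^sup>2 < real N" using reals_Archimedean2 by blast
    have "norm (k m - k n) < e" if "m \<ge> N" "n \<ge> N" for m n
    proof -
      have "4 / e\<^sup>2 < real (Suc m)" "4 / e\<^sup>2 < real (Suc n)" using N that by linarith+
      then have "2 / real (Suc m) < e\<^sup>2 / 2" "2 / real (Suc n) < e\<^sup>2 / 2"
        using \<open>e > 0\<close> by (simp_all add: field_simps)
      then have "(norm (k m - k n))\<^sup>2 < e\<^sup>2" using par[of m n] by simp
      then show ?thesis using \<open>e > 0\<close> by (simp add: power2_less_imp_less)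
    qed
    then show "\<exists>M. \<forall>m\<ge>M. \<forall>n\<ge>M. norm (k m - k n) < e" by blast
  qed
  then obtain p where p: "k \<longlonglongrightarrow> p" using Cauchy_convergent convergent_def by blast
  have pK: "p \<in> K" using closed_sequentially[OF K(2)] k p by blast
  have "(\<lambda>n. (norm (x - k n))\<^sup>2) \<longlonglongrightarrow> (norm (x - p))\<^sup>2" by (intro tendsto_intros p)
  moreover have "(\<lambda>n. D + 1 / real (Suc n)) \<longlonglongrightarrow> D + 0"
    by (intro tendsto_intros LIMSEQ_Suc[OF lim_1_over_n])
  ultimately have "(norm (x - p))\<^sup>2 \<le> D + 0"
    by (rule LIMSEQ_le) (use k(2) in \<open>auto intro: less_imp_le\<close>)
  then have min: "(norm (x - p))\<^sup>2 \<le> (norm (x - q))\<^sup>2" if "q \<in> K" for q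
    using D[OF that] by linarith
  have "inner (x - p) u = 0" if u: "u \<in> K" for u
  proof (cases "u = 0")
    case False
    \<comment> \<open>The multiple of \<open>u\<close> closest to \<open>x - p\<close>; a nonzero
      inner product would contradict the minimality of \<open>p\<close>.\<close>
    define a where "a = inner (x - p) u / inner u u"
    have "p + a *\<^sub>R u \<in> K" using pK u K(1) by (intro subspace_add subspace_mul)
    then have "(norm (x - p))\<^sup>2 \<le> (norm ((x - p) - a *\<^sub>R u))\<^sup>2" using min by (simp add: diff_diff_add)
    also have "\<dots> = (norm (x - p))\<^sup>2 - 2 * a * inner (x - p) u + a * a * inner u u"
      unfolding power2_norm_eq_inner by (simp add: inner_diff inner_commute algebra_simps)
    also have "a * a * inner u u = a * inner (x - p) u" using False by (simp add: a_def)
    finally have "a * inner (x - p) u \<le> 0" by simp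
    then have "(inner (x - p) u)\<^sup>2 / inner u u \<le> 0" by (simp add: a_def power2_eq_square)
    moreover have "0 < inner u u" using False by simp
    ultimately have "(inner (x - p) u)\<^sup>2 \<le> 0" by (auto simp: divide_le_0_iff)
    then show ?thesis by simp
  qed simp
  then show ?thesis using pK by blast
qed

definition proj :: "'a :: real_inner set \<Rightarrow> 'a \<Rightarrow> 'a" where
  "proj K x = (SOME p. p \<in> K \<and> (\<forall>k\<in>K. inner (x - p) k = 0))"

locale closed_subspace =
  fixes K :: "'a :: {real_inner, complete_space} set"
  assumes subspace: "subspace K" and closed: "closed K"
begin

lemma proj_in: "proj K x \<in> K" and proj_orth: "k \<in> K \<Longrightarrow> inner (x - proj K x) k = 0"
proof -
  have "\<exists>p. p \<in> K \<and> (\<forall>k\<in>K. inner (x - p) k = 0)"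
    using orthogonal_projection_exists[OF subspace closed, of x] by blast
  from someI_ex[OF this] have "proj K x \<in> K \<and> (\<forall>k\<in>K. inner (x - proj K x) k = 0)"
    unfolding proj_def .
  then show "proj K x \<in> K" "k \<in> K \<Longrightarrow> inner (x - proj K x) k = 0" by auto
qed

lemma proj_eqI: "p \<in> K \<Longrightarrow> (\<And>k. k \<in> K \<Longrightarrow> inner (x - p) k = 0) \<Longrightarrow> proj K x = p"
proof -
  assume p: "p \<in> K" "\<And>k. k \<in> K \<Longrightarrow> inner (x - p) k = 0"
  define d where "d = proj K x - p"
  have "d \<in> K" using p proj_in subspace by (simp add: d_def subspace_diff)
  then have "inner ((x - p) - (x - proj K x)) d = 0"
    using p(2)[of d] proj_orth[of d x] by (simp add: inner_diff_left)
  then show ?thesis by (simp add: d_def)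
qed

lemma proj_id: "x \<in> K \<Longrightarrow> proj K x = x"
  by (rule proj_eqI) auto

text \<open>If an operator and its adjoint both preserve \<open>K\<close>, it preserves the
  orthogonal complement too, hence commutes with the projection. Taking scalar multiplication for
  \<open>B\<close> yields complex linearity of the projection.\<close>

lemma proj_commute:
  assumes "linear B" "\<And>x. x \<in> K \<Longrightarrow> B x \<in> K" "\<And>x. x \<in> K \<Longrightarrow> B' x \<in> K"
    and "\<And>x y. inner (B x) y = inner x (B' y)"
  shows "proj K (B x) = B (proj K x)"
proof (rule proj_eqI)
  show "B (proj K x) \<in> K" using assms proj_in by blast
  fix k assume "k \<in> K"
  then show "inner (B x - B (proj K x)) k = 0"
    using proj_orth[of "B' k" x] assms(3) assms(4)[of "x - proj K x" k] by (simp add: linear_diff[OF assms(1)])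
qed

lemma inner_proj: "inner (proj K x) y = inner x (proj K y)"
proof -
  have "inner (x - proj K x) (proj K y) = 0" "inner (y - proj K y) (proj K x) = 0"
    by (simp_all add: proj_in proj_orth)
  then show ?thesis by (simp add: inner_diff_left inner_commute[of y] inner_commute[of "proj K y" "proj K x"])
qed

lemma bounded_linear_proj: "bounded_linear (proj K)"
proof (rule bounded_linear_intro[where K = 1])
  fix x y and r :: real
  show "proj K (x + y) = proj K x + proj K y"
  proof (rule proj_eqI)
    show "proj K x + proj K y \<in> K" using proj_in subspace by (simp add: subspace_add)
    show "inner (x + y - (proj K x + proj K y)) k = 0" if "k \<in> K" for k
      using proj_orth[OF that, of x] proj_orth[OF that, of y] by (simp add: inner_diff_left inner_add_left)
  qed
  show "proj K (r *\<^sub>R x) = r *\<^sub>R proj K x"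
  proof (rule proj_eqI)
    show "r *\<^sub>R proj K x \<in> K" using proj_in subspace by (simp add: subspace_mul)
    show "inner (r *\<^sub>R x - r *\<^sub>R proj K x) k = 0" if "k \<in> K" for k
      using proj_orth[OF that, of x] by (simp add: scaleR_right_diff_distrib[symmetric])
  qed
  have "(norm (proj K x))\<^sup>2 = inner x (proj K x)"
    using proj_orth[OF proj_in, of x x] by (simp add: power2_norm_eq_inner inner_diff_left)
  also have "\<dots> \<le> norm x * norm (proj K x)" by (rule norm_cauchy_schwarz)
  finally have "norm (proj K x) * norm (proj K x) \<le> norm x * norm (proj K x)" by (simp add: power2_eq_square)
  then show "norm (proj K x) \<le> norm x * 1"
    by (cases "proj K x = 0") auto
qed

end

section \<open>Bounded operators and their adjoints\<close>

text \<open>One construction for restriction, translation, inversion, conjugation, and the passage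
  between \<open>'a\<close> and \<open>'a \<times> nat\<close>; it is meaningful when
  \<open>\<phi>\<close> is injective on \<open>X\<close>, since then it does not increase
  norms.\<close>

definition reindex :: "'a set \<Rightarrow> ('a \<Rightarrow> 'b) \<Rightarrow> 'b l2 \<Rightarrow> 'a l2" where
  "reindex X \<phi> x = mk (\<lambda>t. if t \<in> X then coef x (\<phi> t) else 0)"

lemma coef_reindex:
  assumes "inj_on \<phi> X"
  shows "coef (reindex X \<phi> x) t = (if t \<in> X then coef x (\<phi> t) else 0)"
proof -
  have "(\<lambda>t. if t \<in> X then coef x (\<phi> t) else 0) \<in> ell2 UNIV"
  proof (rule ell2_UNIV_I)
    fix F :: "'a set" assume F: "finite F"
    have "(\<Sum>t\<in>F. (cmod (if t \<in> X then coef x (\<phi> t) else 0))\<^sup>2) = (\<Sum>t\<in>F \<inter> X. (cmod (coef x (\<phi> t)))\<^sup>2)"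
      using F by (intro sum.mono_neutral_cong_right) auto
    also have "\<dots> = (\<Sum>s\<in>\<phi> ` (F \<inter> X). (cmod (coef x s))\<^sup>2)"
      using inj_on_subset[OF assms, of "F \<inter> X"] by (simp add: sum.reindex)
    also have "\<dots> \<le> (norm x)\<^sup>2" using F by (intro sum_coef_le) auto
    finally show "(\<Sum>t\<in>F. (cmod (if t \<in> X then coef x (\<phi> t) else 0))\<^sup>2) \<le> (norm x)\<^sup>2" .
  qed
  then show ?thesis by (simp add: reindex_def mk_inverse)
qed

lemma norm_reindex_le:
  assumes "inj_on \<phi> X"
  shows "norm (reindex X \<phi> x) \<le> norm x"
proof (rule norm_l2_leI)
  fix F :: "'a set" assume F: "finite F"
  have "(\<Sum>t\<in>F. (cmod (coef (reindex X \<phi> x) t))\<^sup>2) = (\<Sum>t\<in>F \<inter> X. (cmod (coef x (\<phi> t)))\<^sup>2)"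
    using F by (intro sum.mono_neutral_cong_right) (auto simp: coef_reindex[OF assms])
  also have "\<dots> = (\<Sum>s\<in>\<phi> ` (F \<inter> X). (cmod (coef x s))\<^sup>2)"
    using inj_on_subset[OF assms, of "F \<inter> X"] by (simp add: sum.reindex)
  also have "\<dots> \<le> (norm x)\<^sup>2" using F by (intro sum_coef_le) auto
  finally show "(\<Sum>t\<in>F. (cmod (coef (reindex X \<phi> x) t))\<^sup>2) \<le> (norm x)\<^sup>2" .
qed simp

lemma bounded_linear_reindex: "inj_on \<phi> X \<Longrightarrow> bounded_linear (reindex X \<phi>)"
  by (rule bounded_linear_intro[where K = 1])
    (auto intro!: l2_eqI simp: coef_reindex norm_reindex_le)

lemma scaleR_eq_cscale: "r *\<^sub>R x = cscale (of_real r) x"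
  by (rule l2_eqI) simp

lemma reindex_cscale: "inj_on \<phi> X \<Longrightarrow> reindex X \<phi> (cscale c x) = cscale c (reindex X \<phi> x)"
  by (auto intro!: l2_eqI simp: coef_reindex)

lemma cinner_reindex:
  assumes "\<And>t. t \<in> X \<Longrightarrow> \<phi> t \<in> Y \<and> \<psi> (\<phi> t) = t" "\<And>s. s \<in> Y \<Longrightarrow> \<psi> s \<in> X \<and> \<phi> (\<psi> s) = s"
  shows "cinner (reindex X \<phi> x) y = cinner x (reindex Y \<psi> y)"
proof -
  have bij: "bij_betw \<phi> X Y" by (rule bij_betw_byWitness[where f' = \<psi>]) (use assms in auto)
  have inj: "inj_on \<phi> X" "inj_on \<psi> Y" using assms by (metis inj_on_def)+
  have "cinner (reindex X \<phi> x) y = (\<Sum>\<^sub>\<infinity>t\<in>X. coef x (\<phi> t) * cnj (coef y (\<psi> (\<phi> t))))"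
    unfolding cinner_def by (rule infsum_cong_neutral) (auto simp: coef_reindex[OF inj(1)] assms)
  also have "\<dots> = (\<Sum>\<^sub>\<infinity>s\<in>Y. coef x s * cnj (coef y (\<psi> s)))"
    by (rule infsum_reindex_bij_betw[OF bij])
  also have "\<dots> = cinner x (reindex Y \<psi> y)"
    unfolding cinner_def by (rule infsum_cong_neutral) (auto simp: coef_reindex[OF inj(2)])
  finally show ?thesis .
qed

lemmas inner_reindex = cinner_reindex[THEN arg_cong[where f = Re], folded inner_eq_Re]

definition restrict_l2 :: "'a set \<Rightarrow> 'a l2 \<Rightarrow> 'a l2" where
  "restrict_l2 X = reindex X (\<lambda>t. t)"

lemma coef_restrict [simp]: "coef (restrict_l2 X x) t = (if t \<in> X then coef x t else 0)"
  by (simp add: restrict_l2_def coef_reindex)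

lemma cinner_restrict: "cinner (restrict_l2 X x) y = cinner x (restrict_l2 X y)"
  unfolding restrict_l2_def by (rule cinner_reindex) auto

lemma restrict_id: "(\<And>t. t \<notin> X \<Longrightarrow> coef x t = 0) \<Longrightarrow> restrict_l2 X x = x"
  by (auto intro!: l2_eqI)

lemma restrict_restrict [simp]: "restrict_l2 X (restrict_l2 X x) = restrict_l2 X x"
  by (auto intro!: l2_eqI)

lemma ell2_subset_UNIV: "ell2 X \<subseteq> ell2 UNIV"
proof
  fix x assume "x \<in> ell2 X"
  then have "\<forall>t. t \<notin> X \<longrightarrow> x t = 0" "(\<lambda>t. (cmod (x t))\<^sup>2) summable_on X" by (auto simp: ell2_def)
  then have "(\<lambda>t. (cmod (x t))\<^sup>2) summable_on UNIV"
    by (subst summable_on_cong_neutral[where T = X and g = "\<lambda>t. (cmod (x t))\<^sup>2"]) auto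
  then show "x \<in> ell2 UNIV" by (simp add: ell2_def)
qed

lemma coef_mk: "x \<in> ell2 X \<Longrightarrow> coef (mk x) = x"
  using ell2_subset_UNIV by (intro mk_inverse) auto

lemma mk_coef [simp]: "mk (coef x) = x"
  by (rule coef_inverse)

lemma coef_in_ell2: "coef x \<in> ell2 X \<longleftrightarrow> (\<forall>t. t \<notin> X \<longrightarrow> coef x t = 0)"
  using coef_summable by (auto simp: ell2_def)

lemma restrict_mk: "x \<in> ell2 X \<Longrightarrow> restrict_l2 X (mk x) = mk x"
  by (rule restrict_id) (simp add: coef_mk, simp add: ell2_def)

lemma ell2_inner_eq:
  assumes "x \<in> ell2 X"
  shows "ell2_inner X x (coef y) = cinner (mk x) y"
  unfolding ell2_inner_def cinner_def coef_mk[OF assms]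
  by (rule infsum_cong_neutral) (use assms in \<open>auto simp: ell2_def\<close>)

lemma ell2_norm_eq:
  assumes "x \<in> ell2 X"
  shows "ell2_norm X x = norm (mk x)"
proof -
  have "(\<Sum>\<^sub>\<infinity>t\<in>X. (cmod (x t))\<^sup>2) = (norm (mk x))\<^sup>2"
    unfolding norm_l2_square coef_mk[OF assms]
    by (rule infsum_cong_neutral) (use assms in \<open>auto simp: ell2_def\<close>)
  then show ?thesis by (simp add: ell2_norm_def)
qed

text \<open>\<open>op_l2\<close> and \<open>op_fun\<close> are the dictionary between operators on
  functions and maps of the type \<open>l2\<close>. The restrictions to \<open>X\<close> make both
  directions total and compatible with the normalization outside \<open>ell2 X\<close>.\<close>

definition op_l2 :: "'a set \<Rightarrow> 'a operator \<Rightarrow> 'a l2 \<Rightarrow> 'a l2" where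
  "op_l2 X T x = mk (T (coef (restrict_l2 X x)))"

definition op_fun :: "'a set \<Rightarrow> ('a l2 \<Rightarrow> 'a l2) \<Rightarrow> 'a operator" where
  "op_fun X B x = (if x \<in> ell2 X then coef (restrict_l2 X (B (mk x))) else (\<lambda>t. 0))"

lemma coef_restrict_ell2 [simp]: "coef (restrict_l2 X x) \<in> ell2 X"
  by (simp add: coef_in_ell2)

lemma bounded_opsD:
  assumes "T \<in> bounded_ops X"
  shows "x \<in> ell2 X \<Longrightarrow> T x \<in> ell2 X"
    and "x \<notin> ell2 X \<Longrightarrow> T x = (\<lambda>t. 0)"
    and "x \<in> ell2 X \<Longrightarrow> y \<in> ell2 X \<Longrightarrow> T (\<lambda>t. x t + y t) = (\<lambda>t. T x t + T y t)"
    and "x \<in> ell2 X \<Longrightarrow> T (\<lambda>t. c * x t) = (\<lambda>t. c * T x t)"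
    and "\<exists>C. \<forall>x\<in>ell2 X. ell2_norm X (T x) \<le> C * ell2_norm X x"
  using assms unfolding bounded_ops_def by blast+

lemma op_l2_restrict [simp]: "op_l2 X T (restrict_l2 X x) = op_l2 X T x"
  by (simp add: op_l2_def)

lemma coef_op_l2:
  assumes "T \<in> bounded_ops X"
  shows "coef (op_l2 X T x) = T (coef (restrict_l2 X x))"
  unfolding op_l2_def by (rule coef_mk[of _ X]) (use assms in \<open>auto simp: bounded_ops_def\<close>)

lemma coef_op_l2_mk:
  assumes "T \<in> bounded_ops X" "x \<in> ell2 X"
  shows "coef (op_l2 X T (mk x)) = T x"
  using assms by (simp add: coef_op_l2 restrict_mk coef_mk)

lemma op_l2_outside: "T \<in> bounded_ops X \<Longrightarrow> t \<notin> X \<Longrightarrow> coef (op_l2 X T x) t = 0"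
  using bounded_opsD(1)[OF _ coef_restrict_ell2[of X x]] by (auto simp: coef_op_l2 ell2_def)

lemma op_l2_cscale:
  assumes "T \<in> bounded_ops X"
  shows "op_l2 X T (cscale c x) = cscale c (op_l2 X T x)"
proof (rule l2_eqI)
  fix t
  have "coef (restrict_l2 X (cscale c x)) = (\<lambda>t. c * coef (restrict_l2 X x) t)" by auto
  then show "coef (op_l2 X T (cscale c x)) t = coef (cscale c (op_l2 X T x)) t"
    unfolding coef_op_l2[OF assms] cscale.rep_eq by (simp only: bounded_opsD(4)[OF assms coef_restrict_ell2])
qed

lemma bounded_linear_op_l2:
  assumes "T \<in> bounded_ops X"
  shows "bounded_linear (op_l2 X T)"
proof -
  obtain C where C: "\<And>x. x \<in> ell2 X \<Longrightarrow> ell2_norm X (T x) \<le> C * ell2_norm X x"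
    using bounded_opsD(5)[OF assms] by blast
  have T: "T x \<in> ell2 X" if "x \<in> ell2 X" for x using bounded_opsD(1)[OF assms that] .
  show ?thesis
  proof (rule bounded_linear_intro[where K = "\<bar>C\<bar>"])
    fix x y and r :: real
    have "coef (restrict_l2 X (x + y)) = (\<lambda>t. coef (restrict_l2 X x) t + coef (restrict_l2 X y) t)" by auto
    then show "op_l2 X T (x + y) = op_l2 X T x + op_l2 X T y"
      by (intro l2_eqI)
        (simp only: coef_op_l2[OF assms] plus_l2.rep_eq bounded_opsD(3)[OF assms coef_restrict_ell2 coef_restrict_ell2])
    show "op_l2 X T (r *\<^sub>R x) = r *\<^sub>R op_l2 X T x"
      using op_l2_cscale[OF assms] by (simp add: scaleR_eq_cscale)
    have "norm (op_l2 X T x) = ell2_norm X (T (coef (restrict_l2 X x)))"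
      unfolding op_l2_def by (rule ell2_norm_eq[symmetric]) (simp add: T)
    also have "\<dots> \<le> C * ell2_norm X (coef (restrict_l2 X x))" by (rule C) simp
    also have "\<dots> = C * norm (restrict_l2 X x)" by (simp add: ell2_norm_eq)
    also have "\<dots> \<le> \<bar>C\<bar> * norm (restrict_l2 X x)" by (intro mult_right_mono) auto
    also have "\<dots> \<le> \<bar>C\<bar> * norm x"
      by (intro mult_left_mono) (auto simp: restrict_l2_def norm_reindex_le)
    finally show "norm (op_l2 X T x) \<le> norm x * \<bar>C\<bar>" by (simp add: mult.commute)
  qed
qed

lemma op_fun_bounded:
  assumes "bounded_linear B" "\<And>c x. B (cscale c x) = cscale c (B x)"
  shows "op_fun X B \<in> bounded_ops X"
proof -
  interpret bounded_linear B by fact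
  obtain K where K: "\<And>x. norm (B x) \<le> norm x * K" using bounded by blast
  have ell2_add: "(\<lambda>t. x t + y t) \<in> ell2 X" and mk_add: "mk (\<lambda>t. x t + y t) = mk x + mk y"
    if "x \<in> ell2 X" "y \<in> ell2 X" for x y
  proof -
    have e: "coef (mk x + mk y) = (\<lambda>t. x t + y t)" using that by (auto simp: coef_mk)
    have "coef (mk x + mk y) \<in> ell2 X" 
      using that coef_mk[OF that(1)] coef_mk[OF that(2)] by (subst coef_in_ell2) (auto simp: ell2_def)
    then show "(\<lambda>t. x t + y t) \<in> ell2 X" unfolding e .
    show "mk (\<lambda>t. x t + y t) = mk x + mk y" using e by (metis mk_coef)
  qed
  have ell2_cm: "(\<lambda>t. c * x t) \<in> ell2 X" and mk_cm: "mk (\<lambda>t. c * x t) = cscale c (mk x)"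
    if "x \<in> ell2 X" for x c
  proof -
    have e: "coef (cscale c (mk x)) = (\<lambda>t. c * x t)" using that by (auto simp: coef_mk)
    have "coef (cscale c (mk x)) \<in> ell2 X" 
      using that coef_mk[OF that] by (subst coef_in_ell2) (auto simp: ell2_def)
    then show "(\<lambda>t. c * x t) \<in> ell2 X" unfolding e .
    show "mk (\<lambda>t. c * x t) = cscale c (mk x)" using e by (metis mk_coef)
  qed
  have "ell2_norm X (op_fun X B x) \<le> K * ell2_norm X x" if "x \<in> ell2 X" for x
  proof -
    have "ell2_norm X (op_fun X B x) = norm (restrict_l2 X (B (mk x)))"
      using that by (simp add: op_fun_def ell2_norm_eq)
    also have "\<dots> \<le> norm (B (mk x))" by (simp add: restrict_l2_def norm_reindex_le)
    also have "\<dots> \<le> norm (mk x) * K" by (rule K)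
    finally show ?thesis using that by (simp add: ell2_norm_eq mult.commute)
  qed
  then show ?thesis
    unfolding bounded_ops_def
    by (auto simp: op_fun_def ell2_add ell2_cm mk_add mk_cm add assms(2) if_distrib fun_eq_iff)
qed

lemma op_l2_op_fun:
  "op_fun X B \<in> bounded_ops X \<Longrightarrow> op_l2 X (op_fun X B) x = restrict_l2 X (B (restrict_l2 X x))"
  by (simp add: op_l2_def op_fun_def)

text \<open>The coefficients of \<open>B' y\<close> are forced: at \<open>t\<close> they are
  \<open>cinner y (B (basis t))\<close>. They are square summable because testing \<open>B\<close>
  on their own finite truncation \<open>z\<close> bounds the norm of \<open>z\<close> by that of
  \<open>y\<close>, uniformly in the truncation.\<close>

lemma l2_adjoint_exists:
  assumes B: "bounded_linear B" "\<And>c x. B (cscale c x) = cscale c (B x)"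
  obtains B' :: "'b l2 \<Rightarrow> 'a l2" where "bounded_linear B'" "\<And>c x. B' (cscale c x) = cscale c (B' x)"
    "\<And>x y. cinner (B x) y = cinner x (B' y)"
proof -
  interpret bounded_linear B by fact
  obtain K where K: "K \<ge> 0" "\<And>x. norm (B x) \<le> norm x * K" using nonneg_bounded by blast
  define f where "f y t = cinner y (B (basis t))" for y t
  have key: "(\<Sum>t\<in>F. (cmod (f y t))\<^sup>2) \<le> (norm y * K)\<^sup>2" if F: "finite F" for F y
  proof -
    define z where "z = (\<Sum>t\<in>F. cscale (f y t) (basis t))"
    have cz: "coef z t = (if t \<in> F then f y t else 0)" for t
      using F by (simp add: z_def if_distrib[of "(*) _"] sum.delta cong: if_cong)
    define S where "S = (\<Sum>t\<in>F. (cmod (f y t))\<^sup>2)"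
    have nz: "(norm z)\<^sup>2 = S"
    proof -
      have "(norm z)\<^sup>2 = (\<Sum>\<^sub>\<infinity>t\<in>F. (cmod (f y t))\<^sup>2)"
        unfolding norm_l2_square by (rule infsum_cong_neutral) (auto simp: cz)
      then show ?thesis using F by (simp add: S_def)
    qed
    have add_l: "cinner (\<Sum>t\<in>F. g t) y = (\<Sum>t\<in>F. cinner (g t) y)" for g :: "'a \<Rightarrow> 'b l2"
      using F by (induction F rule: finite_induct) (auto simp: cinner_add_left)
    have "cinner (B z) y = (\<Sum>t\<in>F. f y t * cinner (B (basis t)) y)"
      by (simp add: z_def sum B(2) add_l cinner_cscale_left)
    also have "\<dots> = (\<Sum>t\<in>F. of_real ((cmod (f y t))\<^sup>2))"
      by (intro sum.cong refl) (metis cinner_commute complex_norm_square f_def)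
    also have "\<dots> = of_real S" by (simp add: S_def)
    finally have cm: "cinner (B z) y = of_real S" .
    have "0 \<le> S" by (simp add: S_def sum_nonneg)
    then have "cmod (cinner (B z) y) = S" unfolding cm by (simp only: norm_of_real abs_of_nonneg)
    then have "S \<le> norm (B z) * norm y" using cmod_cinner_le by metis
    also have "\<dots> \<le> (norm z * K) * norm y" by (intro mult_right_mono K) simp
    finally have "norm z * norm z \<le> (norm y * K) * norm z" using nz by (simp add: power2_eq_square mult_ac)
    then have "norm z \<le> norm y * K" using K(1) by (cases "norm z = 0") auto
    then have "(norm z)\<^sup>2 \<le> (norm y * K)\<^sup>2" by (intro power_mono) auto
    then show ?thesis using nz by (simp add: S_def)
  qed
  have fin: "f y \<in> ell2 UNIV" for y by (rule ell2_UNIV_I[OF key])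
  define B' where "B' y = mk (f y)" for y
  have cB': "coef (B' y) t = f y t" for y t using fin by (simp add: B'_def mk_inverse)
  have bl: "bounded_linear B'"
  proof (rule bounded_linear_intro[where K = K])
    show "norm (B' y) \<le> norm y * K" for y
      by (rule norm_l2_leI) (use key K in \<open>auto simp: cB'\<close>)
    show "B' (x + y) = B' x + B' y" for x y by (rule l2_eqI) (simp add: cB' f_def cinner_add_left)
    show "B' (r *\<^sub>R x) = r *\<^sub>R B' x" for r x
      by (intro l2_eqI) (simp add: scaleR_eq_cscale cB' f_def cinner_cscale_left)
  qed
  have hom: "B' (cscale c x) = cscale c (B' x)" for c x
    by (rule l2_eqI) (simp add: cB' f_def cinner_cscale_left)
  have "cinner (B x) y = cinner x (B' y)" for x y
  proof -
    have bl: "bounded_linear (\<lambda>x. cinner x y)"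
    proof (rule bounded_linear_intro[where K = "norm y"])
      show "cinner (r *\<^sub>R x) y = r *\<^sub>R cinner x y" for r x
        by (simp add: scaleR_eq_cscale cinner_cscale_left scaleR_conv_of_real)
    qed (auto simp: cinner_add_left cmod_cinner_le)
    have "((\<lambda>t. cinner (cscale (coef x t) (B (basis t))) y) has_sum cinner (B x) y) UNIV"
      using has_sum_bounded_linear[OF bl has_sum_linear_image[OF B, of x]] .
    then have "((\<lambda>t. coef x t * cnj (coef (B' y) t)) has_sum cinner (B x) y) UNIV"
      by (simp add: cinner_cscale_left cB' f_def cinner_commute[of y "B (basis _)"])
    then show ?thesis unfolding cinner_def[of x] by (simp add: infsumI)
  qed
  then show ?thesis using that bl hom by blast
qed

text \<open>The adjoint is defined by a definite description, so existence and uniqueness both have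
  to be supplied; uniqueness is tested against basis vectors.\<close>

lemma adjoint_op:
  assumes T: "T \<in> bounded_ops X"
  shows "adjoint_op X T \<in> bounded_ops X"
    and "cinner (op_l2 X T x) y = cinner x (op_l2 X (adjoint_op X T) y)"
proof -
  obtain B' where B': "bounded_linear B'" "\<And>c x. B' (cscale c x) = cscale c (B' x)"
    "\<And>x y. cinner (op_l2 X T x) y = cinner x (B' y)"
    using l2_adjoint_exists[OF bounded_linear_op_l2[OF T] op_l2_cscale[OF T]] by metis
  define S where "S = op_fun X B'"
  have S: "S \<in> bounded_ops X" unfolding S_def by (rule op_fun_bounded[OF B'(1,2)])
  have TE: "T x \<in> ell2 X" if "x \<in> ell2 X" for x using T that by (auto simp: bounded_ops_def)
  have inner_T: "ell2_inner X (T x) y = cinner (op_l2 X T (mk x)) (mk y)"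
    if "x \<in> ell2 X" "y \<in> ell2 X" for x y
    using ell2_inner_eq[OF TE[OF that(1)], of "mk y"] that coef_op_l2_mk[OF T that(1)]
    by (metis coef_mk mk_coef)
  have inner_S: "ell2_inner X x (S' y) = cinner (mk x) (op_l2 X S' (mk y))"
    if "x \<in> ell2 X" "y \<in> ell2 X" "S' \<in> bounded_ops X" for x y S'
    using ell2_inner_eq[OF that(1), of "op_l2 X S' (mk y)"] coef_op_l2_mk[OF that(3,2)] by simp
  have ex: "S \<in> bounded_ops X \<and> (\<forall>x\<in>ell2 X. \<forall>y\<in>ell2 X. ell2_inner X (T x) y = ell2_inner X x (S y))"
  proof (intro conjI ballI S)
    fix x y assume xy: "x \<in> ell2 X" "y \<in> ell2 X"
    have "cinner (op_l2 X T (mk x)) (mk y) = cinner (restrict_l2 X (mk x)) (B' (mk y))"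
      using B'(3) xy by (simp add: restrict_mk)
    also have "\<dots> = cinner (mk x) (op_l2 X S (mk y))"
      using xy S by (simp add: S_def op_l2_op_fun restrict_mk cinner_restrict[symmetric])
    finally show "ell2_inner X (T x) y = ell2_inner X x (S y)"
      using inner_T[OF xy] inner_S[OF xy S] by simp
  qed
  have uniq: "S' = S''"
    if S': "S' \<in> bounded_ops X" "\<And>x y. x \<in> ell2 X \<Longrightarrow> y \<in> ell2 X \<Longrightarrow> ell2_inner X (T x) y = ell2_inner X x (S' y)"
    and S'': "S'' \<in> bounded_ops X" "\<And>x y. x \<in> ell2 X \<Longrightarrow> y \<in> ell2 X \<Longrightarrow> ell2_inner X (T x) y = ell2_inner X x (S'' y)"
    for S' S''
  proof (rule ext)
    fix y
    show "S' y = S'' y"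
    proof (cases "y \<in> ell2 X")
      case y: True
      show ?thesis
      proof (rule ext)
        fix t
        show "S' y t = S'' y t"
        proof (cases "t \<in> X")
          case True
          have b: "coef (basis t) \<in> ell2 X" unfolding coef_in_ell2 using True by auto
          have "cinner (basis t) (op_l2 X S' (mk y)) = cinner (basis t) (op_l2 X S'' (mk y))"
        using S'(2)[OF b y] S''(2)[OF b y] inner_S[OF b y S'(1)] inner_S[OF b y S''(1)] by (metis mk_coef)
          then have "coef (op_l2 X S' (mk y)) t = coef (op_l2 X S'' (mk y)) t"
            using cinner_basis cinner_commute[of _ "basis t"] by (metis complex_cnj_cnj)
          then show ?thesis using coef_op_l2_mk y S' S'' by metis
        next
          case False
          then show ?thesis using op_l2_outside[OF S'(1) False] op_l2_outside[OF S''(1) False]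
            coef_op_l2_mk[OF S'(1) y] coef_op_l2_mk[OF S''(1) y] by metis
        qed
      qed
    next
      case False
      then show ?thesis using S' S'' by (auto simp: bounded_ops_def)
    qed
  qed
  have "adjoint_op X T = S"
    unfolding adjoint_op_def by (rule the_equality, rule ex) (use uniq ex in blast)
  then show "adjoint_op X T \<in> bounded_ops X" using S by simp
  have "cinner (op_l2 X T x) y = cinner (restrict_l2 X (op_l2 X T (restrict_l2 X x))) y"
    using op_l2_outside[OF T] by (simp add: restrict_id)
  also have "\<dots> = cinner (restrict_l2 X x) (B' (restrict_l2 X y))"
    by (simp only: cinner_restrict[of X "op_l2 X T (restrict_l2 X x)"] B'(3))
  also have "\<dots> = cinner x (op_l2 X (adjoint_op X T) y)"
    using \<open>adjoint_op X T = S\<close> S by (simp add: S_def op_l2_op_fun cinner_restrict)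
  finally show "cinner (op_l2 X T x) y = cinner x (op_l2 X (adjoint_op X T) y)" .
qed

lemma op_l2_comp:
  assumes "T \<in> bounded_ops X"
  shows "op_l2 X (S \<circ> T) x = op_l2 X S (op_l2 X T x)"
  by (simp add: op_l2_def restrict_mk[OF bounded_opsD(1)[OF assms coef_restrict_ell2]]
      coef_mk[OF bounded_opsD(1)[OF assms coef_restrict_ell2]])

section \<open>The density theorem\<close>

text \<open>The topology is only given by a subbase; induction on its generation extracts a basic
  neighbourhood controlled by finitely many matrix coefficients.\<close>

lemma wot_neighbourhood:
  assumes "openin (wot X) U" "S \<in> U"
  shows "\<exists>\<Phi> \<epsilon>. finite \<Phi> \<and> \<Phi> \<subseteq> ell2 X \<times> ell2 X \<and> \<epsilon> > 0 \<and>
    (\<forall>T\<in>bounded_ops X. (\<forall>(x, y)\<in>\<Phi>. cmod (ell2_inner X (T x) y - ell2_inner X (S x) y) < \<epsilon>) \<longrightarrow> T \<in> U)"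
    (is "\<exists>\<Phi> \<epsilon>. ?P \<Phi> \<epsilon> U")
proof -
  from assms(1) have "generate_topology_on
     {{T \<in> bounded_ops X. ell2_inner X (T x) y \<in> V} | x y V. x \<in> ell2 X \<and> y \<in> ell2 X \<and> open V} U"
    unfolding wot_def openin_topology_generated_by_iff .
  then show ?thesis using assms(2)
  proof (induction U rule: generate_topology_on.induct)
    case (Int U V)
    then have SU: "S \<in> U" and SV: "S \<in> V" by blast+
    obtain \<Phi> \<epsilon> where U: "?P \<Phi> \<epsilon> U" using Int.IH(1)[OF SU] by (elim exE) (rule that)
    obtain \<Psi> \<eta> where V: "?P \<Psi> \<eta> V" using Int.IH(2)[OF SV] by (elim exE) (rule that)
    have "T \<in> U \<inter> V" if "T \<in> bounded_ops X"
      "\<forall>(x, y)\<in>\<Phi> \<union> \<Psi>. cmod (ell2_inner X (T x) y - ell2_inner X (S x) y) < min \<epsilon> \<eta>" for T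
    proof -
      have "\<forall>(x, y)\<in>\<Phi>. cmod (ell2_inner X (T x) y - ell2_inner X (S x) y) < \<epsilon>"
        "\<forall>(x, y)\<in>\<Psi>. cmod (ell2_inner X (T x) y - ell2_inner X (S x) y) < \<eta>"
        using that(2) by auto
      then show ?thesis using U V that(1) by blast
    qed
    then have "?P (\<Phi> \<union> \<Psi>) (min \<epsilon> \<eta>) (U \<inter> V)" using U V by auto
    then show ?case by blast
  next
    case (UN \<U>)
    then obtain U where U: "U \<in> \<U>" "S \<in> U" by auto
    obtain \<Phi> \<epsilon> where "?P \<Phi> \<epsilon> U" using UN.IH[OF U] by (elim exE) (rule that)
    then have "?P \<Phi> \<epsilon> (\<Union> \<U>)" using U by blast
    then show ?case by blast
  next
    case (Basis U)
    then obtain x y V where xy: "x \<in> ell2 X" "y \<in> ell2 X" "open V" 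
      and U: "U = {T \<in> bounded_ops X. ell2_inner X (T x) y \<in> V}" by blast
    then have "ell2_inner X (S x) y \<in> V" using Basis by auto
    then obtain e where e: "e > 0" "\<And>z. dist z (ell2_inner X (S x) y) < e \<Longrightarrow> z \<in> V"
      using xy(3) unfolding open_dist by blast
    then have "?P {(x, y)} e U" using xy U by (auto simp: dist_norm)
    then show ?case by blast
  qed simp
qed

lemma wot_closed_memI:
  assumes closed: "closedin (wot X) M" and S: "S \<in> bounded_ops X" and M: "M \<subseteq> bounded_ops X"
    and approx: "\<And>\<Phi> \<epsilon>. finite \<Phi> \<Longrightarrow> \<Phi> \<subseteq> ell2 X \<times> ell2 X \<Longrightarrow> \<epsilon> > 0 \<Longrightarrow>
      \<exists>T\<in>M. \<forall>(x, y)\<in>\<Phi>. cmod (ell2_inner X (T x) y - ell2_inner X (S x) y) < \<epsilon>"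
  shows "S \<in> M"
proof (rule ccontr)
  assume "S \<notin> M"
  \<comment> \<open>With some vector of \<open>ell2 X\<close> available,
    \<open>bounded_ops X\<close> itself is a subbasic set: take the whole plane as the open
    set.\<close>
  have "(\<lambda>t. 0) \<in> ell2 X" by (simp add: ell2_def)
  then have "S \<in> topspace (wot X)"
    unfolding wot_def topology_generated_by_topspace using S by (intro UnionI[of "bounded_ops X"]) force+
  then have "openin (wot X) (topspace (wot X) - M)" "S \<in> topspace (wot X) - M"
    using closed \<open>S \<notin> M\<close> by auto
  from wot_neighbourhood[OF this] approx M show False by blast
qed

section \<open>Finite amplifications\<close>

definition slice :: "nat \<Rightarrow> ('a \<times> nat) l2 \<Rightarrow> 'a l2" where
  "slice i = reindex UNIV (\<lambda>t. (t, i))"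

definition inject :: "nat \<Rightarrow> 'a l2 \<Rightarrow> ('a \<times> nat) l2" where
  "inject i = reindex (UNIV \<times> {i}) fst"

text \<open>The direct sum of \<open>n\<close> copies of \<open>B\<close>, acting on the levels
  below \<open>n\<close> and zero on the others. Levels are natural numbers because \<open>n\<close>
  depends on the weak neighbourhood under consideration.\<close>

definition amplify :: "nat \<Rightarrow> ('a l2 \<Rightarrow> 'a l2) \<Rightarrow> ('a \<times> nat) l2 \<Rightarrow> ('a \<times> nat) l2" where
  "amplify n B v = (\<Sum>i<n. inject i (B (slice i v)))"

lemma inj_fst: "inj_on fst (UNIV \<times> {i})" and inj_pair: "inj_on (\<lambda>t. (t, i)) UNIV"
  by (auto simp: inj_on_def)

lemma coef_slice [simp]: "coef (slice i v) t = coef v (t, i)"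
  by (simp add: slice_def coef_reindex inj_pair)

lemma coef_inject [simp]: "coef (inject i x) p = (if snd p = i then coef x (fst p) else 0)"
  by (cases p) (auto simp: inject_def coef_reindex inj_fst)

lemma slice_inject: "slice i (inject j x) = (if i = j then x else 0)"
  by (auto intro!: l2_eqI)

lemma bounded_linear_slice: "bounded_linear (slice i)"
  and bounded_linear_inject: "bounded_linear (inject i)"
  by (simp_all add: slice_def inject_def bounded_linear_reindex inj_fst inj_pair)

lemma norm_slice_le: "norm (slice i v) \<le> norm v"
  by (simp add: slice_def norm_reindex_le inj_pair)

lemma inner_inject: "inner (inject i x) v = inner x (slice i v)"
  unfolding inject_def slice_def by (rule inner_reindex) auto

lemma bounded_linear_amplify: "bounded_linear B \<Longrightarrow> bounded_linear (amplify n B)"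
  unfolding amplify_def
  by (intro bounded_linear_sum bounded_linear_compose[OF bounded_linear_inject]
      bounded_linear_compose[OF _ bounded_linear_slice])

lemma coef_amplify: "coef (amplify n B v) (a, i) = (if i < n then coef (B (slice i v)) a else 0)"
  by (simp add: amplify_def)

lemma slice_amplify: "slice i (amplify n B v) = (if i < n then B (slice i v) else 0)"
  by (auto intro!: l2_eqI simp: coef_amplify)

lemma amplify_inject: "bounded_linear B \<Longrightarrow> j < n \<Longrightarrow> amplify n B (inject j x) = inject j (B x)"
  by (auto intro!: l2_eqI simp: coef_amplify slice_inject linear_simps(3))

lemma inner_amplify:
  assumes "\<And>x y. inner (B x) y = inner x (B' y)"
  shows "inner (amplify n B v) w = inner v (amplify n B' w)"
  using inner_inject[of _ _ v]
  by (simp add: amplify_def inner_sum_left inner_sum_right inner_inject assms inner_commute[of v "inject _ _"]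
      inner_commute[of "B' _"])

lemma inner_cscale: "inner (cscale c x) y = inner x (cscale (cnj c) y)"
proof -
  have "cinner (cscale c x) y = cnj (cinner (cscale (cnj c) y) x)"
    by (simp add: cinner_cscale_left cinner_commute[of y x])
  then show ?thesis by (simp add: inner_eq_Re cinner_commute[of x "cscale (cnj c) y"])
qed

lemma closure_image_subset:
  assumes "bounded_linear f" "f ` A \<subseteq> closure A"
  shows "x \<in> closure A \<Longrightarrow> f x \<in> closure A"
  using image_closure_subset[OF linear_continuous_on[OF assms(1)] closed_closure assms(2)] by blast

lemma subspace_closure:
  fixes A :: "'a :: real_normed_vector set"
  assumes "subspace A"
  shows "subspace (closure A)"
  unfolding subspace_def
proof (intro conjI allI ballI)
  show "0 \<in> closure A" using assms closure_subset subspace_0 by blast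
  fix x y assume "x \<in> closure A" "y \<in> closure A"
  then obtain f g where "\<And>n. f n \<in> A" "f \<longlonglongrightarrow> x" "\<And>n. g n \<in> A" "g \<longlonglongrightarrow> y"
    unfolding closure_sequential by blast
  then show "x + y \<in> closure A"
    unfolding closure_sequential using assms
    by (intro exI[of _ "\<lambda>n. f n + g n"]) (auto intro!: tendsto_intros subspace_add)
next
  fix x and c :: real assume "x \<in> closure A"
  then obtain f where "\<And>n. f n \<in> A" "f \<longlonglongrightarrow> x"
    unfolding closure_sequential by blast
  then show "c *\<^sub>R x \<in> closure A"
    unfolding closure_sequential using assms
    by (intro exI[of _ "\<lambda>n. c *\<^sub>R f n"]) (auto intro!: tendsto_intros subspace_mul)
qed

locale vn_alg =
  fixes X :: "'a set" and M :: "'a operator set"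
  assumes vna: "von_neumann_algebra X M"
begin

lemma M_bounded: "T \<in> M \<Longrightarrow> T \<in> bounded_ops X"
  using vna by (auto simp: von_neumann_algebra_def)

lemma M_id: "id_op X \<in> M"
  and M_add: "S \<in> M \<Longrightarrow> T \<in> M \<Longrightarrow> (\<lambda>x t. S x t + T x t) \<in> M"
  and M_cmult: "T \<in> M \<Longrightarrow> (\<lambda>x t. c * T x t) \<in> M"
  and M_comp: "S \<in> M \<Longrightarrow> T \<in> M \<Longrightarrow> S \<circ> T \<in> M"
  and M_adj: "T \<in> M \<Longrightarrow> adjoint_op X T \<in> M"
  and M_closed: "closedin (wot X) M"
  using vna unfolding von_neumann_algebra_def by blast+

abbreviation act :: "'a operator \<Rightarrow> 'a l2 \<Rightarrow> 'a l2" where "act \<equiv> op_l2 X"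

lemma act_linear: "T \<in> M \<Longrightarrow> bounded_linear (act T)"
  using bounded_linear_op_l2 M_bounded by blast

lemma act_id: "act (id_op X) x = restrict_l2 X x"
  by (simp add: op_l2_def id_op_def)

lemma act_add: "S \<in> M \<Longrightarrow> T \<in> M \<Longrightarrow> act (\<lambda>x t. S x t + T x t) x = act S x + act T x"
  using M_bounded M_bounded[OF M_add] by (intro l2_eqI) (simp add: coef_op_l2)

lemma act_cmult: "T \<in> M \<Longrightarrow> act (\<lambda>x t. c * T x t) x = cscale c (act T x)"
  using M_bounded M_bounded[OF M_cmult] by (intro l2_eqI) (simp add: coef_op_l2)

lemma act_comp: "S \<in> M \<Longrightarrow> T \<in> M \<Longrightarrow> act (S \<circ> T) x = act S (act T x)"
  using op_l2_comp M_bounded by blast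

lemma inner_act_adj: "T \<in> M \<Longrightarrow> inner (act T x) y = inner x (act (adjoint_op X T) y)"
  using adjoint_op(2)[OF M_bounded] by (simp add: inner_eq_Re)

text \<open>\<open>F\<close> is kept abstract because it serves twice, for the amplified orbit of a
  tuple of vectors and for the orbit of \<open>basis \<one>\<close>.\<close>

lemma cyclic_subspace:
  fixes F :: "'a operator \<Rightarrow> 'b l2"
  assumes add: "\<And>S T. S \<in> M \<Longrightarrow> T \<in> M \<Longrightarrow> F (\<lambda>x t. S x t + T x t) = F S + F T"
    and cm: "\<And>c T. T \<in> M \<Longrightarrow> F (\<lambda>x t. c * T x t) = cscale c (F T)"
  shows "closed_subspace (closure (F ` M))"
    and "x \<in> closure (F ` M) \<Longrightarrow> cscale c x \<in> closure (F ` M)"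
proof -
  have scale: "cscale c y \<in> F ` M" if "y \<in> F ` M" for y c
    using that cm M_cmult by (metis (no_types, lifting) imageE imageI)
  have "subspace (F ` M)"
    unfolding subspace_def
  proof (intro conjI ballI allI)
    have "cscale 0 (F (id_op X)) = 0" by (rule l2_eqI) simp
    then show "0 \<in> F ` M" using scale[of "F (id_op X)" 0] M_id by auto
    show "y + z \<in> F ` M" if "y \<in> F ` M" "z \<in> F ` M" for y z
      using that add M_add by (metis (no_types, lifting) imageE imageI)
    show "r *\<^sub>R y \<in> F ` M" if "y \<in> F ` M" for r y
      using scale[OF that] by (simp add: scaleR_eq_cscale)
  qed
  then show "closed_subspace (closure (F ` M))"
    by (intro closed_subspace.intro subspace_closure closed_closure)
  show "cscale c x \<in> closure (F ` M)" if "x \<in> closure (F ` M)"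
    by (rule closure_image_subset[OF bounded_linear_cscale _ that]) (use scale closure_subset[of "F ` M"] in blast)
qed

text \<open>The argument of von Neumann's density theorem: the projection \<open>Q\<close> onto the closure of the
  amplified orbit of \<open>(\<xi>\<^sub>i)\<close> commutes with the amplification of \<open>M\<close>; the hypothesis on
  \<open>S\<close> is what makes it commute with the amplification of \<open>S\<close> as well.\<close>

lemma memI:
  assumes S: "S \<in> bounded_ops X"
    and lim: "\<And>t. t \<in> X \<Longrightarrow> \<exists>m. (\<forall>n. m n \<in> M) \<and> (\<lambda>n. act (m n) (basis t)) \<longlonglongrightarrow> act S (basis t) \<and>
      (\<forall>v a. (\<lambda>n. coef (act (m n) v) a) \<longlonglongrightarrow> coef (act S v) a)"
  shows "S \<in> M"
proof (rule wot_closed_memI[OF M_closed S])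
  show "M \<subseteq> bounded_ops X" using M_bounded by blast
  fix \<Phi> :: "(('a \<Rightarrow> complex) \<times> ('a \<Rightarrow> complex)) set" and \<epsilon> :: real
  assume \<Phi>: "finite \<Phi>" "\<Phi> \<subseteq> ell2 X \<times> ell2 X" and "\<epsilon> > 0"
  obtain n :: nat and f where f: "\<Phi> = f ` {i. i < n}"
    using finite_imp_nat_seg_image_inj_on[OF \<Phi>(1)] by blast
  define \<xi> where "\<xi> i = mk (fst (f i))" for i
  have fE: "fst (f i) \<in> ell2 X" "snd (f i) \<in> ell2 X" if "i < n" for i
    using \<Phi>(2) f that by (auto simp: mem_Times_iff)
  \<comment> \<open>All vectors tested by the neighbourhood are stacked into one, so that a norm
    approximation of \<open>F S\<close> handles them simultaneously.\<close>
  define \<Xi> where "\<Xi> = (\<Sum>i<n. inject i (\<xi> i))"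
  have slice\<Xi>: "slice i \<Xi> = \<xi> i" if "i < n" for i
    using that by (intro l2_eqI) (simp add: \<Xi>_def)
  define F where "F T = amplify n (act T) \<Xi>" for T
  define K where "K = closure (F ` M)"
  have add: "F (\<lambda>x t. S x t + T x t) = F S + F T" if "S \<in> M" "T \<in> M" for S T
    using that by (simp add: F_def amplify_def act_add linear_simps(1)[OF bounded_linear_inject] sum.distrib)
  have cm: "F (\<lambda>x t. c * T x t) = cscale c (F T)" if "T \<in> M" for c T
    using that by (intro l2_eqI) (auto simp: F_def amplify_def act_cmult sum_distrib_left intro!: sum.cong)
  interpret K: closed_subspace K unfolding K_def by (rule cyclic_subspace(1)[OF add cm])
  have K_scale: "cscale c x \<in> K" if "x \<in> K" for c x
    using cyclic_subspace(2)[of F x c, OF add cm] that unfolding K_def by blast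
  have K_act: "amplify n (act T) x \<in> K" if T: "T \<in> M" and x: "x \<in> K" for T x
  proof -
    have "amplify n (act T) (F R) = F (T \<circ> R)" if "R \<in> M" for R
      unfolding F_def amplify_def[of n "act T"] amplify_def[of n "act (T \<circ> R)"]
      using that T by (intro sum.cong refl) (simp add: slice_amplify act_comp)
    then have "amplify n (act T) (F R) \<in> closure (F ` M)" if "R \<in> M" for R
      using M_comp[OF T that] closure_subset[of "F ` M"] that by auto
    then have "amplify n (act T) ` F ` M \<subseteq> closure (F ` M)" by auto
    then show ?thesis
      using closure_image_subset[OF bounded_linear_amplify[OF act_linear[OF T]]] x unfolding K_def by blast
  qed
  define Q where "Q = proj K"
  have Q_lin: "bounded_linear Q" unfolding Q_def by (rule K.bounded_linear_proj)
  have Q_scale: "Q (cscale c x) = cscale c (Q x)" for c x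
    unfolding Q_def
    by (rule K.proj_commute[OF bounded_linear.linear[OF bounded_linear_cscale] K_scale K_scale inner_cscale])
  have Q_amp: "Q (amplify n (act T) x) = amplify n (act T) (Q x)" if T: "T \<in> M" for T x
    unfolding Q_def
    by (rule K.proj_commute[where B' = "amplify n (act (adjoint_op X T))"])
      (use T K_act M_adj inner_amplify[OF inner_act_adj[OF T]] in
        \<open>auto intro: bounded_linear.linear bounded_linear_amplify act_linear\<close>)
  note S_lin = bounded_linear_op_l2[OF S]
  have restr: "restrict_l2 X (\<xi> i) = \<xi> i" if "i < n" for i
    using fE(1)[OF that] by (simp add: \<xi>_def restrict_mk)
  have "F (id_op X) = \<Xi>"
    unfolding F_def amplify_def \<Xi>_def using slice\<Xi>[unfolded \<Xi>_def] restr
    by (intro sum.cong refl) (simp add: act_id)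
  then have "\<Xi> \<in> K" using M_id closure_subset unfolding K_def by (metis image_eqI subsetD)
  then have Q\<Xi>: "Q \<Xi> = \<Xi>" unfolding Q_def by (rule K.proj_id)
  \<comment> \<open>On a basis vector, \<open>Q\<close> intertwines the approximants
    \<open>m k\<close>. One side converges in norm because \<open>act (m k) (basis t)\<close> does;
    on the other, where the vector is arbitrary, only coordinates are known to converge. Both limits
    exist coordinatewise and therefore agree.\<close>
  have QS: "Q (inject j (act S x)) = amplify n (act S) (Q (inject j x))"
    if j: "j < n" and x: "\<And>t. t \<notin> X \<Longrightarrow> coef x t = 0" for j x
  proof (rule linear_eq_on_basis[where f = "\<lambda>x. Q (inject j (act S x))" and X = X])
    show "bounded_linear (\<lambda>x. Q (inject j (act S x)))"
      by (intro bounded_linear_compose[OF Q_lin] bounded_linear_compose[OF bounded_linear_inject] S_lin)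
    show "bounded_linear (\<lambda>x. amplify n (act S) (Q (inject j x)))"
      by (intro bounded_linear_compose[OF bounded_linear_amplify[OF S_lin]]
          bounded_linear_compose[OF Q_lin] bounded_linear_inject)
    have inj_scale: "inject j (cscale c x) = cscale c (inject j x)" for c and x :: "'a l2"
      by (rule l2_eqI) simp
    have sl_scale: "slice i (cscale c x) = cscale c (slice i x)" for c i and x :: "('a \<times> nat) l2"
      by (rule l2_eqI) simp
    show "Q (inject j (act S (cscale c x))) = cscale c (Q (inject j (act S x)))" for c x
      by (simp add: op_l2_cscale[OF S] inj_scale Q_scale)
    show "amplify n (act S) (Q (inject j (cscale c x))) = cscale c (amplify n (act S) (Q (inject j x)))" for c x
      by (rule l2_eqI) (auto simp: inj_scale Q_scale coef_amplify sl_scale op_l2_cscale[OF S])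
    fix t assume "t \<in> X"
    then obtain m where m: "\<And>k. m k \<in> M" "(\<lambda>k. act (m k) (basis t)) \<longlonglongrightarrow> act S (basis t)"
      "\<And>v a. (\<lambda>k. coef (act (m k) v) a) \<longlonglongrightarrow> coef (act S v) a" using lim by meson
    define v where "v = Q (inject j (basis t))"
    have "(\<lambda>k. Q (inject j (act (m k) (basis t)))) \<longlonglongrightarrow> Q (inject j (act S (basis t)))"
      by (intro bounded_linear.tendsto[OF Q_lin] bounded_linear.tendsto[OF bounded_linear_inject] m)
    moreover have "Q (inject j (act (m k) (basis t))) = amplify n (act (m k)) v" for k
      using Q_amp[OF m(1)[of k], of "inject j (basis t)"] amplify_inject[OF act_linear[OF m(1)] j, of k "basis t"] by (simp add: v_def)
    ultimately have lim1: "(\<lambda>k. amplify n (act (m k)) v) \<longlonglongrightarrow> Q (inject j (act S (basis t)))" by simp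
    show "Q (inject j (act S (basis t))) = amplify n (act S) (Q (inject j (basis t)))"
    proof (rule l2_eqI)
      fix p :: "'a \<times> nat"
      obtain a i where p: "p = (a, i)" by (cases p)
      have "(\<lambda>k. coef (amplify n (act (m k)) v) p) \<longlonglongrightarrow> coef (Q (inject j (act S (basis t)))) p"
        by (intro bounded_linear.tendsto[OF bounded_linear_coef] lim1)
      moreover have "(\<lambda>k. coef (amplify n (act (m k)) v) p) \<longlonglongrightarrow> coef (amplify n (act S) v) p"
        unfolding p coef_amplify using m(3) by simp
      ultimately show "coef (Q (inject j (act S (basis t)))) p = coef (amplify n (act S) (Q (inject j (basis t)))) p"
        unfolding v_def using LIMSEQ_unique by blast
    qed
  qed (use x in auto)
  have "Q (F S) = amplify n (act S) (Q \<Xi>)"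
  proof -
    have "Q (F S) = (\<Sum>j<n. Q (inject j (act S (\<xi> j))))"
      unfolding F_def amplify_def using slice\<Xi>
      by (simp add: bounded_linear.linear[OF Q_lin] linear_sum)
    also have "\<dots> = (\<Sum>j<n. amplify n (act S) (Q (inject j (\<xi> j))))"
    proof (intro sum.cong refl QS)
      fix j t assume "j \<in> {..<n}" "t \<notin> X"
      then show "coef (\<xi> j) t = 0" using fE(1)[of j] by (auto simp: \<xi>_def coef_mk ell2_def)
    qed simp
    also have "\<dots> = amplify n (act S) (Q \<Xi>)"
      unfolding \<Xi>_def
      by (simp add: linear_sum bounded_linear.linear[OF Q_lin] bounded_linear.linear[OF bounded_linear_amplify[OF S_lin]])
    finally show ?thesis .
  qed
  then have "F S \<in> K" using Q\<Xi> K.proj_in[of "F S"] by (simp add: Q_def F_def)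
  \<comment> \<open>Divided by a bound for all norms of the second vectors at once; the summand 1
    keeps the denominator positive.\<close>
  define \<epsilon>' where "\<epsilon>' = \<epsilon> / (1 + (\<Sum>i<n. norm (mk (snd (f i)))))"
  have pos: "1 + (\<Sum>i<n. norm (mk (snd (f i)))) > 0" by (intro add_pos_nonneg sum_nonneg) auto
  then have "\<epsilon>' > 0" using \<open>\<epsilon> > 0\<close> by (simp add: \<epsilon>'_def)
  then obtain T where T: "T \<in> M" "dist (F T) (F S) < \<epsilon>'"
    using \<open>F S \<in> K\<close> unfolding K_def closure_approachable by blast
  have "cmod (ell2_inner X (T (fst (f i))) (snd (f i)) - ell2_inner X (S (fst (f i))) (snd (f i))) < \<epsilon>"
    if i: "i < n" for i
  proof -
    define y where "y = mk (snd (f i))"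
    have y: "coef y = snd (f i)" using fE(2)[OF i] by (simp add: y_def coef_mk)
    have e: "ell2_inner X (R (fst (f i))) (snd (f i)) = cinner (act R (\<xi> i)) y" if "R \<in> bounded_ops X" for R
      using ell2_inner_eq[OF bounded_opsD(1)[OF that fE(1)[OF i]], of y] y
        coef_op_l2_mk[OF that fE(1)[OF i]] by (metis \<xi>_def mk_coef)
    have "act T (\<xi> i) - act S (\<xi> i) = slice i (F T - F S)"
      using i slice\<Xi>[OF i] by (intro l2_eqI) (simp add: F_def coef_amplify)
    then have small: "norm (act T (\<xi> i) - act S (\<xi> i)) \<le> \<epsilon>'"
      using norm_slice_le[of i "F T - F S"] T(2) by (simp add: dist_norm)
    have "cinner (act T (\<xi> i)) y - cinner (act S (\<xi> i)) y = cinner (act T (\<xi> i) - act S (\<xi> i)) y"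
      using cinner_add_left[of "act T (\<xi> i) - act S (\<xi> i)" "act S (\<xi> i)" y] by simp
    then have "cmod (cinner (act T (\<xi> i)) y - cinner (act S (\<xi> i)) y) \<le> \<epsilon>' * norm y"
      using cmod_cinner_le[of "act T (\<xi> i) - act S (\<xi> i)" y] mult_right_mono[OF small norm_ge_zero[of y]]
      by simp
    also have "norm y \<le> (\<Sum>i<n. norm (mk (snd (f i))))"
      unfolding y_def using i by (intro member_le_sum) auto
    then have "\<epsilon>' * norm y < \<epsilon>' * (1 + (\<Sum>i<n. norm (mk (snd (f i)))))"
      using \<open>\<epsilon>' > 0\<close> by (intro mult_strict_left_mono) auto
    also have "\<dots> = \<epsilon>" using pos by (simp add: \<epsilon>'_def)
    finally show ?thesis using e M_bounded[OF T(1)] S by simp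
  qed
  then show "\<exists>T\<in>M. \<forall>(x, y)\<in>\<Phi>. cmod (ell2_inner X (T x) y - ell2_inner X (S x) y) < \<epsilon>"
    using T(1) f by (intro bexI[of _ T]) (auto simp: case_prod_unfold)
qed

end

section \<open>Convolution operators\<close>

lift_definition conj_l2 :: "'a l2 \<Rightarrow> 'a l2" is "\<lambda>x t. cnj (x t)"
  by (simp add: ell2_def)

lemmas conj_l2_coef [simp] = conj_l2.rep_eq

lemma norm_conj_l2 [simp]: "norm (conj_l2 x) = norm x"
  by (simp add: norm_l2_def inner_l2_self)

lemma inner_conj: "inner (conj_l2 x) y = inner x (conj_l2 y)"
proof -
  have "cinner (conj_l2 x) y = cnj (cinner x (conj_l2 y))"
    by (simp add: cinner_def flip: infsum_cnj)
  then show ?thesis by (simp add: inner_eq_Re)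
qed

lemma bounded_linear_conj: "bounded_linear conj_l2"
  by (rule bounded_linear_intro[where K = 1]) (auto intro!: l2_eqI)

lemma bounded_ops_eqI:
  assumes S: "S \<in> bounded_ops X" and T: "T \<in> bounded_ops X" and eq: "\<And>x. op_l2 X S x = op_l2 X T x"
  shows "S = T"
proof
  fix x show "S x = T x"
  proof (cases "x \<in> ell2 X")
    case True
    then show ?thesis using coef_op_l2_mk[OF S True] coef_op_l2_mk[OF T True] eq by simp
  qed (use bounded_opsD(2)[OF S] bounded_opsD(2)[OF T] in simp)
qed

context group begin

abbreviation opG :: "'a operator \<Rightarrow> 'a l2 \<Rightarrow> 'a l2" where "opG \<equiv> op_l2 (carrier G)"

definition hat :: "'a operator \<Rightarrow> 'a l2" where "hat T = opG T (basis \<one>)"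

text \<open>Scalar valued on purpose: the convolution of two square summable functions is bounded
  but need not be square summable.\<close>

definition conv :: "'a l2 \<Rightarrow> 'a l2 \<Rightarrow> 'a \<Rightarrow> complex" where
  "conv x y a = (\<Sum>\<^sub>\<infinity>b\<in>carrier G. coef x (a \<otimes> inv b) * coef y b)"

text \<open>Commutation with right translations, expressed by matrix coefficients because these are
  continuous in the weak operator topology.\<close>

definition equivariant :: "'a operator \<Rightarrow> bool" where
  "equivariant T \<longleftrightarrow> (\<forall>a\<in>carrier G. \<forall>b\<in>carrier G. \<forall>r\<in>carrier G.
     coef (opG T (basis (b \<otimes> r))) (a \<otimes> r) = coef (opG T (basis b)) a)"

lemma inj_translate:
  "s \<in> carrier G \<Longrightarrow> inj_on (\<lambda>t. s \<otimes> t) (carrier G)"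
  "s \<in> carrier G \<Longrightarrow> inj_on (\<lambda>t. t \<otimes> s) (carrier G)"
  "s \<in> carrier G \<Longrightarrow> inj_on (\<lambda>t. s \<otimes> inv t) (carrier G)"
  "s \<in> carrier G \<Longrightarrow> inj_on (\<lambda>t. inv t \<otimes> s) (carrier G)"
  "inj_on (m_inv G) (carrier G)"
  using inv_inj by (auto simp: inj_on_def)

text \<open>As an inner product with a vector built from the other factor alone, a coefficient of a
  convolution is visibly bounded and linear in \<open>y\<close>; the mirror form
  \<open>conv_cinner_left\<close> does the same for \<open>x\<close>.\<close>

lemma conv_cinner_right:
  assumes "a \<in> carrier G"
  shows "conv x y a = cinner y (conj_l2 (reindex (carrier G) (\<lambda>b. a \<otimes> inv b) x))"
  unfolding conv_def cinner_def
  by (rule infsum_cong_neutral) (auto simp: coef_reindex inj_translate assms mult.commute)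

lemma conv_swap:
  assumes "a \<in> carrier G"
  shows "conv x y a = (\<Sum>\<^sub>\<infinity>c\<in>carrier G. coef x c * coef y (inv c \<otimes> a))"
proof -
  have bij: "bij_betw (\<lambda>c. inv c \<otimes> a) (carrier G) (carrier G)"
    by (rule bij_betw_byWitness[where f' = "\<lambda>b. a \<otimes> inv b"])
      (use assms in \<open>auto simp: inv_mult_group m_assoc\<close>, simp_all add: m_assoc[symmetric])
  have "(\<Sum>\<^sub>\<infinity>c\<in>carrier G. coef x c * coef y (inv c \<otimes> a)) =
      (\<Sum>\<^sub>\<infinity>c\<in>carrier G. coef x (a \<otimes> inv (inv c \<otimes> a)) * coef y (inv c \<otimes> a))"
    using assms by (intro infsum_cong) (simp add: inv_mult_group, simp add: m_assoc[symmetric])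
  also have "\<dots> = conv x y a" unfolding conv_def by (rule infsum_reindex_bij_betw[OF bij])
  finally show ?thesis ..
qed

lemma conv_cinner_left:
  assumes "a \<in> carrier G"
  shows "conv x y a = cinner x (conj_l2 (reindex (carrier G) (\<lambda>b. inv b \<otimes> a) y))"
  unfolding conv_swap[OF assms] cinner_def
  by (rule infsum_cong_neutral) (auto simp: coef_reindex inj_translate assms mult.commute)

lemma bounded_linear_cinner_left: "bounded_linear (\<lambda>x. cinner x y)"
  by (rule bounded_linear_intro[where K = "norm y"])
    (auto simp: cinner_add_left scaleR_eq_cscale cinner_cscale_left scaleR_conv_of_real cmod_cinner_le)

lemma bounded_linear_conv:
  assumes "a \<in> carrier G"
  shows "bounded_linear (\<lambda>x. conv x y a)" "bounded_linear (\<lambda>y. conv x y a)"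
  unfolding conv_cinner_left[OF assms] by (rule bounded_linear_cinner_left)
    (unfold conv_cinner_left[OF assms, symmetric] conv_cinner_right[OF assms], rule bounded_linear_cinner_left)

lemma cmod_conv_le:
  assumes "a \<in> carrier G"
  shows "cmod (conv x y a) \<le> norm x * norm y"
proof -
  have "cmod (conv x y a) \<le> norm y * norm (conj_l2 (reindex (carrier G) (\<lambda>b. a \<otimes> inv b) x))"
    unfolding conv_cinner_right[OF assms] by (rule cmod_cinner_le)
  also have "\<dots> \<le> norm y * norm x"
    using norm_reindex_le[OF inj_translate(3)[OF assms], of x] by (simp add: mult_left_mono)
  finally show ?thesis by (simp add: mult.commute)
qed

lemma conv_basis_left:
  assumes "a \<in> carrier G" "g \<in> carrier G"
  shows "conv (basis g) y a = coef y (inv g \<otimes> a)"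
proof -
  have "conv (basis g) y a = (\<Sum>\<^sub>\<infinity>c\<in>{g}. coef y (inv c \<otimes> a))"
    unfolding conv_swap[OF assms(1)] by (rule infsum_cong_neutral) (use assms in auto)
  then show ?thesis by simp
qed

lemma group_vn_algebra_bounded: "T \<in> group_vn_algebra G \<Longrightarrow> T \<in> bounded_ops (carrier G)"
  unfolding group_vn_algebra_def in_closure_of wot_def topology_generated_by_topspace by blast

lemma basis_ell2: "t \<in> X \<Longrightarrow> coef (basis t) \<in> ell2 X"
  unfolding coef_in_ell2 by auto

lemma matrix_coef:
  assumes "T \<in> bounded_ops X" "t \<in> X" "s \<in> X"
  shows "ell2_inner X (T (coef (basis t))) (coef (basis s)) = coef (op_l2 X T (basis t)) s"
  using ell2_inner_eq[OF bounded_opsD(1)[OF assms(1) basis_ell2[OF assms(2)]], of "basis s"]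
    coef_op_l2_mk[OF assms(1) basis_ell2[OF assms(2)]] basis_ell2[OF assms(2)]
    bounded_opsD(1)[OF assms(1) basis_ell2[OF assms(2)]] cinner_basis coef_mk mk_coef by metis

lemma translate_sum_equivariant:
  assumes F: "F \<subseteq> carrier G" and abr: "a \<in> carrier G" "b \<in> carrier G" "r \<in> carrier G"
  shows "(\<Sum>s\<in>F. c s * left_reg G s (coef (basis (b \<otimes> r))) (a \<otimes> r)) =
    (\<Sum>s\<in>F. c s * left_reg G s (coef (basis b)) a)"
proof (intro sum.cong refl arg_cong2[where f = "(*)"])
  fix s assume "s \<in> F"
  then have s: "s \<in> carrier G" using F by auto
  have "inv s \<otimes> (a \<otimes> r) = b \<otimes> r \<longleftrightarrow> inv s \<otimes> a = b"
    using s abr by (simp add: m_assoc[symmetric])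
  then show "left_reg G s (coef (basis (b \<otimes> r))) (a \<otimes> r) = left_reg G s (coef (basis b)) a"
    using abr basis_ell2[of b "carrier G"] basis_ell2[of "b \<otimes> r" "carrier G"]
    unfolding left_reg_def by auto
qed

text \<open>Left translations commute with right translations, and the two matrix coefficients
  compared are weakly continuous. If they differed at \<open>T\<close>, disjoint open sets around
  them would give a weak neighbourhood of \<open>T\<close> without finite sums.\<close>

lemma group_vn_algebra_equivariant:
  assumes T: "T \<in> group_vn_algebra G"
  shows "equivariant T"
  unfolding equivariant_def
proof (intro ballI)
  fix a b r assume abr: "a \<in> carrier G" "b \<in> carrier G" "r \<in> carrier G"
  let ?X = "carrier G"
  note Tb = group_vn_algebra_bounded[OF T]
  define p where "p S = ell2_inner ?X (S (coef (basis (b \<otimes> r)))) (coef (basis (a \<otimes> r)))" for S :: "'a operator"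
  define q where "q S = ell2_inner ?X (S (coef (basis b))) (coef (basis a))" for S :: "'a operator"
  have bE: "coef (basis a) \<in> ell2 ?X" "coef (basis b) \<in> ell2 ?X"
    "coef (basis (a \<otimes> r)) \<in> ell2 ?X" "coef (basis (b \<otimes> r)) \<in> ell2 ?X"
    by (intro basis_ell2 m_closed abr)+
  have "p T = q T"
  proof (rule ccontr)
    assume ne: "p T \<noteq> q T"
    obtain U V where UV: "open U" "open V" "p T \<in> U" "q T \<in> V" "U \<inter> V = {}"
      using hausdorff[OF ne] by blast
    have o1: "openin (wot ?X) {S \<in> bounded_ops ?X. p S \<in> U}"
      unfolding wot_def p_def using bE UV by (intro topology_generated_by_Basis) blast
    have o2: "openin (wot ?X) {S \<in> bounded_ops ?X. q S \<in> V}"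
      unfolding wot_def q_def using bE UV by (intro topology_generated_by_Basis) blast
    define W where "W = {S \<in> bounded_ops ?X. p S \<in> U} \<inter> {S \<in> bounded_ops ?X. q S \<in> V}"
    have W: "openin (wot ?X) W" "T \<in> W"
      unfolding W_def using o1 o2 Tb UV by (auto intro: openin_Int)
    obtain S where "S \<in> {(\<lambda>x t. \<Sum>s\<in>F. c s * left_reg G s x t) | F c. finite F \<and> F \<subseteq> carrier G}" "S \<in> W"
      using T W unfolding group_vn_algebra_def in_closure_of by meson
    then obtain F c where F: "F \<subseteq> carrier G" and S: "S = (\<lambda>x t. \<Sum>s\<in>F. c s * left_reg G s x t)" by blast
    have Sb: "S \<in> bounded_ops ?X" "p S \<in> U" "q S \<in> V" using \<open>S \<in> W\<close> by (simp_all add: W_def)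
    have "p S = S (coef (basis (b \<otimes> r))) (a \<otimes> r)"
      unfolding p_def using matrix_coef[OF Sb(1), of "b \<otimes> r" "a \<otimes> r"] abr
        coef_op_l2_mk[OF Sb(1) bE(4)] by (simp only: mk_coef m_closed)
    moreover have "q S = S (coef (basis b)) a"
      unfolding q_def using matrix_coef[OF Sb(1), of b a] abr
        coef_op_l2_mk[OF Sb(1) bE(2)] by (simp only: mk_coef)
    ultimately have "p S = q S" unfolding S using translate_sum_equivariant[OF F abr] by simp
    then show False using Sb UV by auto
  qed
  then show "coef (opG T (basis (b \<otimes> r))) (a \<otimes> r) = coef (opG T (basis b)) a"
    unfolding p_def q_def using matrix_coef[OF Tb] abr by (simp only: m_closed)
qed

text \<open>Equivariance determines all columns of the matrix of \<open>T\<close> from the one at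
  \<open>\<one>\<close>; hence \<open>T\<close> is left convolution by \<open>hat T\<close>.\<close>

lemma act_basis:
  assumes T: "T \<in> bounded_ops (carrier G)" "equivariant T" and t: "t \<in> carrier G"
  shows "opG T (basis t) = reindex (carrier G) (\<lambda>a. a \<otimes> inv t) (hat T)"
proof (rule l2_eqI)
  fix a
  show "coef (opG T (basis t)) a = coef (reindex (carrier G) (\<lambda>a. a \<otimes> inv t) (hat T)) a"
  proof (cases "a \<in> carrier G")
    case True
    have "coef (opG T (basis (\<one> \<otimes> t))) (a \<otimes> inv t \<otimes> t) = coef (opG T (basis \<one>)) (a \<otimes> inv t)"
      using T(2) True t unfolding equivariant_def by blast
    then show ?thesis using True t by (simp add: coef_reindex inj_translate hat_def m_assoc)
  qed (use t op_l2_outside[OF T(1)] in \<open>simp add: coef_reindex inj_translate\<close>)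
qed

lemma act_conv:
  assumes T: "T \<in> bounded_ops (carrier G)" "equivariant T" and a: "a \<in> carrier G"
  shows "coef (opG T x) a = conv (hat T) x a"
proof -
  have "((\<lambda>t. coef (cscale (coef x t) (opG T (basis t))) a) has_sum coef (opG T x) a) UNIV"
    by (intro has_sum_bounded_linear[OF bounded_linear_coef]
        has_sum_linear_image[OF bounded_linear_op_l2[OF T(1)] op_l2_cscale[OF T(1)]])
  then have "coef (opG T x) a = (\<Sum>\<^sub>\<infinity>t. coef x t * coef (opG T (basis t)) a)"
    by (simp add: infsumI)
  also have "\<dots> = conv (hat T) x a"
    unfolding conv_def
  proof (rule infsum_cong_neutral)
    fix t assume "t \<in> UNIV - carrier G"
    then have "restrict_l2 (carrier G) (basis t) = 0" by (intro l2_eqI) auto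
    then have "opG T (basis t) = 0"
      using op_l2_restrict[of "carrier G" T "basis t"] linear_simps(3)[OF bounded_linear_op_l2[OF T(1)]] by simp
    then show "coef x t * coef (opG T (basis t)) a = 0" by simp
  qed (use a act_basis[OF T] in \<open>auto simp: coef_reindex inj_translate mult.commute\<close>)
  finally show ?thesis .
qed

lemma left_reg_eq_op_fun:
  assumes "s \<in> carrier G"
  shows "left_reg G s = op_fun (carrier G) (reindex (carrier G) (\<lambda>t. inv s \<otimes> t))"
  using assms by (auto simp: left_reg_def op_fun_def fun_eq_iff coef_reindex inj_translate coef_mk)

lemma left_reg_bounded: "s \<in> carrier G \<Longrightarrow> left_reg G s \<in> bounded_ops (carrier G)"
  unfolding left_reg_eq_op_fun
  by (intro op_fun_bounded bounded_linear_reindex reindex_cscale inj_translate) auto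

lemma act_left_reg:
  assumes "s \<in> carrier G"
  shows "opG (left_reg G s) x = reindex (carrier G) (\<lambda>t. inv s \<otimes> t) x"
  using left_reg_bounded[OF assms] assms unfolding left_reg_eq_op_fun[OF assms]
  by (intro l2_eqI) (simp add: op_l2_op_fun coef_reindex inj_translate)

lemma equivariant_left_reg:
  assumes "s \<in> carrier G"
  shows "equivariant (left_reg G s)"
  unfolding equivariant_def using assms
  by (auto simp: act_left_reg coef_reindex inj_translate m_assoc[symmetric])

lemma hat_left_reg: "s \<in> carrier G \<Longrightarrow> hat (left_reg G s) = basis s"
  unfolding hat_def act_left_reg
  by (intro l2_eqI) (auto simp: coef_reindex inj_translate inv_solve_left')

lemma adjoint_left_reg:
  assumes s: "s \<in> carrier G"
  shows "adjoint_op (carrier G) (left_reg G s) = left_reg G (inv s)"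
proof (rule bounded_ops_eqI[OF adjoint_op(1) left_reg_bounded])
  fix y
  have "cinner x (opG (adjoint_op (carrier G) (left_reg G s)) y) = cinner x (opG (left_reg G (inv s)) y)" for x
    using s unfolding adjoint_op(2)[OF left_reg_bounded[OF s], symmetric]
    by (simp add: act_left_reg) (intro cinner_reindex, auto simp: m_assoc[symmetric])
  then have "cinner (opG (adjoint_op (carrier G) (left_reg G s)) y) x = cinner (opG (left_reg G (inv s)) y) x" for x
    by (metis cinner_commute)
  then show "opG (adjoint_op (carrier G) (left_reg G s)) y = opG (left_reg G (inv s)) y"
    by (intro l2_eqI) (metis cinner_basis)
qed (use s in \<open>auto simp: left_reg_bounded\<close>)

end

locale group_vn_subalgebra = group G + vn_alg "carrier G" M
  for G :: "('a, 'b) monoid_scheme" (structure) and M +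
  assumes M_sub: "M \<subseteq> group_vn_algebra G"
begin

lemma M_equivariant: "T \<in> M \<Longrightarrow> equivariant T"
  using M_sub group_vn_algebra_equivariant by auto

text \<open>Norm convergence of the vectors \<open>T \<delta>\<^sub>e\<close> only gives pointwise convergence of the convolvers,
  without a norm bound; this is why \<open>memI\<close> asks for no more.\<close>

lemma hat_closure_memI:
  assumes S: "S \<in> bounded_ops (carrier G)" "equivariant S" and cl: "hat S \<in> closure (hat ` M)"
  shows "S \<in> M"
proof (rule memI[OF S(1)])
  fix t assume t: "t \<in> carrier G"
  obtain h where h: "\<And>n. h n \<in> hat ` M" "h \<longlonglongrightarrow> hat S" using cl unfolding closure_sequential by blast
  then have "\<forall>n. \<exists>T. T \<in> M \<and> h n = hat T" by blast
  then obtain m where m: "\<And>n. m n \<in> M" "\<And>n. h n = hat (m n)" using choice[of "\<lambda>n T. T \<in> M \<and> h n = hat T"] by blast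
  have "h = (\<lambda>n. hat (m n))" using m(2) by blast
  then have lim: "(\<lambda>n. hat (m n)) \<longlonglongrightarrow> hat S" using h(2) by simp
  have "(\<lambda>n. act (m n) (basis t)) \<longlonglongrightarrow> act S (basis t)"
    unfolding act_basis[OF M_bounded[OF m(1)] M_equivariant[OF m(1)] t] act_basis[OF S t]
    by (intro bounded_linear.tendsto[OF bounded_linear_reindex] lim inj_translate) (use t in auto)
  moreover have "(\<lambda>n. coef (act (m n) v) a) \<longlonglongrightarrow> coef (act S v) a" for v a
  proof (cases "a \<in> carrier G")
    case True
    then show ?thesis
      unfolding act_conv[OF M_bounded[OF m(1)] M_equivariant[OF m(1)] True] act_conv[OF S True]
      by (intro bounded_linear.tendsto[OF bounded_linear_conv(1)] lim)
  qed (simp add: op_l2_outside[OF M_bounded[OF m(1)]] op_l2_outside[OF S(1)])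
  ultimately show "\<exists>m. (\<forall>n. m n \<in> M) \<and> (\<lambda>n. act (m n) (basis t)) \<longlonglongrightarrow> act S (basis t) \<and>
      (\<forall>v a. (\<lambda>n. coef (act (m n) v) a) \<longlonglongrightarrow> coef (act S v) a)" using m(1) by blast
qed

lemma hat_add: "S \<in> M \<Longrightarrow> T \<in> M \<Longrightarrow> hat (\<lambda>x t. S x t + T x t) = hat S + hat T"
  and hat_cmult: "T \<in> M \<Longrightarrow> hat (\<lambda>x t. c * T x t) = cscale c (hat T)"
  by (simp_all add: hat_def act_add act_cmult)

definition K :: "'a l2 set" where "K = closure (hat ` M)"

sublocale K: closed_subspace K
  unfolding K_def by (rule cyclic_subspace(1)[OF hat_add hat_cmult])

lemma K_cscale: "x \<in> K \<Longrightarrow> cscale c x \<in> K"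
  using cyclic_subspace(2)[of hat x c, OF hat_add hat_cmult] unfolding K_def by blast

lemma K_linear_image:
  assumes "bounded_linear f" "\<And>T. T \<in> M \<Longrightarrow> f (hat T) \<in> K" "x \<in> K"
  shows "f x \<in> K"
  using closure_image_subset[OF assms(1), of "hat ` M" x] assms(2,3) unfolding K_def by blast

lemma hat_in_K: "T \<in> M \<Longrightarrow> hat T \<in> K"
  unfolding K_def using closure_subset[of "hat ` M"] by blast

lemma basis_one_in_K: "basis \<one> \<in> K"
proof -
  have "hat (id_op (carrier G)) = basis \<one>"
    unfolding hat_def act_id by (intro restrict_id) auto
  then show ?thesis using hat_in_K[OF M_id] by simp
qed

lemma K_outside: "x \<in> K \<Longrightarrow> t \<notin> carrier G \<Longrightarrow> coef x t = 0"
proof -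
  assume x: "x \<in> K" and t: "t \<notin> carrier G"
  obtain h where h: "\<And>n. h n \<in> hat ` M" "h \<longlonglongrightarrow> x" using x unfolding K_def closure_sequential by blast
  have "coef (h n) t = 0" for n
    using h(1)[of n] op_l2_outside[OF M_bounded t] by (auto simp: hat_def)
  then have "(\<lambda>n. 0) \<longlonglongrightarrow> coef x t" using bounded_linear.tendsto[OF bounded_linear_coef h(2), of t] by simp
  then show "coef x t = 0" using LIMSEQ_unique tendsto_const by blast
qed

definition P :: "'a l2 \<Rightarrow> 'a l2" where "P = proj K"

lemma P_cscale: "P (cscale c x) = cscale c (P x)"
  unfolding P_def
  by (rule K.proj_commute[OF bounded_linear.linear[OF bounded_linear_cscale] K_cscale K_cscale inner_cscale])

lemma cinner_P: "cinner (P x) y = cinner x (P y)"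
  by (rule cinner_eqI) (simp add: P_cscale[symmetric], simp add: P_def K.inner_proj)

lemma act_hat: "S \<in> M \<Longrightarrow> T \<in> M \<Longrightarrow> act S (hat T) = hat (S \<circ> T)"
  by (simp add: hat_def act_comp)

lemma P_act:
  assumes T: "T \<in> M"
  shows "P (act T x) = act T (P x)"
proof -
  have K_act: "act S y \<in> K" if "S \<in> M" "y \<in> K" for S y
    by (rule K_linear_image[OF act_linear[OF that(1)] _ that(2)])
      (simp add: act_hat[OF that(1)] hat_in_K M_comp[OF that(1)])
  show ?thesis
    unfolding P_def
    by (rule K.proj_commute[where B' = "act (adjoint_op (carrier G) T)"])
      (use T K_act M_adj inner_act_adj in \<open>auto intro: bounded_linear.linear act_linear\<close>)
qed

lemma coef_hat_adjoint:
  assumes T: "T \<in> M" and s: "s \<in> carrier G"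
  shows "coef (hat (adjoint_op (carrier G) T)) s = cnj (coef (hat T) (inv s))"
proof -
  have "coef (hat (adjoint_op (carrier G) T)) s = cnj (cinner (basis s) (act (adjoint_op (carrier G) T) (basis \<one>)))"
    by (simp add: hat_def flip: cinner_commute)
  also have "\<dots> = cnj (coef (act T (basis s)) \<one>)"
    by (simp flip: adjoint_op(2)[OF M_bounded[OF T]])
  also have "\<dots> = cnj (coef (hat T) (inv s))"
    using s act_basis[OF M_bounded[OF T] M_equivariant[OF T] s] by (simp add: coef_reindex inj_translate)
  finally show ?thesis .
qed

text \<open>The modular conjugation of the canonical trace: by \<open>coef_hat_adjoint\<close> it
  takes \<open>hat T\<close> to \<open>hat\<close> of the adjoint of \<open>T\<close>, for
  \<open>T\<close> in \<open>M\<close>.\<close>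

definition J :: "'a l2 \<Rightarrow> 'a l2" where "J x = conj_l2 (reindex (carrier G) (m_inv G) x)"

lemma coef_J [simp]: "coef (J x) t = (if t \<in> carrier G then cnj (coef x (inv t)) else 0)"
  by (simp add: J_def coef_reindex inj_translate)

lemma bounded_linear_J: "bounded_linear J"
  unfolding J_def
  by (intro bounded_linear_compose[OF bounded_linear_conj] bounded_linear_reindex inj_translate)

lemma inner_J: "inner (J x) y = inner x (J y)"
proof -
  have "J y = reindex (carrier G) (m_inv G) (conj_l2 y)"
    by (intro l2_eqI) (simp add: coef_reindex inj_translate)
  then show ?thesis unfolding J_def inner_conj by (simp, intro inner_reindex) auto
qed

text \<open>This is right convolution by \<open>hat T\<close>. Writing it through \<open>J\<close>
  and the adjoint gives boundedness and its own adjoint for free.\<close>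

definition right_act :: "'a operator \<Rightarrow> 'a l2 \<Rightarrow> 'a l2" where
  "right_act T x = J (act (adjoint_op (carrier G) T) (J x))"

lemma coef_right_act:
  assumes T: "T \<in> M"
  shows "coef (right_act T x) a = (if a \<in> carrier G then conv x (hat T) a else 0)"
proof (cases "a \<in> carrier G")
  case a: True
  have bij: "bij_betw (\<lambda>c. c \<otimes> inv a) (carrier G) (carrier G)"
    by (rule bij_betw_byWitness[where f' = "\<lambda>c. c \<otimes> a"]) (use a in \<open>auto simp: m_assoc\<close>)
  have "coef (right_act T x) a = cnj (conv (hat (adjoint_op (carrier G) T)) (J x) (inv a))"
    using a act_conv[OF M_bounded[OF M_adj[OF T]] M_equivariant[OF M_adj[OF T]]] by (simp add: right_act_def)
  also have "\<dots> = (\<Sum>\<^sub>\<infinity>b\<in>carrier G. coef x (inv b) * coef (hat T) (b \<otimes> a))"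
    unfolding conv_def infsum_cnj[symmetric]
    using a T by (intro infsum_cong) (simp add: coef_hat_adjoint inv_mult_group mult.commute)
  also have "\<dots> = (\<Sum>\<^sub>\<infinity>c\<in>carrier G. coef x (inv (c \<otimes> inv a)) * coef (hat T) ((c \<otimes> inv a) \<otimes> a))"
    by (rule infsum_reindex_bij_betw[OF bij, symmetric])
  also have "\<dots> = conv x (hat T) a"
    unfolding conv_def using a by (intro infsum_cong) (simp add: inv_mult_group m_assoc)
  finally show ?thesis using a by simp
qed (simp add: right_act_def)

text \<open>Right convolution by \<open>hat S\<close> takes \<open>hat N\<close> to
  \<open>hat (N \<circ> S)\<close>, so it preserves \<open>K\<close>, as does its adjoint. Together
  with \<open>P_act\<close> this makes \<open>P\<close> a bimodule map over
  \<open>M\<close>.\<close>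

lemma P_right_act:
  assumes T: "T \<in> M"
  shows "P (right_act T x) = right_act T (P x)"
proof -
  have bl: "bounded_linear (right_act S)" if "S \<in> M" for S
    unfolding right_act_def
    by (intro bounded_linear_compose[OF bounded_linear_J] bounded_linear_compose[OF act_linear] M_adj that
        bounded_linear_J)
  have "right_act S (hat N) \<in> K" if "S \<in> M" "N \<in> M" for S N
  proof -
    have "right_act S (hat N) = hat (N \<circ> S)"
    proof (rule l2_eqI)
      fix a show "coef (right_act S (hat N)) a = coef (hat (N \<circ> S)) a"
        unfolding coef_right_act[OF that(1)] act_hat[OF that(2,1), symmetric]
        using act_conv[OF M_bounded[OF that(2)] M_equivariant[OF that(2)]] op_l2_outside[OF M_bounded[OF that(2)]]
        by simp
    qed
    then show ?thesis using that by (simp add: hat_in_K M_comp)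
  qed
  then have K_right: "right_act S y \<in> K" if "S \<in> M" "y \<in> K" for S y
    using K_linear_image[OF bl[OF that(1)] _ that(2)] that(1) by blast
  have "inner (right_act T x) y = inner x (right_act (adjoint_op (carrier G) T) y)" for x y
    unfolding right_act_def using T by (simp add: inner_J inner_act_adj M_adj)
  then show ?thesis
    unfolding P_def using T K_right M_adj bounded_linear.linear[OF bl]
    by (intro K.proj_commute[where B' = "right_act (adjoint_op (carrier G) T)"]) auto
qed

end

text \<open>The union of the centralizers of the powers of \<open>g\<close>, equivalently the
  elements whose orbit under conjugation by powers of \<open>g\<close> is finite. Passing to common
  multiples of exponents makes it a subgroup.\<close>

definition (in group) commensurator :: "'a \<Rightarrow> 'a set" where
  "commensurator g = {s \<in> carrier G. \<exists>n::nat. n > 0 \<and> s \<otimes> g [^] n = g [^] n \<otimes> s}"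

lemma (in group) commute_pow_mult:
  assumes "s \<in> carrier G" "g \<in> carrier G" "s \<otimes> g [^] (n::nat) = g [^] n \<otimes> s"
  shows "s \<otimes> g [^] (n * m) = g [^] (n * m) \<otimes> s"
  using group_commutes_pow[of "g [^] n" s m] assms by (simp add: nat_pow_pow)

lemma (in group) subgroup_commensurator:
  assumes g: "g \<in> carrier G"
  shows "subgroup (commensurator g) G"
proof
  show "commensurator g \<subseteq> carrier G" by (auto simp: commensurator_def)
  show "\<one> \<in> commensurator g" using g by (auto simp: commensurator_def intro!: exI[of _ 1])
next
  fix x y assume "x \<in> commensurator g" "y \<in> commensurator g"
  then obtain n m :: nat where nm: "n > 0" "m > 0" and xy: "x \<in> carrier G" "y \<in> carrier G"
    and c: "x \<otimes> g [^] n = g [^] n \<otimes> x" "y \<otimes> g [^] m = g [^] m \<otimes> y"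
    by (auto simp: commensurator_def)
  have "x \<otimes> g [^] (n * m) = g [^] (n * m) \<otimes> x" "y \<otimes> g [^] (n * m) = g [^] (n * m) \<otimes> y"
    using commute_pow_mult[OF xy(1) g c(1), of m] commute_pow_mult[OF xy(2) g c(2), of n]
    by (simp_all add: mult.commute)
  then have "(x \<otimes> y) \<otimes> g [^] (n * m) = g [^] (n * m) \<otimes> (x \<otimes> y)"
    using xy g by (metis m_assoc nat_pow_closed)
  then show "x \<otimes> y \<in> commensurator g"
    using nm xy by (auto simp: commensurator_def intro!: exI[of _ "n * m"])
next
  fix x assume "x \<in> commensurator g"
  then obtain n :: nat where n: "n > 0" "x \<in> carrier G" "x \<otimes> g [^] n = g [^] n \<otimes> x"
    by (auto simp: commensurator_def)
  then have "inv x \<otimes> g [^] n = g [^] n \<otimes> inv x"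
    using g by (metis inv_closed inv_solve_left inv_solve_right m_assoc m_closed nat_pow_closed)
  then show "inv x \<in> commensurator g" using n by (auto simp: commensurator_def)
qed

section \<open>Projections of group elements\<close>

locale invariant_vn_subalgebra = group_vn_subalgebra +
  assumes invariant: "g \<in> carrier G \<Longrightarrow>
    (\<lambda>T. left_reg G g \<circ> T \<circ> adjoint_op (carrier G) (left_reg G g)) ` M = M"
begin

definition Ad :: "'a \<Rightarrow> 'a operator \<Rightarrow> 'a operator" where
  "Ad g T = left_reg G g \<circ> T \<circ> left_reg G (inv g)"

lemma Ad_mem: "g \<in> carrier G \<Longrightarrow> T \<in> M \<Longrightarrow> Ad g T \<in> M"
  using invariant[of g] by (auto simp: Ad_def adjoint_left_reg)

lemma act_Ad:
  assumes "g \<in> carrier G" "T \<in> M"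
  shows "act (Ad g T) x =
    reindex (carrier G) (\<lambda>t. inv g \<otimes> t) (act T (reindex (carrier G) (\<lambda>t. g \<otimes> t) x))"
proof -
  have "act (Ad g T) x = act (left_reg G g \<circ> T) (act (left_reg G (inv g)) x)"
    unfolding Ad_def using assms by (intro op_l2_comp left_reg_bounded) auto
  also have "\<dots> = act (left_reg G g) (act T (act (left_reg G (inv g)) x))"
    using M_bounded[OF assms(2)] by (rule op_l2_comp)
  finally show ?thesis using assms by (simp add: act_left_reg)
qed

definition U :: "'a \<Rightarrow> 'a l2 \<Rightarrow> 'a l2" where
  "U w = reindex (carrier G) (\<lambda>t. inv w \<otimes> t \<otimes> w)"

lemma inj_conjugate: "w \<in> carrier G \<Longrightarrow> inj_on (\<lambda>t. inv w \<otimes> t \<otimes> w) (carrier G)"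
  by (auto simp: inj_on_def)

lemma coef_U: "w \<in> carrier G \<Longrightarrow> coef (U w x) t = (if t \<in> carrier G then coef x (inv w \<otimes> t \<otimes> w) else 0)"
  unfolding U_def by (rule coef_reindex[OF inj_conjugate])

lemma hat_Ad:
  assumes w: "w \<in> carrier G" and T: "T \<in> M"
  shows "hat (Ad w T) = U w (hat T)"
proof (rule l2_eqI)
  fix t
  have b: "reindex (carrier G) (\<lambda>t. w \<otimes> t) (basis \<one>) = basis (inv w)"
  proof (rule l2_eqI)
    fix s
    have "w \<otimes> s = \<one> \<longleftrightarrow> s = inv w" if "s \<in> carrier G"
      using w that by (metis inv_equality inv_comm r_inv)
    then show "coef (reindex (carrier G) (\<lambda>t. w \<otimes> t) (basis \<one>)) s = coef (basis (inv w)) s"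
      using w by (auto simp: coef_reindex inj_translate)
  qed
  show "coef (hat (Ad w T)) t = coef (U w (hat T)) t"
    using w act_basis[OF M_bounded[OF T] M_equivariant[OF T], of "inv w"]
    by (simp add: hat_def[of "Ad w T"] act_Ad[OF w T] b coef_reindex inj_translate coef_U)
qed

lemma U_K:
  assumes "w \<in> carrier G" "x \<in> K"
  shows "U w x \<in> K"
  by (rule K_linear_image[OF _ _ assms(2)])
    (simp_all add: U_def bounded_linear_reindex inj_conjugate assms hat_Ad[symmetric, unfolded U_def] hat_in_K Ad_mem)

text \<open>Invariance of \<open>M\<close> makes \<open>K\<close> stable under conjugation by
  \<open>w\<close> and by \<open>inv w\<close>, and these two operators are adjoint to each
  other.\<close>

lemma P_U:
  assumes w: "w \<in> carrier G"
  shows "P (U w x) = U w (P x)"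
  unfolding P_def
proof (rule K.proj_commute[where B' = "U (inv w)"])
  show "linear (U w)"
    unfolding U_def by (intro bounded_linear.linear bounded_linear_reindex inj_conjugate w)
  show "inner (U w x) y = inner x (U (inv w) y)" for x y
    unfolding U_def
    by (rule inner_reindex) (use w in \<open>auto simp: m_assoc\<close>, simp_all add: m_assoc[symmetric])
qed (use w U_K in auto)

text \<open>Conjugation by \<open>g\<close> fixes \<open>basis g\<close> and commutes with
  \<open>P\<close>, so it fixes the projected vector.\<close>

lemma P_basis_conjugate:
  assumes g: "g \<in> carrier G" and t: "t \<in> carrier G"
  shows "coef (P (basis g)) (inv g \<otimes> t \<otimes> g) = coef (P (basis g)) t"
proof -
  have "U g (basis g) = basis g"
    using g by (intro l2_eqI) (auto simp: coef_U inv_solve_left')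
  then have "U g (P (basis g)) = P (basis g)" using P_U[OF g, of "basis g"] by simp
  then show ?thesis using coef_U[OF g, of "P (basis g)" t] t by simp
qed

lemma P_basis_in_K: "P x \<in> K"
  unfolding P_def by (rule K.proj_in)

text \<open>The vector is constant on conjugation orbits under \<open>g\<close>; square summability forces the
  orbits in its support to be finite.\<close>

lemma P_basis_support:
  assumes g: "g \<in> carrier G" and nz: "coef (P (basis g)) s \<noteq> 0"
  shows "s \<in> commensurator g"
proof (rule ccontr)
  assume not_comm: "s \<notin> commensurator g"
  define \<xi> where "\<xi> = P (basis g)"
  have s: "s \<in> carrier G" using nz K_outside[OF P_basis_in_K] by blast
  define orb where "orb n = inv (g [^] n) \<otimes> s \<otimes> g [^] n" for n :: nat
  have orb_c: "orb n \<in> carrier G" for n using g s by (simp add: orb_def)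
  have const: "coef \<xi> (orb n) = coef \<xi> s" for n
  proof (induction n)
    case (Suc n)
    have "orb (Suc n) = inv g \<otimes> orb n \<otimes> g"
      unfolding orb_def using g s by (simp add: inv_mult_group m_assoc)
    then show ?case using Suc P_basis_conjugate[OF g orb_c[of n]] by (simp add: \<xi>_def)
  qed (use s in \<open>simp add: orb_def\<close>)
  have "orb n \<noteq> orb m" if "n < m" for n m
  proof
    assume eq: "orb n = orb m"
    define d where "d = m - n"
    have d: "d > 0" "m = d + n" using that by (auto simp: d_def)
    have gm: "g [^] m = g [^] d \<otimes> g [^] n" using g d(2) by (simp add: nat_pow_mult)
    have "orb m = inv (g [^] n) \<otimes> (inv (g [^] d) \<otimes> s \<otimes> g [^] d) \<otimes> g [^] n"
      unfolding orb_def gm using g s by (simp add: inv_mult_group m_assoc)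
    then have "s = inv (g [^] d) \<otimes> s \<otimes> g [^] d"
      using eq g s unfolding orb_def by simp
    then have "g [^] d \<otimes> s = s \<otimes> g [^] d"
      using g s by (metis inv_closed inv_solve_left m_assoc m_closed nat_pow_closed)
    then have "s \<otimes> g [^] d = g [^] d \<otimes> s" by simp
    then show False using not_comm d(1) s unfolding commensurator_def by blast
  qed
  then have inj: "inj orb" by (metis injI linorder_neqE_nat)
  define c where "c = (cmod (coef \<xi> s))\<^sup>2"
  have c: "c > 0" using nz by (simp add: c_def \<xi>_def)
  obtain N :: nat where N: "(norm \<xi>)\<^sup>2 / c < N" using reals_Archimedean2 by blast
  have "(\<Sum>t\<in>orb ` {..<N}. (cmod (coef \<xi> t))\<^sup>2) = N * c"
    using inj_on_subset[OF inj] by (subst sum.reindex) (auto simp: const c_def)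
  then have "N * c \<le> (norm \<xi>)\<^sup>2" using sum_coef_le[of "orb ` {..<N}" \<xi>] by simp
  then show False using N c by (simp add: field_simps)
qed

text \<open>\<open>P\<close> is self-adjoint and fixes \<open>basis \<one>\<close>. This keeps
  \<open>\<one>\<close> out of the support, as the separation hypothesis concerns nontrivial
  elements only.\<close>

lemma P_basis_one:
  assumes "g \<noteq> \<one>"
  shows "coef (P (basis g)) \<one> = 0"
proof -
  have "coef (P (basis g)) \<one> = cinner (basis g) (P (basis \<one>))" using cinner_P[of "basis g" "basis \<one>"] by simp
  also have "P (basis \<one>) = basis \<one>" unfolding P_def by (rule K.proj_id[OF basis_one_in_K])
  finally show ?thesis using assms by simp
qed

text \<open>Applying \<open>P\<close> to \<open>\<lambda>(g) T \<lambda>(g)\<^sup>* \<delta>\<^sub>g = \<delta>\<^sub>g T\<close> shows that \<open>\<lambda>(g)\<^sup>* P \<delta>\<^sub>g\<close> commutes with \<open>M\<close>.\<close>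

lemma conv_commute:
  assumes g: "g \<in> carrier G" and a: "a \<in> carrier G" and y: "y \<in> K"
  defines "x \<equiv> reindex (carrier G) (\<lambda>t. g \<otimes> t) (P (basis g))"
  shows "conv y x a = conv x y a"
proof -
  define \<xi> where "\<xi> = P (basis g)"
  have on_M: "conv (hat T) x a = conv x (hat T) a" if T: "T \<in> M" for T
  proof -
    have b: "reindex (carrier G) (\<lambda>t. g \<otimes> t) (basis g) = basis \<one>"
      using g by (intro l2_eqI) (auto simp: coef_reindex inj_translate r_cancel_one')
    have "act (Ad g T) (basis g) = right_act T (basis g)"
      using g by (intro l2_eqI)
        (simp add: act_Ad[OF g T] b hat_def[symmetric] coef_reindex inj_translate coef_right_act[OF T] conv_basis_left)
    then have "act (Ad g T) \<xi> = right_act T \<xi>"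
      unfolding \<xi>_def using P_act[OF Ad_mem[OF g T]] P_right_act[OF T] by metis
    then have "coef (act (Ad g T) \<xi>) (g \<otimes> a) = coef (right_act T \<xi>) (g \<otimes> a)" by simp
    moreover have "coef (act (Ad g T) \<xi>) (g \<otimes> a) = coef (act T x) a"
      using g a by (simp add: act_Ad[OF g T] coef_reindex inj_translate x_def \<xi>_def m_assoc[symmetric])
    moreover have "conv \<xi> (hat T) (g \<otimes> a) = conv x (hat T) a"
      unfolding conv_def using g a
      by (intro infsum_cong) (simp add: x_def \<xi>_def coef_reindex inj_translate m_assoc)
    ultimately show ?thesis
      using g a by (simp add: coef_right_act[OF T] act_conv[OF M_bounded[OF T] M_equivariant[OF T] a])
  qed
  obtain h where h: "\<And>n. h n \<in> hat ` M" "h \<longlonglongrightarrow> y" using y unfolding K_def closure_sequential by blast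
  have "(\<lambda>n. conv (h n) x a) \<longlonglongrightarrow> conv y x a" "(\<lambda>n. conv x (h n) a) \<longlonglongrightarrow> conv x y a"
    by (intro bounded_linear.tendsto[OF bounded_linear_conv(1)[OF a]]
        bounded_linear.tendsto[OF bounded_linear_conv(2)[OF a]] h)+
  moreover have "(\<lambda>n. conv (h n) x a) = (\<lambda>n. conv x (h n) a)"
  proof
    fix n
    obtain T where "T \<in> M" "h n = hat T" using h(1)[of n] by blast
    then show "conv (h n) x a = conv x (h n) a" using on_M by simp
  qed
  ultimately show ?thesis using LIMSEQ_unique by metis
qed

lemma conv_diff_bound:
  assumes "a \<in> carrier G"
  shows "cmod (conv x y a - conv x' y' a) \<le> norm (x - x') * norm y + norm x' * norm (y - y')"
proof -
  have "conv x y a - conv x' y' a = conv (x - x') y a + conv x' (y - y') a"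
    using linear_simps(2)[OF bounded_linear_conv(1)[OF assms]] linear_simps(2)[OF bounded_linear_conv(2)[OF assms]]
    by simp
  then show ?thesis
    using norm_triangle_ineq[of "conv (x - x') y a" "conv x' (y - y') a"]
      cmod_conv_le[OF assms, of "x - x'" y] cmod_conv_le[OF assms, of x' "y - y'"] by simp
qed

text \<open>Comparing the coefficients of \<open>x * U\<^sub>w \<xi>\<close> and \<open>U\<^sub>w \<xi> * x\<close> at \<open>c\<^sub>0 w d\<^sub>0 w\<^sup>-\<^sup>1\<close>: after truncation to
  a finite set only the term \<open>x(c\<^sub>0) \<xi>(d\<^sub>0)\<close> survives on one side and nothing on the other.\<close>

lemma P_basis_concentrated:
  assumes g: "g \<in> carrier G" "g \<noteq> \<one>"
    and sep: "\<And>F. finite F \<Longrightarrow> F \<subseteq> commensurator g - {\<one>} \<Longrightarrow>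
      \<exists>w\<in>carrier G. (\<forall>c\<in>F. \<forall>d\<in>F. w \<otimes> d \<otimes> inv w \<noteq> c) \<and>
        (\<forall>c\<in>F. \<forall>c'\<in>F. \<forall>d\<in>F. \<forall>d'\<in>F. w \<otimes> d' \<otimes> inv w \<otimes> c' \<noteq> c \<otimes> (w \<otimes> d \<otimes> inv w))"
    and s: "s \<noteq> g"
  shows "coef (P (basis g)) s = 0"
proof (rule ccontr)
  define \<xi> where "\<xi> = P (basis g)"
  assume "coef (P (basis g)) s \<noteq> 0"
  then have nz: "coef \<xi> s \<noteq> 0" by (simp add: \<xi>_def)
  interpret C: subgroup "commensurator g" G by (rule subgroup_commensurator[OF g(1)])
  have \<xi>C: "t \<in> commensurator g" if "coef \<xi> t \<noteq> 0" for t
    using P_basis_support[OF g(1)] that by (simp add: \<xi>_def)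
  have "g \<otimes> g [^] (1::nat) = g [^] (1::nat) \<otimes> g" using g by simp
  then have gC: "g \<in> commensurator g" unfolding commensurator_def using g(1) zero_less_one by blast
  have \<xi>1: "coef \<xi> \<one> = 0" using P_basis_one[OF g(2)] by (simp add: \<xi>_def)
  have Cc: "t \<in> carrier G" if "t \<in> commensurator g" for t using that C.subset by auto
  define x where "x = reindex (carrier G) (\<lambda>t. g \<otimes> t) \<xi>"
  have x: "coef x t = (if t \<in> carrier G then coef \<xi> (g \<otimes> t) else 0)" for t
    using g by (simp add: x_def coef_reindex inj_translate)
  have xC: "t \<in> commensurator g" if "coef x t \<noteq> 0" for t
  proof -
    have t: "t \<in> carrier G" "g \<otimes> t \<in> commensurator g" using that \<xi>C by (auto simp: x split: if_splits)
    have "inv g \<otimes> (g \<otimes> t) \<in> commensurator g" by (rule C.m_closed[OF C.m_inv_closed[OF gC] t(2)])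
    moreover have "inv g \<otimes> (g \<otimes> t) = t" using t g by (simp add: m_assoc[symmetric])
    ultimately show ?thesis by (simp only:)
  qed
  have sC: "s \<in> commensurator g" "s \<in> carrier G" "s \<noteq> \<one>" using \<xi>C[OF nz] Cc nz \<xi>1 by auto
  \<comment> \<open>A nonzero coefficient of \<open>\<xi>\<close> at \<open>s \<noteq> g\<close>
    becomes a coefficient of \<open>x\<close> at a nontrivial element.\<close>
  define c0 where "c0 = inv g \<otimes> s"
  have c0: "c0 \<in> commensurator g" "c0 \<in> carrier G" using sC gC g by (auto simp: c0_def)
  have gc0: "g \<otimes> c0 = s" using sC g by (simp add: c0_def m_assoc[symmetric])
  then have c01: "c0 \<noteq> \<one>" using s g by auto
  have xc0: "coef x c0 = coef \<xi> s" using c0 gc0 by (simp add: x)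
  define \<alpha> where "\<alpha> = cmod (coef x c0 * coef \<xi> s)"
  have \<alpha>: "\<alpha> > 0" using nz xc0 by (simp add: \<alpha>_def)
  define \<beta> where "\<beta> = norm \<xi> + norm x + 1"
  have \<beta>: "\<beta> > 0" unfolding \<beta>_def by (intro add_nonneg_pos) auto
  \<comment> \<open>Each truncation error will be at most \<open>e * \<beta>\<close>, hence at most
    a quarter of \<open>\<alpha>\<close>; \<open>e \<le> 1\<close> absorbs the quadratic term, which
    accounts for the 1 in \<open>\<beta>\<close>.\<close>
  define e where "e = min 1 (\<alpha> / (4 * \<beta>))"
  have e: "e > 0" "e \<le> 1" "e * \<beta> \<le> \<alpha> / 4"
    using \<alpha> \<beta> by (auto simp: e_def min_def field_simps)
  obtain F1 where F1: "finite F1" "\<And>F' y. F1 \<subseteq> F' \<Longrightarrow> finite F' \<Longrightarrow>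
      (\<And>t. coef y t = (if t \<in> F' then coef x t else 0)) \<Longrightarrow> norm (x - y) < e"
    using finite_truncation[OF e(1), of x] by blast
  obtain F2 where F2: "finite F2" "\<And>F' y. F2 \<subseteq> F' \<Longrightarrow> finite F' \<Longrightarrow>
      (\<And>t. coef y t = (if t \<in> F' then coef \<xi> t else 0)) \<Longrightarrow> norm (\<xi> - y) < e"
    using finite_truncation[OF e(1), of \<xi>] by blast
  define F where "F = F1 \<union> F2 \<union> {c0, s}"
  define x0 \<xi>0 where "x0 = restrict_l2 F x" and "\<xi>0 = restrict_l2 F \<xi>"
  have near: "norm (x - x0) < e" "norm (\<xi> - \<xi>0) < e"
    using F1 F2 by (auto simp: F_def x0_def \<xi>0_def intro!: F1(2)[of F] F2(2)[of F])
  define D where "D = F \<inter> commensurator g"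
  have D: "finite D" "D \<subseteq> commensurator g" using F1 F2 by (auto simp: D_def F_def)
  have suppx: "t \<in> D" if "coef x0 t \<noteq> 0" for t using that xC by (auto simp: x0_def D_def split: if_splits)
  have supp\<xi>: "t \<in> D" "t \<noteq> \<one>" if "coef \<xi>0 t \<noteq> 0" for t
    using that \<xi>C \<xi>1 by (auto simp: \<xi>0_def D_def split: if_splits)
  have c0D: "c0 \<in> D" "s \<in> D" using c0 sC by (auto simp: D_def F_def)
  \<comment> \<open>Besides the truncated supports, \<open>E\<close> contains the quotients that
    arise when two different terms of one convolution meet at the same group element.\<close>
  define E where "E = (D \<union> (\<lambda>(c, c'). inv c \<otimes> c') ` (D \<times> D) \<union> (\<lambda>(d, d'). d \<otimes> inv d') ` (D \<times> D)) - {\<one>}"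
  have Efin: "finite E" unfolding E_def using D(1) by blast
  have "inv c \<otimes> c' \<in> commensurator g" "c \<otimes> inv c' \<in> commensurator g" if "c \<in> D" "c' \<in> D" for c c'
    using D(2) that by auto
  then have Esub: "E \<subseteq> commensurator g - {\<one>}" unfolding E_def using D(2) by auto
  obtain w where w: "w \<in> carrier G"
    and sep1: "\<forall>c\<in>E. \<forall>d\<in>E. w \<otimes> d \<otimes> inv w \<noteq> c"
    and sep2: "\<forall>c\<in>E. \<forall>c'\<in>E. \<forall>d\<in>E. \<forall>d'\<in>E. w \<otimes> d' \<otimes> inv w \<otimes> c' \<noteq> c \<otimes> (w \<otimes> d \<otimes> inv w)"
    using sep[OF Efin Esub] by (elim bexE conjE) (rule that)
  define a where "a = c0 \<otimes> (w \<otimes> s \<otimes> inv w)"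
  have a: "a \<in> carrier G" using c0 w sC by (simp add: a_def)
  define \<eta> \<eta>0 where "\<eta> = U w \<xi>" and "\<eta>0 = U w \<xi>0"
  have n\<eta>: "norm \<eta> \<le> norm \<xi>"
    unfolding \<eta>_def U_def by (rule norm_reindex_le[OF inj_conjugate[OF w]])
  have "\<eta> - \<eta>0 = U w (\<xi> - \<xi>0)" using w by (intro l2_eqI) (simp add: \<eta>_def \<eta>0_def coef_U)
  then have n\<eta>0: "norm (\<eta> - \<eta>0) < e"
    using norm_reindex_le[OF inj_conjugate[OF w], of "\<xi> - \<xi>0"] near(2) unfolding U_def by simp
  have nx0: "norm x0 \<le> norm x + e" using near(1) norm_triangle_ineq2[of x0 x] by (simp add: norm_minus_commute)
  have n\<eta>0': "norm \<eta>0 \<le> norm \<xi> + e"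
    using n\<eta>0 n\<eta> norm_triangle_ineq2[of \<eta>0 \<eta>] by (simp add: norm_minus_commute)
  have conj_D: "t \<in> carrier G" "w \<otimes> (inv w \<otimes> t \<otimes> w) \<otimes> inv w = t" "inv w \<otimes> t \<otimes> w \<in> D" "inv w \<otimes> t \<otimes> w \<noteq> \<one>"
    if "coef \<eta>0 t \<noteq> 0" for t
  proof -
    show t: "t \<in> carrier G" using that w by (auto simp: \<eta>0_def coef_U split: if_splits)
    show "w \<otimes> (inv w \<otimes> t \<otimes> w) \<otimes> inv w = t" using t w by (simp add: m_assoc) (simp add: m_assoc[symmetric])
    show "inv w \<otimes> t \<otimes> w \<in> D" "inv w \<otimes> t \<otimes> w \<noteq> \<one>"
      using that supp\<xi> w t by (auto simp: \<eta>0_def coef_U)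
  qed
  \<comment> \<open>Cancelling the conjugate of \<open>s\<close> turns the equation into
    \<open>w \<otimes> (d \<otimes> inv s) \<otimes> inv w = c\<close>, which \<open>sep1\<close>
    forbids, or which forces \<open>d = s\<close> when \<open>c = \<one>\<close>.\<close>
  have clash: "d = s" if cD: "c \<in> carrier G" "c = \<one> \<or> c \<in> E" and d: "d \<in> D" and eq: "w \<otimes> d \<otimes> inv w = c \<otimes> (w \<otimes> s \<otimes> inv w)" for c d
  proof (rule ccontr)
    assume "d \<noteq> s"
    have dc: "d \<in> carrier G" using d D Cc by auto
    have "d \<otimes> inv s \<noteq> \<one>" using \<open>d \<noteq> s\<close> dc sC by (metis inv_closed inv_equality inv_inv)
    then have dE: "d \<otimes> inv s \<in> E" using d c0D by (auto simp: E_def)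
    have "w \<otimes> (d \<otimes> inv s) \<otimes> inv w = (w \<otimes> d \<otimes> inv w) \<otimes> inv (w \<otimes> s \<otimes> inv w)"
      using dc sC w by (simp add: inv_mult_group m_assoc) (simp add: m_assoc[symmetric])
    also have "\<dots> = c" unfolding eq using cD w sC by (simp add: m_assoc)
    finally have c_eq: "w \<otimes> (d \<otimes> inv s) \<otimes> inv w = c" .
    then have "c \<noteq> \<one>" using \<open>d \<otimes> inv s \<noteq> \<one>\<close> dc sC w
      by (metis inv_closed inv_equality inv_inv inv_solve_left m_closed r_inv r_one)
    then show False using sep1 dE c_eq cD(2) by blast
  qed
  have main: "conv x0 \<eta>0 a = coef x c0 * coef \<xi> s"
  proof -
    have "conv x0 \<eta>0 a = (\<Sum>\<^sub>\<infinity>c\<in>{c0}. coef x0 c * coef \<eta>0 (inv c \<otimes> a))"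
      unfolding conv_swap[OF a]
    proof (rule infsum_cong_neutral)
      fix c assume c: "c \<in> carrier G - {c0}"
      show "coef x0 c * coef \<eta>0 (inv c \<otimes> a) = 0"
      proof (rule ccontr)
        assume "coef x0 c * coef \<eta>0 (inv c \<otimes> a) \<noteq> 0"
        then have nz: "coef x0 c \<noteq> 0" "coef \<eta>0 (inv c \<otimes> a) \<noteq> 0" by auto
        have "inv c \<otimes> c0 \<noteq> \<one>" using c c0 by (metis Diff_iff inv_closed inv_equality inv_inv singletonI)
        then have cE: "inv c \<otimes> c0 \<in> E" using suppx[OF nz(1)] c0D by (auto simp: E_def)
        define d where "d = inv w \<otimes> (inv c \<otimes> a) \<otimes> w"
        have d: "d \<in> D" "w \<otimes> d \<otimes> inv w = inv c \<otimes> a" using conj_D[OF nz(2)] by (auto simp: d_def)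
        have "w \<otimes> d \<otimes> inv w = (inv c \<otimes> c0) \<otimes> (w \<otimes> s \<otimes> inv w)"
          using d c c0 w sC by (simp add: a_def m_assoc)
        moreover from this have "d = s" using clash[of "inv c \<otimes> c0" d] cE d c c0 by simp
        ultimately have "inv c \<otimes> c0 = \<one>"
          using c c0 w sC by (metis Diff_iff inv_closed m_closed r_cancel_one')
        then show False using \<open>inv c \<otimes> c0 \<noteq> \<one>\<close> by simp
      qed
    qed (use c0 in auto)
    also have "\<dots> = coef x0 c0 * coef \<eta>0 (inv c0 \<otimes> a)" by simp
    also have "inv c0 \<otimes> a = w \<otimes> s \<otimes> inv w" using c0 w sC by (simp add: a_def m_assoc[symmetric])
    also have "coef \<eta>0 (w \<otimes> s \<otimes> inv w) = coef \<xi>0 s"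
      using w sC by (simp add: \<eta>0_def coef_U m_assoc) (simp add: m_assoc[symmetric])
    finally show ?thesis by (simp add: x0_def \<xi>0_def F_def)
  qed
  have none: "conv \<eta>0 x0 a = 0"
    unfolding conv_swap[OF a]
  proof (rule infsum_0)
    fix t assume t: "t \<in> carrier G"
    show "coef \<eta>0 t * coef x0 (inv t \<otimes> a) = 0"
    proof (rule ccontr)
      assume "coef \<eta>0 t * coef x0 (inv t \<otimes> a) \<noteq> 0"
      then have nz: "coef \<eta>0 t \<noteq> 0" "coef x0 (inv t \<otimes> a) \<noteq> 0" by auto
      define d c where "d = inv w \<otimes> t \<otimes> w" and "c = inv t \<otimes> a"
      have d: "d \<in> D" "d \<noteq> \<one>" "w \<otimes> d \<otimes> inv w = t" using conj_D[OF nz(1)] by (auto simp: d_def)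
      have c: "c \<in> D" "t \<otimes> c = a" using suppx[OF nz(2)] t a by (auto simp: c_def m_assoc[symmetric])
      have eq: "w \<otimes> d \<otimes> inv w \<otimes> c = c0 \<otimes> (w \<otimes> s \<otimes> inv w)" using c d by (simp add: a_def)
      show False
      \<comment> \<open>Since \<open>\<one>\<close> is not in \<open>E\<close>, \<open>sep2\<close>
        says nothing for \<open>c = \<one>\<close>; the equation then has the form treated by
        \<open>clash\<close>.\<close>
      proof (cases "c = \<one>")
        case True
        then have eq': "w \<otimes> d \<otimes> inv w = c0 \<otimes> (w \<otimes> s \<otimes> inv w)" using eq d t by simp
        have "d = s" using clash[of c0 d] c0 c0D c01 d eq' by (auto simp: E_def)
        then show False using eq' c0 c01 w sC by (metis inv_closed m_closed r_cancel_one')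
      next
        case False
        then have "c \<in> E" "d \<in> E" "c0 \<in> E" "s \<in> E" using c d c0D c01 sC by (auto simp: E_def)
        then show False using sep2 eq by blast
      qed
    qed
  qed
  have "\<eta> \<in> K" unfolding \<eta>_def \<xi>_def by (intro U_K w P_basis_in_K)
  then have comm: "conv \<eta> x a = conv x \<eta> a"
    using conv_commute[OF g(1) a] by (simp add: x_def \<xi>_def)
  \<comment> \<open>The same number \<open>conv x \<eta> a\<close> is compared with the single
    surviving product and, after commuting, with 0.\<close>
  have "cmod (conv x \<eta> a - conv x0 \<eta>0 a) \<le> e * norm \<xi> + (norm x + e) * e"
    using conv_diff_bound[OF a, of x \<eta> x0 \<eta>0]
      mult_mono[OF less_imp_le[OF near(1)] n\<eta>] mult_mono[OF nx0 less_imp_le[OF n\<eta>0]] e(1) by simp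
  moreover have "cmod (conv \<eta> x a - conv \<eta>0 x0 a) \<le> e * norm x + (norm \<xi> + e) * e"
    using conv_diff_bound[OF a, of \<eta> x \<eta>0 x0]
      mult_mono[OF less_imp_le[OF n\<eta>0] order_refl[of "norm x"]] mult_mono[OF n\<eta>0' less_imp_le[OF near(1)]] e(1) by simp
  moreover have "e * e \<le> e" using e by (simp add: mult_left_le)
  then have "e * norm \<xi> + (norm x + e) * e \<le> e * \<beta>" "e * norm x + (norm \<xi> + e) * e \<le> e * \<beta>"
    by (simp_all add: \<beta>_def algebra_simps)
  ultimately have "cmod (conv x \<eta> a - coef x c0 * coef \<xi> s) \<le> \<alpha> / 4" "cmod (conv x \<eta> a) \<le> \<alpha> / 4"
    using e(3) main none comm by simp_all
  then have "cmod (coef x c0 * coef \<xi> s) \<le> \<alpha> / 4 + \<alpha> / 4"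
    using norm_triangle_ineq4[of "conv x \<eta> a" "conv x \<eta> a - coef x c0 * coef \<xi> s"] by simp
  then show False using \<alpha> by (simp add: \<alpha>_def)
qed

lemma P_basis_cases:
  assumes conc: "\<And>s. s \<noteq> g \<Longrightarrow> coef (P (basis g)) s = 0"
  shows "P (basis g) = 0 \<or> P (basis g) = basis g"
proof -
  define c where "c = coef (P (basis g)) g"
  have eq: "P (basis g) = cscale c (basis g)"
    using conc by (intro l2_eqI) (auto simp: c_def)
  have "P (P (basis g)) = P (basis g)" using K.proj_id[OF P_basis_in_K] by (simp add: P_def)
  then have "cscale c (cscale c (basis g)) = cscale c (basis g)"
    unfolding eq P_cscale by (simp add: eq[symmetric])
  then have "c * c = c" by (metis basis.rep_eq cscale.rep_eq mult.right_neutral)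
  then have "c = 0 \<or> c = 1" by simp
  then show ?thesis using eq by (auto intro!: l2_eqI)
qed

text \<open>For \<open>T\<close> in \<open>M\<close> the coefficient of \<open>hat T\<close> at
  \<open>t\<close> pairs \<open>hat T\<close> with \<open>P (basis t)\<close>, so it vanishes off
  \<open>H\<close>. Thus \<open>hat T\<close> is a limit of combinations of \<open>basis h\<close>,
  \<open>h \<in> H\<close>, and the density criterion, applied to any competing subalgebra
  \<open>N\<close>, puts \<open>T\<close> into \<open>N\<close>.\<close>

lemma generated_by_normal_subgroup:
  assumes dich: "\<And>g. g \<in> carrier G \<Longrightarrow> P (basis g) = 0 \<or> P (basis g) = basis g"
  shows "\<exists>H. H \<lhd> G \<and> M = subgroup_vn_algebra G H"
proof -
  \<comment> \<open>Membership in \<open>M\<close>, rather than the condition on \<open>P\<close>,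
    makes the subgroup and normality claims immediate; \<open>HI\<close> links the two.\<close>
  define H where "H = {h \<in> carrier G. left_reg G h \<in> M}"
  have HI: "h \<in> H" if "h \<in> carrier G" "P (basis h) = basis h" for h
  proof -
    have "hat (left_reg G h) \<in> closure (hat ` M)"
      using P_basis_in_K[of "basis h"] that by (simp add: hat_left_reg K_def)
    then show ?thesis
      using hat_closure_memI[OF left_reg_bounded equivariant_left_reg] that by (simp add: H_def)
  qed
  have comp: "left_reg G (g \<otimes> h) = left_reg G g \<circ> left_reg G h" if "g \<in> carrier G" "h \<in> carrier G" for g h
  proof (rule ext)
    fix x show "left_reg G (g \<otimes> h) x = (left_reg G g \<circ> left_reg G h) x"
    proof (cases "x \<in> ell2 (carrier G)")
      case True
      then show ?thesis
        using bounded_opsD(1)[OF left_reg_bounded[OF that(2)] True] that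
        by (auto simp: left_reg_def inv_mult_group m_assoc fun_eq_iff)
    qed (use that in \<open>auto simp: left_reg_def\<close>)
  qed
  have one: "left_reg G \<one> = id_op (carrier G)"
    by (auto simp: left_reg_def id_op_def fun_eq_iff ell2_def)
  have sub: "subgroup H G"
  proof
    show "x \<otimes> y \<in> H" if "x \<in> H" "y \<in> H" for x y
      using that comp[of x y] M_comp by (auto simp: H_def)
    show "inv x \<in> H" if "x \<in> H" for x
      using that adjoint_left_reg[of x] M_adj[of "left_reg G x"] by (auto simp: H_def)
  qed (use one M_id in \<open>auto simp: H_def\<close>)
  have "g \<otimes> h \<otimes> inv g \<in> H" if "g \<in> carrier G" "h \<in> H" for g h
  proof -
    have h: "h \<in> carrier G" "left_reg G h \<in> M" using that by (auto simp: H_def)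
    then have "Ad g (left_reg G h) = left_reg G (g \<otimes> h \<otimes> inv g)"
      using that by (simp add: Ad_def comp)
    then show ?thesis using Ad_mem[OF that(1) h(2)] h that by (simp add: H_def)
  qed
  then have normal: "H \<lhd> G" using sub by (simp add: normal_inv_iff)
  have M_least: "M \<subseteq> N" if N: "vn_subalgebra (carrier G) (group_vn_algebra G) N" "left_reg G ` H \<subseteq> N" for N
  proof
    interpret N: group_vn_subalgebra G N
      using N by unfold_locales (auto simp: vn_subalgebra_def)
    fix T assume T: "T \<in> M"
    have "((\<lambda>t. cscale (coef (hat T) t) (basis t)) has_sum hat T) UNIV" by (rule has_sum_basis)
    moreover have "(\<Sum>t\<in>F. cscale (coef (hat T) t) (basis t)) \<in> N.K" for F
    proof (rule subspace_sum[OF N.K.subspace])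
      fix t
      show "cscale (coef (hat T) t) (basis t) \<in> N.K"
      proof (cases "t \<in> H")
        case True
        then have "basis t \<in> N.K"
          using N(2) N.hat_in_K[of "left_reg G t"] hat_left_reg[of t] by (auto simp: H_def)
        then show ?thesis by (rule N.K_cscale)
      next
        case False
        have "coef (hat T) t = 0"
        proof (cases "t \<in> carrier G")
          case True
          then have z: "P (basis t) = 0" using dich[OF True] HI[OF True] False by blast
          have "coef (hat T) t = cinner (P (hat T)) (basis t)"
            using K.proj_id[OF hat_in_K[OF T]] by (simp add: P_def)
          also have "\<dots> = cinner (hat T) 0" unfolding cinner_P z ..
          also have "\<dots> = 0" by (simp add: cinner_def)
          finally show ?thesis .
        qed (simp add: K_outside[OF hat_in_K[OF T]])
        then have "cscale (coef (hat T) t) (basis t) = 0" by (intro l2_eqI) simp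
        then show ?thesis using subspace_0[OF N.K.subspace] by simp
      qed
    qed
    ultimately have "hat T \<in> N.K"
      unfolding has_sum_def by (intro Lim_in_closed_set[OF N.K.closed]) auto
    then show "T \<in> N"
      unfolding N.K_def by (intro N.hat_closure_memI M_bounded M_equivariant T)
  qed
  have "M = subgroup_vn_algebra G H"
    unfolding subgroup_vn_algebra_def
  proof (rule hull_unique[symmetric])
    show "left_reg G ` H \<subseteq> M" by (auto simp: H_def)
    show "vn_subalgebra (carrier G) (group_vn_algebra G) M" using vna M_sub by (simp add: vn_subalgebra_def)
  qed (rule M_least)
  then show ?thesis using normal by blast
qed

end

section \<open>Growth and fixed points at infinity in hyperbolic groups\<close>

text \<open>What the geometry needs of a word length: \<open>len_split\<close> supplies points on a
  geodesic from \<open>\<one>\<close> to \<open>x\<close>, and \<open>four_point\<close> is Gromov's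
  condition in a form without base point.\<close>

locale hyperbolic_length = group G for G (structure) +
  fixes len :: "'a \<Rightarrow> nat" and \<delta> :: real
  assumes len_one [simp]: "len \<one> = 0"
    and len_mult: "x \<in> carrier G \<Longrightarrow> y \<in> carrier G \<Longrightarrow> len (x \<otimes> y) \<le> len x + len y"
    and len_inv [simp]: "x \<in> carrier G \<Longrightarrow> len (inv x) = len x"
    and finite_ball: "finite {x \<in> carrier G. len x \<le> n}"
    and len_split: "x \<in> carrier G \<Longrightarrow> r \<le> len x \<Longrightarrow>
      \<exists>p\<in>carrier G. len p = r \<and> len (inv p \<otimes> x) = len x - r"
    and delta_nonneg: "0 \<le> \<delta>"
    and four_point: "\<lbrakk>x \<in> carrier G; y \<in> carrier G; z \<in> carrier G; w \<in> carrier G\<rbrakk> \<Longrightarrow>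
      real (len (inv x \<otimes> y)) + real (len (inv z \<otimes> w)) \<le>
        max (real (len (inv x \<otimes> z)) + real (len (inv y \<otimes> w)))
            (real (len (inv x \<otimes> w)) + real (len (inv y \<otimes> z))) + 2 * \<delta>"
begin

definition dst :: "'a \<Rightarrow> 'a \<Rightarrow> real" where
  "dst x y = real (len (inv x \<otimes> y))"

definition gp :: "'a \<Rightarrow> 'a \<Rightarrow> real" where
  "gp x y = (real (len x) + real (len y) - dst x y) / 2"

definition ball_card :: "real \<Rightarrow> nat" where
  "ball_card R = card {x \<in> carrier G. real (len x) \<le> R}"

lemma dst_four:
  assumes "x \<in> carrier G" "y \<in> carrier G" "z \<in> carrier G" "w \<in> carrier G"
  shows "dst x y + dst z w \<le> dst x z + dst y w + 2 * \<delta> \<or>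
    dst x y + dst z w \<le> dst x w + dst y z + 2 * \<delta>"
  using four_point[OF assms] unfolding dst_def by linarith

lemma dst_mult_left [simp]:
  assumes "a \<in> carrier G" "x \<in> carrier G" "y \<in> carrier G"
  shows "dst (a \<otimes> x) (a \<otimes> y) = dst x y"
proof -
  have "inv (a \<otimes> x) \<otimes> (a \<otimes> y) = inv x \<otimes> (inv a \<otimes> (a \<otimes> y))"
    using assms by (simp add: inv_mult_group m_assoc)
  also have "inv a \<otimes> (a \<otimes> y) = y"
    using assms by (simp add: m_assoc[symmetric])
  finally show ?thesis by (simp add: dst_def)
qed

lemma dst_commute: "x \<in> carrier G \<Longrightarrow> y \<in> carrier G \<Longrightarrow> dst x y = dst y x"
  unfolding dst_def using len_inv[of "inv x \<otimes> y"] by (simp add: inv_mult_group)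

lemma dst_one [simp]: "x \<in> carrier G \<Longrightarrow> dst \<one> x = len x" "x \<in> carrier G \<Longrightarrow> dst x \<one> = len x"
  by (simp_all add: dst_def)

lemma dst_triangle:
  assumes "x \<in> carrier G" "y \<in> carrier G" "z \<in> carrier G"
  shows "dst x z \<le> dst x y + dst y z"
proof -
  have "inv x \<otimes> z = (inv x \<otimes> y) \<otimes> (inv y \<otimes> z)"
    using assms by (metis dst_mult_left inv_closed inv_solve_left m_assoc m_closed)
  then show ?thesis using len_mult[of "inv x \<otimes> y" "inv y \<otimes> z"] assms by (simp add: dst_def)
qed

lemma dst_inv_left:
  assumes "z \<in> carrier G" "x \<in> carrier G" "y \<in> carrier G"
  shows "dst x (inv z \<otimes> y) = dst (z \<otimes> x) y"
  using dst_mult_left[of z x "inv z \<otimes> y"] assms by (simp add: m_assoc[symmetric])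

lemma gp_commute: "x \<in> carrier G \<Longrightarrow> y \<in> carrier G \<Longrightarrow> gp x y = gp y x"
  by (simp add: gp_def dst_commute)

lemma gp_le_len: 
  assumes "x \<in> carrier G" "y \<in> carrier G"
  shows "gp x y \<le> len x" "gp x y \<le> len y"
  using dst_triangle[of \<one> x y] dst_triangle[of \<one> y x] assms
  by (simp_all add: gp_def dst_commute)

text \<open>Translating both points by \<open>a\<close> amounts to moving the base point by distance
  \<open>len a\<close>, and Gromov products are 1-Lipschitz in the base point.\<close>

lemma gp_mult_left:
  assumes "x \<in> carrier G" "y \<in> carrier G" "a \<in> carrier G"
  shows "gp x y - len a \<le> gp (a \<otimes> x) (a \<otimes> y)"
  using dst_triangle[of "inv a" \<one> x] dst_triangle[of "inv a" \<one> y]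
    dst_triangle[of \<one> "inv a" x] dst_triangle[of \<one> "inv a" y] 
    dst_inv_left[of a \<one> x] dst_inv_left[of a \<one> y] assms
    dst_mult_left[of a "inv a" x] dst_mult_left[of a "inv a" y]
  by (simp add: gp_def field_simps)

lemma gp_ultra:
  assumes "x \<in> carrier G" "y \<in> carrier G" "z \<in> carrier G"
  shows "gp x y - \<delta> \<le> gp x z \<or> gp y z - \<delta> \<le> gp x z"
  using dst_four[of x z y \<one>] assms dst_commute[of z y] by (auto simp: gp_def field_simps)

text \<open>When \<open>z\<close> moves \<open>k\<close> along itself, what \<open>z\<close> adds to
  the length of \<open>k\<close> its inverse removes, up to \<delta>. Hence if neither shortens
  \<open>k\<close>, neither lengthens it by more than \<open>2 * \<delta>\<close>.\<close>

lemma shift_bound: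
  assumes "z \<in> carrier G" "k \<in> carrier G" "len z \<le> gp k (z \<otimes> k)"
  shows "real (len (z \<otimes> k)) + len (inv z \<otimes> k) \<le> 2 * real (len k) + 2 * \<delta>"
  using dst_four[of \<one> "z \<otimes> k" z k] assms dst_mult_left[of z k \<one>] dst_inv_left[of z \<one> k]
    dst_commute[of "z \<otimes> k" k] len_mult[of z k]
  by (auto simp: gp_def)

text \<open>Each \<open>z\<close> moves the point \<open>p\<close> at distance \<open>L\<close> on a
  geodesic from \<open>\<one>\<close> to \<open>k\<close> by at most \<open>6 * \<delta>\<close>, so
  conjugation by \<open>p\<close> embeds \<open>V\<close> into a ball. The constant is
  \<open>2 * \<delta>\<close> from the shift and \<open>2 * \<delta>\<close> from each of two
  successive four-point estimates.\<close>

lemma card_nearly_fixing: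
  assumes V: "V \<subseteq> carrier G" and k: "k \<in> carrier G"
    and L: "\<And>z. z \<in> V \<Longrightarrow> len z \<le> L" "\<And>z. z \<in> V \<Longrightarrow> 2 * real L \<le> gp k (z \<otimes> k)"
    and shift: "\<And>z. z \<in> V \<Longrightarrow> len (z \<otimes> k) \<le> len k + 2 * \<delta>"
      "\<And>z. z \<in> V \<Longrightarrow> len (inv z \<otimes> k) \<le> len k + 2 * \<delta>"
  shows "card V \<le> ball_card (6 * \<delta>)"
proof (cases "V = {}")
  case False
  then obtain z0 where "z0 \<in> V" by auto
  then have "L \<le> len k" using L(2)[of z0] gp_le_len(1)[of k "z0 \<otimes> k"] V k by auto
  then obtain p where p: "p \<in> carrier G" "len p = L" "len (inv p \<otimes> k) = len k - L"
    using len_split k by blast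
  have dpk: "dst p k = real (len k) - L" using p \<open>L \<le> len k\<close> by (simp add: dst_def)
  have "len (inv p \<otimes> (z \<otimes> p)) \<le> 6 * \<delta>" if z: "z \<in> V" for z
  proof -
    have zc: "z \<in> carrier G" using V z by auto
    have a: "dst p (inv z) = len (z \<otimes> p)"
      using dst_inv_left[of z p \<one>] zc p by simp
    have b: "dst (inv z) k = len (z \<otimes> k)"
      using dst_inv_left[of z k \<one>] zc k dst_commute[of "inv z" k] by simp
    have c: "dst (inv z \<otimes> k) k = real (len k) + len (z \<otimes> k) - 2 * gp k (z \<otimes> k)"
      using dst_inv_left[of z k k] zc k dst_commute[of k "inv z \<otimes> k"] dst_commute[of k "z \<otimes> k"]
      by (simp add: gp_def field_simps)
    have d: "dst p (inv z \<otimes> k) = dst (z \<otimes> p) k" using dst_inv_left zc p k by simp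
    have lp: "real (len (z \<otimes> p)) \<le> L + 4 * \<delta>"
      using dst_four[of p "inv z" \<one> k] a b dpk zc p k L(1)[OF z] shift[OF z] delta_nonneg by auto
    have lk: "dst (z \<otimes> p) k \<le> real (len k) - L + 4 * \<delta>"
      using dst_four[of p "inv z \<otimes> k" \<one> k] c d dpk zc p k L[OF z] shift[OF z] delta_nonneg by auto
    have "dst p (z \<otimes> p) \<le> 6 * \<delta>"
      using dst_four[of p "z \<otimes> p" \<one> k] lp lk dpk zc p k by auto
    then show ?thesis by (simp add: dst_def)
  qed
  then have sub: "(\<lambda>z. inv p \<otimes> (z \<otimes> p)) ` V \<subseteq> {x \<in> carrier G. real (len x) \<le> 6 * \<delta>}"
    using V p by auto
  have inj: "inj_on (\<lambda>z. inv p \<otimes> (z \<otimes> p)) V"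
    using V p by (auto simp: inj_on_def subset_iff)
  have "{x \<in> carrier G. real (len x) \<le> 6 * \<delta>} \<subseteq> {x \<in> carrier G. len x \<le> nat \<lfloor>6 * \<delta>\<rfloor>}"
    by (auto simp: le_nat_floor)
  then have "finite {x \<in> carrier G. real (len x) \<le> 6 * \<delta>}"
    using finite_ball finite_subset by blast
  then show ?thesis
    unfolding ball_card_def using card_inj_on_le[OF inj sub] by simp
qed simp

text \<open>Another factor \<open>c\<close> costs \<open>len c\<close> for translating the pair
  \<open>k\<close>, \<open>c [^] m \<otimes> k\<close> by \<open>c\<close>, and \<delta> for
  comparing through \<open>c \<otimes> k\<close>.\<close>

lemma gp_pow_ge:
  assumes "c \<in> carrier G" "k \<in> carrier G"
  shows "gp k (c \<otimes> k) - real m * (len c + \<delta>) \<le> gp k (c [^] m \<otimes> k)"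
proof (induction m)
  case 0
  then show ?case using gp_le_len[of k "c \<otimes> k"] assms by (simp add: gp_def dst_def)
next
  case (Suc m)
  have eq: "c \<otimes> (c [^] m \<otimes> k) = c [^] Suc m \<otimes> k"
    using assms by (metis m_assoc nat_pow_Suc2 nat_pow_closed)
  have "gp k (c [^] m \<otimes> k) - len c \<le> gp (c \<otimes> k) (c [^] Suc m \<otimes> k)"
    using gp_mult_left[of k "c [^] m \<otimes> k" c] assms eq by simp
  moreover have "gp k (c \<otimes> k) - \<delta> \<le> gp k (c [^] Suc m \<otimes> k) \<or>
      gp (c \<otimes> k) (c [^] Suc m \<otimes> k) - \<delta> \<le> gp k (c [^] Suc m \<otimes> k)"
    using gp_ultra[of k "c \<otimes> k" "c [^] Suc m \<otimes> k"] assms by simp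
  moreover have "0 \<le> real m * (len c + \<delta>)" using delta_nonneg by simp
  moreover have "real (Suc m) * (len c + \<delta>) = real m * (len c + \<delta>) + (len c + \<delta>)"
    by (simp add: algebra_simps)
  ultimately show ?case using Suc delta_nonneg by linarith
qed

text \<open>Were the product too large, \<open>M + 1\<close> distinct powers of \<open>c\<close>
  would nearly fix \<open>k\<close>; as \<open>k\<close> is shortest under these powers,
  \<open>shift_bound\<close> makes their shifts small, and there would be more of them than
  \<open>card_nearly_fixing\<close> permits. The bound leaves \<open>2 * L\<close> after the loss
  over \<open>M\<close> steps.\<close>

lemma gp_shortest_bounded:
  assumes c: "c \<in> carrier G" and inf: "\<And>n::nat. n > 0 \<Longrightarrow> c [^] n \<noteq> \<one>"
  shows "\<exists>B. \<forall>k\<in>carrier G. (\<forall>m::nat. len k \<le> len (c [^] m \<otimes> k) \<and> len k \<le> len (inv (c [^] m) \<otimes> k))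
    \<longrightarrow> gp k (c \<otimes> k) \<le> B"
proof -
  define M where "M = ball_card (6 * \<delta>)"
  define L where "L = Max ((\<lambda>m. len (c [^] (m::nat))) ` {..M})"
  have L: "len (c [^] m) \<le> L" if "m \<le> M" for m
    unfolding L_def using that by (intro Max_ge) auto
  have inj: "inj_on (\<lambda>m::nat. c [^] m) {..M}"
  proof -
    have *: "c [^] i \<noteq> c [^] j" if "i < j" for i j :: nat
    proof
      assume "c [^] i = c [^] j"
      then have "c [^] (j - i) = \<one>" using pow_eq_div2 c by (metis)
      then show False using inf that by simp
    qed
    show ?thesis
      by (intro inj_onI) (metis * linorder_neqE_nat)
  qed
  have "gp k (c \<otimes> k) \<le> 2 * real L + M * (len c + \<delta>)" if k: "k \<in> carrier G" and
    short: "\<forall>m::nat. len k \<le> len (c [^] m \<otimes> k) \<and> len k \<le> len (inv (c [^] m) \<otimes> k)" for k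
  proof (rule ccontr)
    assume "\<not> ?thesis"
    then have gt: "gp k (c \<otimes> k) > 2 * real L + M * (len c + \<delta>)" by simp
    have ge: "2 * real L \<le> gp k (c [^] m \<otimes> k)" if "m \<le> M" for m
    proof -
      have "real m * (len c + \<delta>) \<le> M * (len c + \<delta>)"
        using that delta_nonneg by (intro mult_right_mono) auto
      then show ?thesis using gp_pow_ge[OF c k, of m] gt by simp
    qed
    have "card ((\<lambda>m::nat. c [^] m) ` {..M}) \<le> ball_card (6 * \<delta>)"
    proof (rule card_nearly_fixing[OF _ k, where L = L])
      fix z assume "z \<in> (\<lambda>m::nat. c [^] m) ` {..M}"
      then obtain m where m: "m \<le> M" "z = c [^] m" by auto
      show "len z \<le> L" "2 * real L \<le> gp k (z \<otimes> k)" using m L ge by auto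
      have "real (len (z \<otimes> k)) + len (inv z \<otimes> k) \<le> 2 * real (len k) + 2 * \<delta>"
        using shift_bound[of z k] ge[OF m(1)] L[OF m(1)] m(2) c k by auto
      moreover have "len k \<le> len (z \<otimes> k)" "len k \<le> len (inv z \<otimes> k)" using short m(2) by auto
      ultimately show "len (z \<otimes> k) \<le> len k + 2 * \<delta>" "len (inv z \<otimes> k) \<le> len k + 2 * \<delta>"
        by linarith+
    qed (use c in auto)
    then show False using card_image[OF inj] by (simp add: M_def)
  qed
  then show ?thesis by blast
qed

text \<open>Sort the ball of \<open>A\<close> by \<open>len (v \<otimes> p)\<close>, which takes at
  most \<open>2 * n + 1\<close> values. Quotients of elements with equal value shift
  \<open>p\<close> hardly at all, so \<open>card_nearly_fixing\<close> bounds every fibre.\<close>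

lemma linear_growth:
  assumes A: "subgroup A G"
    and deep: "\<And>n X. \<exists>p\<in>carrier G. \<forall>v\<in>A. len v \<le> n \<longrightarrow> X \<le> gp p (v \<otimes> p)"
  shows "card {x \<in> A. len x \<le> n} \<le> (2 * n + 1) * ball_card (6 * \<delta>)"
proof -
  have Ac: "A \<subseteq> carrier G" using A subgroup.subset by blast
  define V where "V = {x \<in> A. len x \<le> n}"
  obtain p where p: "p \<in> carrier G"
    \<comment> \<open>Quotients of two elements of the ball have length up to \<open>2 * n\<close>;
      this is the \<open>L\<close> of the counting principle, which then asks for depth
      \<open>4 * n\<close>.\<close>
    and gp: "\<And>v. v \<in> A \<Longrightarrow> len v \<le> 2 * n \<Longrightarrow> 4 * real n \<le> gp p (v \<otimes> p)"
    using deep[of "2 * n" "4 * real n"] by blast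
  have finV: "finite V"
    unfolding V_def using Ac by (intro finite_subset[OF _ finite_ball[of n]]) auto
  define f where "f v = len (v \<otimes> p)" for v
  have shift: "len ((inv u \<otimes> v) \<otimes> p) \<le> len p + 2 * \<delta>" and lenz: "len (inv u \<otimes> v) \<le> 2 * n"
    if u: "u \<in> V" and v: "v \<in> V" and f: "f u = f v" for u v
  proof -
    have uc: "u \<in> carrier G" "v \<in> carrier G" and uA: "u \<in> A" "v \<in> A" and ul: "len u \<le> n" "len v \<le> n"
      using u v Ac by (auto simp: V_def)
    define z where "z = inv v \<otimes> u"
    have z: "z \<in> carrier G" "z \<in> A" using uc uA A by (auto simp: z_def subgroup.m_closed subgroup.m_inv_closed)
    have zl: "len z \<le> 2 * n" using len_mult[of "inv v" u] ul uc by (simp add: z_def)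
    have iz: "inv z = inv u \<otimes> v" using uc by (simp add: z_def inv_mult_group)
    show "len (inv u \<otimes> v) \<le> 2 * n" using zl len_inv[of z] iz z by simp
    have e1: "dst (v \<otimes> p) (u \<otimes> p) = dst p (z \<otimes> p)"
      using dst_inv_left[of v p "u \<otimes> p"] uc p by (simp add: z_def m_assoc)
    have e2: "dst u (v \<otimes> p) = len ((inv u \<otimes> v) \<otimes> p)"
      using uc p by (simp add: dst_def m_assoc)
    have e3: "dst u (u \<otimes> p) = len p" using dst_mult_left[of u \<one> p] uc p by simp
    have e4: "dst p (z \<otimes> p) = real (len p) + len (z \<otimes> p) - 2 * gp p (z \<otimes> p)"
      by (simp add: gp_def field_simps)
    have l1: "len (z \<otimes> p) \<le> len p + 2 * n" using len_mult[of z p] zl z p by simp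
    have "p = inv u \<otimes> (u \<otimes> p)" using uc p by (simp add: m_assoc[symmetric])
    then have l2: "len p \<le> n + len (u \<otimes> p)" 
      using len_mult[of "inv u" "u \<otimes> p"] uc p ul by simp
    \<comment> \<open>In the four-point inequality one alternative gives the claim because
      \<open>f u = f v\<close>; in the other the depth \<open>4 * n\<close> outweighs all lengths
      bounded by multiples of \<open>n\<close>.\<close>
    show "len ((inv u \<otimes> v) \<otimes> p) \<le> len p + 2 * \<delta>"
      using dst_four[of u "v \<otimes> p" \<one> "u \<otimes> p"] uc p e1 e2 e3 e4 l1 l2 gp[OF z(2) zl] f ul
      by (auto simp: f_def)
  qed
  have fibre: "card {v \<in> V. f v = y} \<le> ball_card (6 * \<delta>)" for y
  proof (cases "{v \<in> V. f v = y} = {}")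
    case False
    then obtain u where u: "u \<in> V" "f u = y" by auto
    then have uc: "u \<in> A" "u \<in> carrier G" using Ac by (auto simp: V_def)
    have "card ((\<lambda>v. inv u \<otimes> v) ` {v \<in> V. f v = y}) \<le> ball_card (6 * \<delta>)"
    proof (rule card_nearly_fixing[OF _ p, where L = "2 * n"])
      fix z assume "z \<in> (\<lambda>v. inv u \<otimes> v) ` {v \<in> V. f v = y}"
      then obtain v where v: "v \<in> V" "f v = y" "z = inv u \<otimes> v" by auto
      have vc: "v \<in> A" "v \<in> carrier G" using v Ac by (auto simp: V_def)
      have zA: "z \<in> A" using v(3) vc uc A by (auto simp: subgroup.m_closed subgroup.m_inv_closed)
      show l: "len z \<le> 2 * n" using lenz[OF u(1) v(1)] u v by simp
      show "2 * real (2 * n) \<le> gp p (z \<otimes> p)" using gp[OF zA l] by simp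
      show "len (z \<otimes> p) \<le> len p + 2 * \<delta>" using shift[OF u(1) v(1)] u v by simp
      have "inv z = inv v \<otimes> u" using vc uc v(3) by (simp add: inv_mult_group)
      then show "len (inv z \<otimes> p) \<le> len p + 2 * \<delta>" using shift[OF v(1) u(1)] u v by simp
    qed (use uc Ac in \<open>auto simp: V_def\<close>)
    moreover have "inj_on (\<lambda>v. inv u \<otimes> v) {v \<in> V. f v = y}"
      using uc Ac by (auto simp: inj_on_def V_def subset_iff)
    ultimately show ?thesis by (simp add: card_image)
  next
    case True
    then show ?thesis by (simp only: card.empty)
  qed
  have "f ` V \<subseteq> {len p - n .. len p + n}"
  proof (intro image_subsetI)
    fix v assume "v \<in> V"
    then have v: "v \<in> carrier G" "len v \<le> n" using Ac by (auto simp: V_def)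
    have "p = inv v \<otimes> (v \<otimes> p)" using v p by (simp add: m_assoc[symmetric])
    then have "len p \<le> n + len (v \<otimes> p)" 
      using len_mult[of "inv v" "v \<otimes> p"] v p by simp
    moreover have "len (v \<otimes> p) \<le> n + len p" using len_mult[of v p] v p by simp
    ultimately show "f v \<in> {len p - n .. len p + n}" by (auto simp: f_def)
  qed
  then have "card (f ` V) \<le> card {len p - n .. len p + n}" by (intro card_mono) auto
  then have cf: "card (f ` V) \<le> 2 * n + 1" by simp
  have "card V = (\<Sum>y\<in>f ` V. card {v \<in> V. f v = y})"
    using finV sum.group[OF finV finite_imageI[OF finV], of f f "\<lambda>_. 1::nat"] by simp
  also have "\<dots> \<le> card (f ` V) * ball_card (6 * \<delta>)"
    using sum_bounded_above[of "f ` V" "\<lambda>y. card {v \<in> V. f v = y}"] fibre by simp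
  also have "\<dots> \<le> (2 * n + 1) * ball_card (6 * \<delta>)"
    using cf by (rule mult_right_mono) simp
  finally show ?thesis by (simp add: V_def)
qed

section \<open>Amenability of groups of linear growth\<close>

lemma almost_invariant_ball:
  fixes \<epsilon> :: real
  assumes growth: "\<And>n. card {x \<in> carrier G. len x \<le> n} \<le> a * n + b" and "\<epsilon> > 0"
  shows "\<exists>n. card {x \<in> carrier G. len x \<le> Suc n} \<le> (1 + \<epsilon>) * card {x \<in> carrier G. len x \<le> n}"
proof (rule ccontr)
  define \<beta> where "\<beta> n = card {x \<in> carrier G. len x \<le> n}" for n
  assume "\<not> ?thesis"
  then have step: "(1 + \<epsilon>) * \<beta> n \<le> \<beta> (Suc n)" for n by (auto simp: \<beta>_def not_le intro: less_imp_le)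
  have "\<beta> 0 > 0" unfolding \<beta>_def using finite_ball[of 0] by (auto simp: card_gt_0_iff intro!: exI[of _ \<one>])
  then have ge: "(1 + \<epsilon>) ^ n \<le> \<beta> n" for n
  proof (induction n)
    case (Suc n)
    have "(1 + \<epsilon>) * (1 + \<epsilon>) ^ n \<le> (1 + \<epsilon>) * \<beta> n"
      using Suc \<open>\<epsilon> > 0\<close> by (intro mult_left_mono) auto
    then show ?case using step[of n] by simp
  qed simp
  have "(\<lambda>n. real n / (1 + \<epsilon>) ^ n) \<longlonglongrightarrow> 0" "(\<lambda>n. inverse ((1 + \<epsilon>) ^ n)) \<longlonglongrightarrow> 0"
    using lim_n_over_pown[of "1 + \<epsilon>"] LIMSEQ_inverse_realpow_zero[of "1 + \<epsilon>"] \<open>\<epsilon> > 0\<close> by auto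
  then have "(\<lambda>n. a * (real n / (1 + \<epsilon>) ^ n) + b * inverse ((1 + \<epsilon>) ^ n)) \<longlonglongrightarrow> real a * 0 + real b * 0"
    by (intro tendsto_intros)
  then have "\<forall>\<^sub>F n in sequentially. a * (real n / (1 + \<epsilon>) ^ n) + b * inverse ((1 + \<epsilon>) ^ n) < 1"
    by (rule order_tendstoD) simp
  then obtain n where "a * (real n / (1 + \<epsilon>) ^ n) + b * inverse ((1 + \<epsilon>) ^ n) < 1"
    by (auto simp: eventually_sequentially)
  then have "a * real n + b < (1 + \<epsilon>) ^ n"
    using \<open>\<epsilon> > 0\<close> by (simp add: field_simps)
  moreover have "real (\<beta> n) \<le> a * real n + b"
    using growth[of n] unfolding \<beta>_def[symmetric] by (metis of_nat_add of_nat_le_iff of_nat_mult)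
  ultimately show False using ge[of n] by simp
qed

text \<open>The ball and its translate both lie in the next ball, so each exceeds the other by at
  most an \<epsilon> fraction of its elements; the factor 2 counts the two differences.\<close>

lemma sum_translate_bound:
  fixes f :: "'a \<Rightarrow> real" and \<epsilon> :: real
  assumes s: "s \<in> carrier G" "len s \<le> 1" and f: "\<And>x. x \<in> carrier G \<Longrightarrow> \<bar>f x\<bar> \<le> C"
    and n: "card {x \<in> carrier G. len x \<le> Suc n} \<le> (1 + \<epsilon>) * card {x \<in> carrier G. len x \<le> n}"
  shows "\<bar>(\<Sum>x | x \<in> carrier G \<and> len x \<le> n. f (s \<otimes> x)) - (\<Sum>x | x \<in> carrier G \<and> len x \<le> n. f x)\<bar>
    \<le> 2 * C * (\<epsilon> * card {x \<in> carrier G. len x \<le> n})"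
proof -
  define B where "B = {x \<in> carrier G. len x \<le> n}"
  define B' where "B' = (\<lambda>x. s \<otimes> x) ` B"
  have fin: "finite B" "finite B'" using finite_ball by (auto simp: B_def B'_def)
  have inj: "inj_on (\<lambda>x. s \<otimes> x) B" using s by (auto simp: inj_on_def B_def)
  then have cardB: "card B' = card B" by (simp add: B'_def card_image)
  have sub: "B \<union> B' \<subseteq> {x \<in> carrier G. len x \<le> Suc n}"
    using s len_mult[OF s(1)] by (force simp: B_def B'_def)
  have "card (B \<union> B') \<le> card {x \<in> carrier G. len x \<le> Suc n}"
    using sub finite_ball by (intro card_mono) auto
  then have un: "real (card (B \<union> B')) \<le> (1 + \<epsilon>) * card B" using n by (simp add: B_def)
  have "card (B \<union> B') = card B + card (B' - B)" "card (B \<union> B') = card B' + card (B - B')"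
    using fin by (metis card_Un_disjoint Diff_disjoint Un_Diff_cancel finite_Diff)
      (use fin in \<open>metis card_Un_disjoint Diff_disjoint Un_Diff_cancel finite_Diff sup_commute\<close>)
  then have diff: "real (card (B' - B)) \<le> \<epsilon> * card B" "real (card (B - B')) \<le> \<epsilon> * card B"
    using un cardB by (auto simp: algebra_simps)
  have C: "0 \<le> C" using f[of \<one>] by auto
  have small: "\<bar>sum f D\<bar> \<le> C * (\<epsilon> * card B)" if "D \<subseteq> carrier G" "real (card D) \<le> \<epsilon> * card B" for D
  proof -
    have "\<bar>sum f D\<bar> \<le> (\<Sum>x\<in>D. \<bar>f x\<bar>)" by (rule sum_abs)
    also have "\<dots> \<le> card D * C" using sum_bounded_above[of D "\<lambda>x. \<bar>f x\<bar>" C] f that by auto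
    also have "\<dots> \<le> C * (\<epsilon> * card B)" using that C by (simp add: mult.commute mult_left_mono)
    finally show ?thesis .
  qed
  have "(\<Sum>x\<in>B. f (s \<otimes> x)) = sum f B'" unfolding B'_def using inj by (simp add: sum.reindex)
  also have "sum f B' - sum f B = sum f (B' - B) - sum f (B - B')"
  proof -
    have "sum f B' = sum f (B' - B) + sum f (B' \<inter> B)" "sum f B = sum f (B - B') + sum f (B' \<inter> B)"
      using fin by (metis Diff_Diff_Int add.commute sum.Int_Diff) 
        (use fin in \<open>metis inf_commute add.commute sum.Int_Diff\<close>)
    then show ?thesis by simp
  qed
  finally have eq: "(\<Sum>x\<in>B. f (s \<otimes> x)) - sum f B = sum f (B' - B) - sum f (B - B')" .
  have "B' - B \<subseteq> carrier G" "B - B' \<subseteq> carrier G" using sub by auto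
  then have "\<bar>sum f (B' - B)\<bar> \<le> C * (\<epsilon> * card B)" "\<bar>sum f (B - B')\<bar> \<le> C * (\<epsilon> * card B)"
    using small diff by blast+
  then show ?thesis using eq unfolding B_def[symmetric] by linarith
qed

text \<open>Averages over almost invariant balls lie in a product of compact intervals, one for each
  function, and a cluster point of them is an invariant mean.\<close>

lemma amenable_if_linear_growth:
  assumes growth: "\<And>n. card {x \<in> carrier G. len x \<le> n} \<le> a * n + b"
  shows "amenable G"
proof -
  define B where "B n = {x \<in> carrier G. len x \<le> n}" for n
  have "\<exists>n. card (B (Suc n)) \<le> (1 + 1 / real (Suc j)) * card (B n)" for j
    unfolding B_def by (rule almost_invariant_ball[OF growth]) simp
  then obtain \<nu> where \<nu>: "\<And>j. card (B (Suc (\<nu> j))) \<le> (1 + 1 / real (Suc j)) * card (B (\<nu> j))"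
    by metis
  have finB: "finite (B n)" for n using finite_ball by (simp add: B_def)
  have Bpos: "card (B n) > 0" for n
    using finB[of n] by (auto simp: card_gt_0_iff B_def intro!: exI[of _ \<one>])
  \<comment> \<open>The value 0 on unbounded functions keeps every coordinate inside a compact
    interval.\<close>
  define avg where "avg j f = (if bounded (f ` carrier G) then (\<Sum>x\<in>B (\<nu> j). f x) / card (B (\<nu> j)) else 0)"
    for j and f :: "'a \<Rightarrow> real"
  define nrm where "nrm f = (SOME C. \<forall>x\<in>carrier G. \<bar>f x\<bar> \<le> C)" for f :: "'a \<Rightarrow> real"
  have nrm: "\<bar>f x\<bar> \<le> nrm f" if "bounded (f ` carrier G)" "x \<in> carrier G" for f x
  proof -
    have "\<exists>C. \<forall>x\<in>carrier G. \<bar>f x\<bar> \<le> C" using that(1) by (auto simp: bounded_iff)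
    then show ?thesis unfolding nrm_def using someI_ex[of "\<lambda>C. \<forall>x\<in>carrier G. \<bar>f x\<bar> \<le> C"] that(2) by blast
  qed
  have avg_le: "\<bar>avg j f\<bar> \<le> \<bar>nrm f\<bar>" for j f
  proof (cases "bounded (f ` carrier G)")
    case True
    have "\<bar>\<Sum>x\<in>B (\<nu> j). f x\<bar> \<le> (\<Sum>x\<in>B (\<nu> j). \<bar>f x\<bar>)" by (rule sum_abs)
    also have "\<dots> \<le> card (B (\<nu> j)) * nrm f"
      using sum_bounded_above[of "B (\<nu> j)" "\<lambda>x. \<bar>f x\<bar>" "nrm f"] nrm[OF True] by (auto simp: B_def)
    also have "\<dots> \<le> card (B (\<nu> j)) * \<bar>nrm f\<bar>" by (intro mult_left_mono) auto
    finally show ?thesis using True Bpos[of "\<nu> j"] by (simp add: avg_def field_simps)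
  qed (simp add: avg_def)
  define K where "K = (\<Pi>\<^sub>E f\<in>(UNIV :: ('a \<Rightarrow> real) set). {- \<bar>nrm f\<bar> .. \<bar>nrm f\<bar>})"
  have "compactin (product_topology (\<lambda>i. euclidean) UNIV) K"
    unfolding K_def compactin_PiE by auto
  then have "compact K" by (simp add: euclidean_product_topology)
  moreover have "filtermap avg sequentially \<noteq> bot" by (simp add: filtermap_bot_iff)
  moreover have "avg j \<in> K" for j
    using avg_le[of j] unfolding K_def by (intro PiE_I) (auto simp: abs_le_iff minus_le_iff)
  then have "\<forall>\<^sub>F \<phi> in filtermap avg sequentially. \<phi> \<in> K" by (simp add: eventually_filtermap)
  ultimately obtain m where m: "inf (nhds m) (filtermap avg sequentially) \<noteq> bot"
    unfolding compact_filter by blast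
  \<comment> \<open>A proper filter finer than both: along it every evaluation converges to that of
    \<open>m\<close>, and whatever holds for almost all \<open>avg j\<close> holds
    eventually.\<close>
  define F where "F = inf (nhds m) (filtermap avg sequentially)"
  have F: "F \<noteq> bot" using m by (simp add: F_def)
  have lim: "((\<lambda>\<phi>. \<phi> f) \<longlongrightarrow> m f) F" for f
  proof -
    have "continuous_on UNIV (\<lambda>\<phi> :: ('a \<Rightarrow> real) \<Rightarrow> real. \<phi> f)" by simp
    then have "((\<lambda>\<phi>. \<phi> f) \<longlongrightarrow> m f) (at m)" unfolding continuous_on_def by blast
    then have "((\<lambda>\<phi>. \<phi> f) \<longlongrightarrow> m f) (nhds m)"
      by (simp add: tendsto_at_iff_tendsto_nhds[of "\<lambda>\<phi>. \<phi> f"])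
    then show ?thesis by (rule tendsto_mono[rotated]) (simp add: F_def)
  qed
  have ev: "eventually P F" if "\<forall>\<^sub>F j in sequentially. P (avg j)" for P
    using that filter_leD[of F "filtermap avg sequentially"] by (auto simp: F_def eventually_filtermap)
  have ev': "eventually P F" if "\<And>j. P (avg j)" for P using that by (intro ev) simp
  have limI: "m f = L" if "((\<lambda>\<phi>. \<phi> f) \<longlongrightarrow> L) F" for f L
    using tendsto_unique[OF F lim that] .
  have cong: "m f = m g" if "\<And>x. x \<in> carrier G \<Longrightarrow> f x = g x" for f g
  proof (rule limI)
    have "avg j f = avg j g" for j
    proof -
      have "f ` carrier G = g ` carrier G" using that by auto
      then show ?thesis using that by (auto simp: avg_def B_def intro!: sum.cong)
    qed
    then show "((\<lambda>\<phi>. \<phi> f) \<longlongrightarrow> m g) F"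
      by (intro Lim_transform_eventually[OF lim[of g]] ev') simp
  qed
  have bdd_translate: "bounded ((\<lambda>t. f (s \<otimes> t)) ` carrier G)"
    if "s \<in> carrier G" "bounded (f ` carrier G)" for f :: "'a \<Rightarrow> real" and s
    by (rule bounded_subset[OF that(2)]) (use that in auto)
  have inv1: "m (\<lambda>t. f (s \<otimes> t)) = m f"
    if s: "s \<in> carrier G" "len s \<le> 1" and f: "bounded (f ` carrier G)" for s f
  proof -
    have est: "\<bar>avg j (\<lambda>t. f (s \<otimes> t)) - avg j f\<bar> \<le> 2 * nrm f * (1 / real (Suc j))" for j
    proof -
      have "\<bar>(\<Sum>x\<in>B (\<nu> j). f (s \<otimes> x)) - (\<Sum>x\<in>B (\<nu> j). f x)\<bar>
          \<le> 2 * nrm f * (1 / real (Suc j) * card (B (\<nu> j)))"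
        unfolding B_def by (rule sum_translate_bound[OF s nrm[OF f] \<nu>[unfolded B_def]])
      then show ?thesis
        using Bpos[of "\<nu> j"] f bdd_translate[OF s(1) f]
        by (simp add: avg_def diff_divide_distrib[symmetric] divide_le_eq)
    qed
    have "(\<lambda>j. 2 * nrm f * (1 / real (Suc j))) \<longlonglongrightarrow> 2 * nrm f * 0"
      by (intro tendsto_intros LIMSEQ_Suc[OF lim_1_over_n])
    then have z: "(\<lambda>j. 2 * nrm f * (1 / real (Suc j))) \<longlonglongrightarrow> 0" by simp
    have "((\<lambda>\<phi>. \<phi> (\<lambda>t. f (s \<otimes> t)) - \<phi> f) \<longlongrightarrow> 0) F"
    proof (rule tendstoI)
      fix e :: real assume "e > 0"
      then have "\<forall>\<^sub>F j in sequentially. 2 * nrm f * (1 / real (Suc j)) < e"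
        using order_tendstoD(2)[OF z] by blast
      then have "\<forall>\<^sub>F j in sequentially. dist (avg j (\<lambda>t. f (s \<otimes> t)) - avg j f) 0 < e"
        by (rule eventually_mono) (use est in \<open>auto simp: dist_real_def intro: le_less_trans\<close>)
      then show "\<forall>\<^sub>F \<phi> in F. dist (\<phi> (\<lambda>t. f (s \<otimes> t)) - \<phi> f) 0 < e" by (rule ev)
    qed
    moreover have "((\<lambda>\<phi>. \<phi> (\<lambda>t. f (s \<otimes> t)) - \<phi> f) \<longlongrightarrow> m (\<lambda>t. f (s \<otimes> t)) - m f) F"
      by (intro tendsto_intros lim)
    ultimately show ?thesis using tendsto_unique[OF F] by fastforce
  qed
  \<comment> \<open>Almost invariance of balls only controls elements of length at most 1; longer
    ones are split into a first letter and a shorter rest.\<close>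
  have inv: "m (\<lambda>t. f (s \<otimes> t)) = m f" if "s \<in> carrier G" "bounded (f ` carrier G)" for s f
    using that
  proof (induction "len s" arbitrary: s f rule: less_induct)
    case less
    show ?case
    proof (cases "len s \<le> 1")
      case False
      then obtain p where p: "p \<in> carrier G" "len p = 1" "len (inv p \<otimes> s) = len s - 1"
        using len_split[of s 1] less by auto
      define q where "q = inv p \<otimes> s"
      have q: "q \<in> carrier G" "len q < len s" "s = p \<otimes> q"
        using p less False by (auto simp: q_def m_assoc[symmetric])
      have "m (\<lambda>t. f (s \<otimes> t)) = m (\<lambda>t. f (p \<otimes> (q \<otimes> t)))"
        by (rule cong) (use p q in \<open>auto simp: m_assoc\<close>)
      also have "\<dots> = m (\<lambda>t. f (p \<otimes> t))"
        using less(1)[OF q(2,1), of "\<lambda>t. f (p \<otimes> t)"] bdd_translate p less by simp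
      also have "\<dots> = m f" using inv1 p less by simp
      finally show ?thesis .
    qed (use inv1 less in auto)
  qed
  have "invariant_mean G m"
    unfolding invariant_mean_def
  proof (intro conjI allI ballI impI)
    fix f g :: "'a \<Rightarrow> real" assume fg: "bounded (f ` carrier G)" "bounded (g ` carrier G)"
    have "bounded ((\<lambda>t. f t + g t) ` carrier G)"
      using bounded_plus_comp[OF fg] .
    then have "avg j (\<lambda>t. f t + g t) = avg j f + avg j g" for j
      using fg by (simp add: avg_def sum.distrib add_divide_distrib)
    then show "m (\<lambda>t. f t + g t) = m f + m g"
      by (intro limI Lim_transform_eventually[OF tendsto_add[OF lim lim]] ev') simp
  next
    fix c and f :: "'a \<Rightarrow> real" assume f: "bounded (f ` carrier G)"
    have "bounded ((\<lambda>t. c * f t) ` carrier G)"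
      using bounded_scaleR_comp[OF f, of c] by simp
    then have "avg j (\<lambda>t. c * f t) = c * avg j f" for j
      using f by (simp add: avg_def sum_distrib_left)
    then show "m (\<lambda>t. c * f t) = c * m f"
      by (intro limI Lim_transform_eventually[OF tendsto_mult[OF tendsto_const lim]] ev') simp
  next
    fix f :: "'a \<Rightarrow> real" assume "bounded (f ` carrier G)" and pos: "\<forall>t\<in>carrier G. 0 \<le> f t"
    have "0 \<le> avg j f" for j
      using pos by (auto simp: avg_def B_def intro!: divide_nonneg_nonneg sum_nonneg)
    then show "0 \<le> m f" by (intro tendsto_lowerbound[OF lim _ F] ev')
  next
    have "bounded ((\<lambda>t. 1 :: real) ` carrier G)" by (auto simp: bounded_iff)
    then have "avg j (\<lambda>t. 1) = 1" for j using Bpos[of "\<nu> j"] by (simp add: avg_def)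
    then show "m (\<lambda>t. 1) = 1"
      by (intro limI Lim_transform_eventually[OF tendsto_const] ev') simp
  qed (use inv in auto)
  then show ?thesis by (auto simp: amenable_def)
qed

section \<open>Choosing the separating conjugator\<close>

lemma unbounded_powers:
  assumes g: "g \<in> carrier G" and inf: "\<And>n::nat. n > 0 \<Longrightarrow> g [^] n \<noteq> \<one>" and "m > 0"
  shows "\<exists>N::nat. r < len (g [^] (m * N))"
proof (rule ccontr)
  assume "\<not> ?thesis"
  then have "range (\<lambda>N::nat. g [^] (m * N)) \<subseteq> {x \<in> carrier G. len x \<le> r}"
    using g by (auto simp: not_less)
  then have "finite (range (\<lambda>N::nat. g [^] (m * N)))" using finite_ball finite_subset by blast
  moreover have "inj (\<lambda>N::nat. g [^] (m * N))"
  proof -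
    have *: "g [^] (m * i) \<noteq> g [^] (m * j)" if "i < j" for i j :: nat
    proof
      assume "g [^] (m * i) = g [^] (m * j)"
      then have "g [^] (m * j - m * i) = \<one>" using pow_eq_div2 g by metis
      then show False using inf[of "m * j - m * i"] that \<open>m > 0\<close> by simp
    qed
    show ?thesis by (intro injI) (metis * linorder_neqE_nat)
  qed
  ultimately show False using finite_imageD by blast
qed

text \<open>A long power \<open>p\<close> of \<open>g\<close> commuting with \<open>v\<close>
  satisfies \<open>v \<otimes> p = p \<otimes> v\<close>, so \<open>v\<close> moves \<open>p\<close>
  by only \<open>len v\<close>, while \<open>p\<close> is as long as desired.\<close>

lemma commensurator_fixes_far_point:
  assumes g: "g \<in> carrier G" and inf: "\<And>n::nat. n > 0 \<Longrightarrow> g [^] n \<noteq> \<one>"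
  shows "\<exists>p\<in>carrier G. \<forall>v\<in>commensurator g. len v \<le> n \<longrightarrow> X \<le> gp p (v \<otimes> p)"
proof -
  define V where "V = {v \<in> commensurator g. len v \<le> n}"
  have finV: "finite V"
    by (rule finite_subset[OF _ finite_ball[of n]]) (auto simp: V_def commensurator_def)
  have "\<forall>v\<in>V. \<exists>k::nat. k > 0 \<and> v \<otimes> g [^] k = g [^] k \<otimes> v" by (auto simp: V_def commensurator_def)
  then obtain k where k: "\<And>v. v \<in> V \<Longrightarrow> 0 < k v \<and> v \<otimes> g [^] (k v :: nat) = g [^] (k v) \<otimes> v" by metis
  \<comment> \<open>Only finitely many \<open>v\<close> have length at most \<open>n\<close>, so one
    exponent serves all of them.\<close>
  define m where "m = (\<Prod>v\<in>V. k v)"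
  have "m > 0" using k by (auto simp: m_def intro!: prod_pos)
  then obtain N :: nat where N: "nat \<lceil>X\<rceil> + n < len (g [^] (m * N))"
    using unbounded_powers[OF g inf] by blast
  define p where "p = g [^] (m * N)"
  have p: "p \<in> carrier G" using g by (simp add: p_def)
  have "X \<le> gp p (v \<otimes> p)" if "v \<in> commensurator g" "len v \<le> n" for v
  proof -
    have v: "v \<in> V" "v \<in> carrier G" using that by (auto simp: V_def commensurator_def)
    have "k v dvd m * N" using finV v by (simp add: m_def dvd_prodI dvd_mult2)
    then obtain j where "m * N = k v * j" by auto
    then have comm: "v \<otimes> p = p \<otimes> v" using commute_pow_mult[OF v(2) g] k[OF v(1)] by (simp add: p_def)
    have "dst p (v \<otimes> p) = len v" using dst_mult_left[of p \<one> v] p v comm by simp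
    moreover have "len p \<le> len v + len (v \<otimes> p)"
      using len_mult[of "inv v" "v \<otimes> p"] v p by (simp add: m_assoc[symmetric])
    moreover have "X + n < len p" using N by (simp add: p_def[symmetric]) linarith
    ultimately show ?thesis using that by (simp add: gp_def field_simps)
  qed
  then show ?thesis using p by blast
qed

text \<open>Otherwise every element is \<open>c \<otimes> y\<close> with \<open>c\<close> in the
  commensurator and \<open>len y < r\<close>; the group would then inherit the linear growth of the
  commensurator and be amenable.\<close>

lemma long_shortest_representative:
  assumes "\<not> amenable G" and g: "g \<in> carrier G" and inf: "\<And>n::nat. n > 0 \<Longrightarrow> g [^] n \<noteq> \<one>"
  shows "\<exists>y\<in>carrier G. (\<forall>c\<in>commensurator g. len y \<le> len (c \<otimes> y)) \<and> r \<le> len y"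
proof (rule ccontr)
  assume "\<not> ?thesis"
  then have short: "len y < r" if "y \<in> carrier G" "\<forall>c\<in>commensurator g. len y \<le> len (c \<otimes> y)" for y
    using that by (meson not_le)
  interpret C: subgroup "commensurator g" G using subgroup_commensurator[OF g] .
  define D where "D = card {x \<in> carrier G. len x \<le> r}"
  define N where "N = ball_card (6 * \<delta>)"
  have "card {x \<in> carrier G. len x \<le> n} \<le> (2 * N * D) * n + (2 * r + 1) * N * D" for n
  proof -
    have sub: "{x \<in> carrier G. len x \<le> n} \<subseteq>
      (\<lambda>(c, y). c \<otimes> y) ` ({c \<in> commensurator g. len c \<le> n + r} \<times> {x \<in> carrier G. len x \<le> r})"
    proof
      fix x assume "x \<in> {x \<in> carrier G. len x \<le> n}"
      then have x: "x \<in> carrier G" "len x \<le> n" by auto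
      obtain c where c: "c \<in> commensurator g"
        and min: "\<And>c'. c' \<in> commensurator g \<Longrightarrow> len (c \<otimes> x) \<le> len (c' \<otimes> x)"
        using ex_has_least_nat[of "\<lambda>c. c \<in> commensurator g" \<one> "\<lambda>c. len (c \<otimes> x)"] C.one_closed by blast
      have cc: "c \<in> carrier G" using c C.subset by auto
      have "\<forall>d\<in>commensurator g. len (c \<otimes> x) \<le> len (d \<otimes> (c \<otimes> x))"
      proof
        fix d assume d: "d \<in> commensurator g"
        then have "d \<otimes> (c \<otimes> x) = (d \<otimes> c) \<otimes> x" using x cc C.subset by (simp add: m_assoc subset_iff)
        then show "len (c \<otimes> x) \<le> len (d \<otimes> (c \<otimes> x))" using min[of "d \<otimes> c"] c d by simp
      qed
      then have y: "len (c \<otimes> x) < r" using short x cc by simp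
      have eq: "x = inv c \<otimes> (c \<otimes> x)" using x cc by (simp add: m_assoc[symmetric])
      have "inv c = x \<otimes> inv (c \<otimes> x)" using x cc by (simp add: inv_mult_group m_assoc[symmetric])
      then have "len (inv c) \<le> n + r"
        using len_mult[of x "inv (c \<otimes> x)"] x cc y by simp
      then have "inv c \<in> {c \<in> commensurator g. len c \<le> n + r}" using c by auto
      moreover have "c \<otimes> x \<in> {x \<in> carrier G. len x \<le> r}" using x cc y by auto
      ultimately show "x \<in> (\<lambda>(c, y). c \<otimes> y) ` ({c \<in> commensurator g. len c \<le> n + r} \<times> {x \<in> carrier G. len x \<le> r})"
        using eq by force
    qed
    have fin: "finite {c \<in> commensurator g. len c \<le> n + r}"
      by (rule finite_subset[OF _ finite_ball[of "n + r"]]) (use C.subset in auto)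
    have "card {x \<in> carrier G. len x \<le> n} \<le> card {c \<in> commensurator g. len c \<le> n + r} * D"
      using surj_card_le[OF _ sub] fin finite_ball by (simp add: card_cartesian_product D_def)
    also have "\<dots> \<le> ((2 * (n + r) + 1) * N) * D"
      using linear_growth[OF C.subgroup_axioms commensurator_fixes_far_point[OF g inf], of "n + r"]
      by (intro mult_right_mono) (simp_all add: N_def)
    also have "\<dots> = (2 * N * D) * n + (2 * r + 1) * N * D" by (simp add: algebra_simps)
    finally show ?thesis .
  qed
  then show False using amenable_if_linear_growth assms(1) by blast
qed

text \<open>Apply \<open>linear_growth\<close> to the whole group. The resulting \<open>n\<close>
  and \<open>X\<close> are independent of \<open>p\<close>, while \<open>v\<close> may depend on
  it.\<close>

lemma no_fixed_far_point:
  assumes "\<not> amenable G"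
  shows "\<exists>(n::nat) X. \<forall>p\<in>carrier G. \<exists>v\<in>carrier G. len v \<le> n \<and> gp p (v \<otimes> p) < X"
proof (rule ccontr)
  assume "\<not> ?thesis"
  then have deep: "\<exists>p\<in>carrier G. \<forall>v\<in>carrier G. len v \<le> n \<longrightarrow> X \<le> gp p (v \<otimes> p)" for n X
    by (meson not_le)
  have "card {x \<in> carrier G. len x \<le> n} \<le> (2 * ball_card (6 * \<delta>)) * n + ball_card (6 * \<delta>)" for n
    using linear_growth[OF subgroup_self deep, of n] by (simp add: algebra_simps)
  then show False using amenable_if_linear_growth assms by blast
qed

text \<open>The length of \<open>w \<otimes> d \<otimes> inv w\<close> is the distance from
  \<open>inv w\<close> to \<open>d \<otimes> inv w\<close>. When these two diverge early there is
  little cancellation, and the conjugate follows \<open>w\<close> along most of its length.\<close>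

lemma len_conjugate_lower:
  assumes "w \<in> carrier G" "d \<in> carrier G"
  shows "2 * real (len w) - len d - 2 * gp (inv w) (d \<otimes> inv w) \<le> len (w \<otimes> d \<otimes> inv w)"
    and "real (len w) - len d - gp (inv w) (d \<otimes> inv w) \<le> gp (w \<otimes> d \<otimes> inv w) w"
proof -
  have a: "dst (inv w) (d \<otimes> inv w) = len (w \<otimes> d \<otimes> inv w)"
    using assms by (simp add: dst_def m_assoc)
  have "inv w = inv d \<otimes> (d \<otimes> inv w)" using assms by (simp add: m_assoc[symmetric])
  then have b: "len w \<le> len d + len (d \<otimes> inv w)"
    using len_mult[of "inv d" "d \<otimes> inv w"] assms by simp
  show c: "2 * real (len w) - len d - 2 * gp (inv w) (d \<otimes> inv w) \<le> len (w \<otimes> d \<otimes> inv w)"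
    using a b assms by (simp add: gp_def field_simps)
  have "dst (w \<otimes> d \<otimes> inv w) w = len (w \<otimes> inv d)"
    using assms by (simp add: dst_def inv_mult_group m_assoc)
  moreover have "len (w \<otimes> inv d) \<le> len w + len d" using len_mult[of w "inv d"] assms by simp
  ultimately show "real (len w) - len d - gp (inv w) (d \<otimes> inv w) \<le> gp (w \<otimes> d \<otimes> inv w) w"
    using c unfolding gp_def[of "w \<otimes> d \<otimes> inv w" w] by (simp add: field_simps)
qed

lemma gp_mult_right:
  assumes "x \<in> carrier G" "y \<in> carrier G" "c \<in> carrier G"
  shows "gp x y - len c \<le> gp (x \<otimes> c) y"
proof -
  have "dst x (x \<otimes> c) = len c" using dst_mult_left[of x \<one> c] assms by simp
  then have "dst (x \<otimes> c) y \<le> len c + dst x y"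
    using dst_triangle[of "x \<otimes> c" x y] assms dst_commute[of "x \<otimes> c" x] by simp
  moreover have "x = (x \<otimes> c) \<otimes> inv c" using assms by (simp add: m_assoc)
  then have "len x \<le> len (x \<otimes> c) + len c" using len_mult[of "x \<otimes> c" "inv c"] assms by simp
  ultimately show ?thesis by (simp add: gp_def field_simps)
qed

text \<open>Both \<open>w\<close> and \<open>inv w\<close> begin like the long shortest
  representative \<open>y\<close>, which no \<open>c \<in> F\<close> keeps close to itself. So
  conjugates by \<open>w\<close> are too long to lie in \<open>F\<close>, and the second relation
  would make \<open>w\<close> and \<open>c \<otimes> w\<close> run together too far.\<close>

lemma separating_conjugator:
  assumes tf: "torsion_free G" and na: "\<not> amenable G" and g: "g \<in> carrier G" "g \<noteq> \<one>"
    and F: "finite F" "F \<subseteq> commensurator g - {\<one>}"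
  shows "\<exists>w\<in>carrier G. (\<forall>c\<in>F. \<forall>d\<in>F. w \<otimes> d \<otimes> inv w \<noteq> c) \<and>
    (\<forall>c\<in>F. \<forall>c'\<in>F. \<forall>d\<in>F. \<forall>d'\<in>F. w \<otimes> d' \<otimes> inv w \<otimes> c' \<noteq> c \<otimes> (w \<otimes> d \<otimes> inv w))"
proof -
  interpret C: subgroup "commensurator g" G using subgroup_commensurator[OF g(1)] .
  have inf: "c [^] n \<noteq> \<one>" if "c \<in> carrier G" "c \<noteq> \<one>" "n > 0" for c and n :: nat
    using tf that by (auto simp: torsion_free_def)
  have Fc: "c \<in> carrier G" "c \<noteq> \<one>" "c \<in> commensurator g" if "c \<in> F" for c using F that C.subset by auto
  define Y where "Y = {y \<in> carrier G. \<forall>c\<in>commensurator g. len y \<le> len (c \<otimes> y)}"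
  have "\<exists>B. \<forall>y\<in>Y. gp y (c \<otimes> y) \<le> B" if c: "c \<in> F" for c
  proof -
    obtain B where B: "\<And>k. k \<in> carrier G \<Longrightarrow>
        (\<forall>m::nat. len k \<le> len (c [^] m \<otimes> k) \<and> len k \<le> len (inv (c [^] m) \<otimes> k)) \<Longrightarrow> gp k (c \<otimes> k) \<le> B"
      using gp_shortest_bounded[OF Fc(1)[OF c] inf[OF Fc(1,2)[OF c]]] by blast
    have "c [^] m \<in> commensurator g" for m :: nat
      by (induction m) (auto simp: Fc(3)[OF c])
    then have "gp y (c \<otimes> y) \<le> B" if "y \<in> Y" for y
      using that by (intro B) (auto simp: Y_def)
    then show ?thesis by blast
  qed
  then obtain \<beta> where \<beta>: "\<And>c y. c \<in> F \<Longrightarrow> y \<in> Y \<Longrightarrow> gp y (c \<otimes> y) \<le> \<beta> c" by metis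
  define B where "B = (\<Sum>c\<in>F. \<bar>\<beta> c\<bar>)"
  have B: "gp y (c \<otimes> y) \<le> B" if "c \<in> F" "y \<in> Y" for c y
    using \<beta>[OF that] member_le_sum[of c F "\<lambda>c. \<bar>\<beta> c\<bar>"] that F by (auto simp: B_def)
  have B0: "B \<ge> 0" by (auto simp: B_def intro: sum_nonneg)
  define \<Lambda> where "\<Lambda> = (\<Sum>c\<in>F. len c)"
  have \<Lambda>: "len c \<le> \<Lambda>" if "c \<in> F" for c
    using member_le_sum[of c F len] that F by (auto simp: \<Lambda>_def)
  obtain n0 :: nat and X0 where n0: "\<And>p. p \<in> carrier G \<Longrightarrow> \<exists>v\<in>carrier G. len v \<le> n0 \<and> gp p (v \<otimes> p) < X0"
    using no_fixed_far_point[OF na] by blast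
  \<comment> \<open>Makes \<open>T\<close>, a lower bound for the products of \<open>w\<close> and
    of \<open>inv w\<close> with \<open>y\<close>, exceed every error term below.\<close>
  define r where "r = nat \<lceil>n0 + \<bar>X0\<bar> + 2 * B + 4 * \<delta> + 2 * \<Lambda> + 2 * B + 4 * \<delta> + 1\<rceil>"
  obtain y where y: "y \<in> Y" "r \<le> len y"
    using long_shortest_representative[OF na g(1) inf[OF g], of r] by (auto simp: Y_def)
  have yc: "y \<in> carrier G" using y by (simp add: Y_def)
  define T where "T = real (len y) - n0 - \<bar>X0\<bar>"
  have T: "T > 4 * B + 8 * \<delta> + 2 * \<Lambda>" using y(2) by (simp add: T_def r_def) linarith
  obtain v where v: "v \<in> carrier G" "len v \<le> n0" "gp (inv y) (v \<otimes> inv y) < X0"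
    using n0[of "inv y"] yc by auto
  define w where "w = y \<otimes> v \<otimes> inv y"
  have w: "w \<in> carrier G" using yc v by (simp add: w_def)
  have iw: "inv w = y \<otimes> inv v \<otimes> inv y" using yc v by (simp add: w_def inv_mult_group m_assoc)
  have lw: "len w \<ge> 2 * real (len y) - n0 - 2 * X0"
    using len_conjugate_lower(1)[OF yc v(1)] v by (simp add: w_def)
  have gw: "gp w y \<ge> T"
    using len_conjugate_lower(2)[OF yc v(1)] v by (simp add: w_def T_def)
  have giw: "gp (inv w) y \<ge> T"
  proof -
    have "dst (inv w) y = len (y \<otimes> v)"
      using yc v w by (simp add: dst_def) (simp add: w_def m_assoc)
    moreover have "len (y \<otimes> v) \<le> len y + n0" using len_mult[of y v] yc v by simp
    ultimately show ?thesis using lw w by (simp add: gp_def T_def field_simps)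
  qed
  \<comment> \<open>A point \<open>u\<close> that begins like \<open>y\<close> inherits its bound:
    passing from \<open>y\<close> to \<open>u\<close> and from \<open>c \<otimes> y\<close> to
    \<open>c \<otimes> u\<close> costs \<delta> each, the other alternatives being excluded by
    \<open>T\<close>.\<close>
  have far: "gp u (c \<otimes> u) \<le> B + 2 * \<delta>" if u: "u \<in> carrier G" "gp u y \<ge> T" and c: "c \<in> F" for u c
  proof -
    note cc = Fc(1)[OF c]
    have "gp y u - \<delta> \<le> gp y (c \<otimes> y) \<or> gp u (c \<otimes> y) - \<delta> \<le> gp y (c \<otimes> y)"
      using gp_ultra[of y u "c \<otimes> y"] yc u cc by simp
    moreover have "gp u (c \<otimes> u) - \<delta> \<le> gp u (c \<otimes> y) \<or> gp (c \<otimes> u) (c \<otimes> y) - \<delta> \<le> gp u (c \<otimes> y)"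
      using gp_ultra[of u "c \<otimes> u" "c \<otimes> y"] yc u cc by simp
    moreover have "gp u y - len c \<le> gp (c \<otimes> u) (c \<otimes> y)" using gp_mult_left yc u cc by simp
    ultimately show ?thesis
      using B[OF c y(1)] B0 T delta_nonneg \<Lambda>[OF c] u gp_commute[OF u(1) yc] by linarith
  qed
  have lwT: "len w \<ge> T" using gp_le_len[OF w yc] gw by simp
  have inv_far: "gp (inv w) (c \<otimes> inv w) \<le> B + 2 * \<delta>" if "c \<in> F" for c
    using far[of "inv w"] giw w that by simp
  have "w \<otimes> d \<otimes> inv w \<noteq> c" if "c \<in> F" "d \<in> F" for c d
  proof
    assume "w \<otimes> d \<otimes> inv w = c"
    then show False
      using len_conjugate_lower(1)[OF w Fc(1)[OF that(2)]] inv_far[OF that(2)] \<Lambda>[OF that(1)] \<Lambda>[OF that(2)]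
        lwT T B0 delta_nonneg by simp
  qed
  moreover have "w \<otimes> d' \<otimes> inv w \<otimes> c' \<noteq> c \<otimes> (w \<otimes> d \<otimes> inv w)"
    if in_F: "c \<in> F" "c' \<in> F" "d \<in> F" "d' \<in> F" for c c' d d'
  proof
    assume eq: "w \<otimes> d' \<otimes> inv w \<otimes> c' = c \<otimes> (w \<otimes> d \<otimes> inv w)"
    \<comment> \<open>As \<open>c \<otimes> (w \<otimes> d \<otimes> inv w)\<close> this element
      follows \<open>c \<otimes> w\<close>; as
      \<open>w \<otimes> d' \<otimes> inv w \<otimes> c'\<close> it follows
      \<open>w\<close>.\<close>
    define a where "a = c \<otimes> (w \<otimes> d \<otimes> inv w)"
    have ac: "a \<in> carrier G" using in_F Fc w by (simp add: a_def)
    have low: "real (len w) - \<Lambda> - (B + 2 * \<delta>) \<le> gp (w \<otimes> d \<otimes> inv w) w" if "d \<in> F" for d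
      using len_conjugate_lower(2)[OF w Fc(1)[OF that]] inv_far[OF that] \<Lambda>[OF that] by simp
    have "real (len w) - 2 * \<Lambda> - (B + 2 * \<delta>) \<le> gp a (c \<otimes> w)"
      using gp_mult_left[of "w \<otimes> d \<otimes> inv w" w c] low[OF in_F(3)] \<Lambda>[OF in_F(1)] in_F Fc w
      by (simp add: a_def)
    moreover have "real (len w) - 2 * \<Lambda> - (B + 2 * \<delta>) \<le> gp a w"
      using gp_mult_right[of "w \<otimes> d' \<otimes> inv w" w c'] low[OF in_F(4)] \<Lambda>[OF in_F(2)] in_F Fc w
      by (simp add: a_def eq[symmetric])
    moreover have "gp w a - \<delta> \<le> gp w (c \<otimes> w) \<or> gp a (c \<otimes> w) - \<delta> \<le> gp w (c \<otimes> w)"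
      using gp_ultra[of w a "c \<otimes> w"] w ac in_F Fc by simp
    ultimately show False
      using far[OF w gw in_F(1)] lwT T B0 delta_nonneg gp_commute[OF w ac] by linarith
  qed
  ultimately show ?thesis using w by blast
qed

end

section \<open>Word lengths of finitely generated groups\<close>

lemma (in group) foldr_closed: "set u \<subseteq> carrier G \<Longrightarrow> foldr (\<otimes>) u \<one> \<in> carrier G"
  by (induction u) auto

lemma (in group) foldr_mult_append:
  "set u \<subseteq> carrier G \<Longrightarrow> set v \<subseteq> carrier G \<Longrightarrow>
    foldr (\<otimes>) (u @ v) \<one> = foldr (\<otimes>) u \<one> \<otimes> foldr (\<otimes>) v \<one>"
  by (induction u) (auto simp: m_assoc foldr_closed)

lemma (in group) word_exists:
  assumes S: "S \<subseteq> carrier G" "generate G S = carrier G" and x: "x \<in> carrier G"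
  shows "\<exists>u. set u \<subseteq> S \<union> m_inv G ` S \<and> foldr (\<otimes>) u \<one> = x"
proof -
  have "x \<in> generate G S" using assms by simp
  then show ?thesis
  proof (induction rule: generate.induct)
    case one
    show ?case by (intro exI[of _ "[]"]) simp
  next
    case (incl h)
    then show ?case using S by (intro exI[of _ "[h]"]) auto
  next
    case (inv h)
    then show ?case using S by (intro exI[of _ "[inv h]"]) auto
  next
    case (eng h1 h2)
    then obtain u v where uv: "set u \<subseteq> S \<union> m_inv G ` S" "foldr (\<otimes>) u \<one> = h1"
      "set v \<subseteq> S \<union> m_inv G ` S" "foldr (\<otimes>) v \<one> = h2" by blast
    have "foldr (\<otimes>) (u @ v) \<one> = foldr (\<otimes>) u \<one> \<otimes> foldr (\<otimes>) v \<one>"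
      using uv(1,3) S by (intro foldr_mult_append) auto
    then show ?case using uv by (intro exI[of _ "u @ v"]) auto
  qed
qed


text \<open>Cutting a shortest word after \<open>r\<close> letters yields \<open>len_split\<close>.
  The four-point inequality is Gromov's inequality based at \<open>w\<close>, multiplied out so that
  the base point loses its special role.\<close>

lemma (in group) hyperbolic_length_word_length:
  assumes S: "finite S" "S \<subseteq> carrier G" "generate G S = carrier G"
    and hyp: "gromov_hyperbolic (carrier G) (word_metric G S)"
  obtains \<delta> where "hyperbolic_length G (word_length G S) \<delta>"
proof -
  define T where "T = S \<union> m_inv G ` S"
  have T: "finite T" "T \<subseteq> carrier G" and invT: "m_inv G ` T \<subseteq> T" using S by (auto simp: T_def)
  define ev where "ev u = foldr (\<otimes>) u \<one>" for u
  let ?len = "word_length G S"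
  have ev_closed: "ev u \<in> carrier G" if "set u \<subseteq> T" for u
    using foldr_closed that T unfolding ev_def by blast
  have ev_append: "ev (u @ v) = ev u \<otimes> ev v" if "set u \<subseteq> T" "set v \<subseteq> T" for u v
    unfolding ev_def using that T by (intro foldr_mult_append) auto
  have le: "?len x \<le> length u" if "set u \<subseteq> T" "ev u = x" for u x
    unfolding word_length_def by (rule Least_le) (use that in \<open>auto simp: T_def ev_def\<close>)
  have word: "\<exists>u. length u = ?len x \<and> set u \<subseteq> T \<and> ev u = x" if "x \<in> carrier G" for x
    using LeastI_ex[of "\<lambda>n. \<exists>u. length u = n \<and> set u \<subseteq> T \<and> ev u = x"] word_exists[OF S(2,3) that]
    unfolding word_length_def T_def ev_def by blast
  have mult: "?len (x \<otimes> y) \<le> ?len x + ?len y" if xy: "x \<in> carrier G" "y \<in> carrier G" for x y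
  proof -
    obtain u v where u: "length u = ?len x" "set u \<subseteq> T" "ev u = x"
      and v: "length v = ?len y" "set v \<subseteq> T" "ev v = y" using word xy by metis
    then show ?thesis using le[of "u @ v" "x \<otimes> y"] ev_append[OF u(2) v(2)] by simp
  qed
  have ev_inv: "ev (map (m_inv G) (rev u)) = inv (ev u)" if "set u \<subseteq> T" for u
    using that
  proof (induction u)
    case (Cons a u)
    then have a: "a \<in> carrier G" "set u \<subseteq> T" "inv a \<in> T" using T invT by auto
    have "ev (map (m_inv G) (rev (a # u))) = ev (map (m_inv G) (rev u)) \<otimes> ev [inv a]"
      using a invT by (simp, intro ev_append) auto
    then show ?case using Cons a ev_closed[of u] by (simp add: ev_def inv_mult_group)
  qed (simp add: ev_def)
  have inv_le: "?len (inv x) \<le> ?len x" if x: "x \<in> carrier G" for x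
  proof -
    obtain u where u: "length u = ?len x" "set u \<subseteq> T" "ev u = x" using word x by metis
    have "set (map (m_inv G) (rev u)) \<subseteq> T" using u invT by auto
    then show ?thesis using le[OF _ ev_inv[OF u(2)]] u by simp
  qed
  have inv: "?len (inv x) = ?len x" if "x \<in> carrier G" for x
    using inv_le[of x] inv_le[of "inv x"] that by simp
  obtain \<delta> where \<delta>: "\<delta> \<ge> 0" and hyp: "\<And>w x y z. \<lbrakk>w \<in> carrier G; x \<in> carrier G; y \<in> carrier G; z \<in> carrier G\<rbrakk> \<Longrightarrow>
     min (gromov_product (word_metric G S) w x y) (gromov_product (word_metric G S) w y z) - \<delta>
       \<le> gromov_product (word_metric G S) w x z"
    using hyp unfolding gromov_hyperbolic_def by blast
  have sym: "word_metric G S x y = word_metric G S y x" if "x \<in> carrier G" "y \<in> carrier G" for x y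
    using inv[of "inv x \<otimes> y"] that by (simp add: word_metric_def inv_mult_group)
  have "hyperbolic_length G ?len \<delta>"
  proof
    show one: "?len \<one> = 0" using le[of "[]" \<one>] by (simp add: ev_def)
    show "finite {x \<in> carrier G. ?len x \<le> n}" for n
    proof (rule finite_subset)
      show "{x \<in> carrier G. ?len x \<le> n} \<subseteq> ev ` {u. set u \<subseteq> T \<and> length u \<le> n}"
        using word by fastforce
    qed (use finite_lists_length_le[OF T(1)] in auto)
    show "\<exists>p\<in>carrier G. ?len p = r \<and> ?len (inv p \<otimes> x) = ?len x - r"
      if x: "x \<in> carrier G" and r: "r \<le> ?len x" for x r
    proof -
      obtain u where u: "length u = ?len x" "set u \<subseteq> T" "ev u = x" using word x by metis
      have sub: "set (take r u) \<subseteq> T" "set (drop r u) \<subseteq> T"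
        using u(2) set_take_subset[of r u] set_drop_subset[of r u] by auto
      define p q where "p = ev (take r u)" and "q = ev (drop r u)"
      have pq: "p \<in> carrier G" "q \<in> carrier G" using ev_closed sub by (auto simp: p_def q_def)
      have x_eq: "x = p \<otimes> q" using ev_append[OF sub] u(3) by (simp add: p_def q_def)
      then have "inv p \<otimes> x = q" using pq by (simp add: m_assoc[symmetric])
      moreover have "?len p \<le> r" "?len q \<le> ?len x - r"
        using le[OF sub(1)] le[OF sub(2)] u(1) r by (auto simp: p_def q_def)
      moreover have "?len x \<le> ?len p + ?len q" using mult[OF pq] x_eq by simp
      ultimately show ?thesis using pq r by (intro bexI[of _ p]) auto
    qed
    show "real (?len (inv x \<otimes> y)) + real (?len (inv z \<otimes> w))
      \<le> max (real (?len (inv x \<otimes> z)) + real (?len (inv y \<otimes> w)))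
          (real (?len (inv x \<otimes> w)) + real (?len (inv y \<otimes> z))) + 2 * \<delta>"
      if c: "x \<in> carrier G" "y \<in> carrier G" "z \<in> carrier G" "w \<in> carrier G" for x y z w
    proof -
      let ?d = "word_metric G S"
      have "min (gromov_product ?d w x z) (gromov_product ?d w z y) \<le> gromov_product ?d w x y + \<delta>"
        using hyp[OF c(4,1,3,2)] by simp
      then have "?d x y + ?d z w \<le> ?d x z + ?d y w + 2 * \<delta> \<or> ?d x y + ?d z w \<le> ?d x w + ?d y z + 2 * \<delta>"
        using sym[OF c(3,2)] unfolding min_le_iff_disj gromov_product_def by (auto simp: field_simps)
      then have "?d x y + ?d z w \<le> max (?d x z + ?d y w) (?d x w + ?d y z) + 2 * \<delta>"
        by linarith
      then show ?thesis by (simp add: word_metric_def)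
    qed
  qed (use mult inv \<delta> in auto)
  then show ?thesis using that by blast
qed

section \<open>Invariant subalgebras of torsion-free hyperbolic groups\<close>

theorem theorem1p2:
  fixes G :: "('a, 'b) monoid_scheme"
  assumes "group G"
    and "torsion_free G"
    and "\<not> amenable G"
    and "hyperbolic_group G"
  shows "ISR_property G"
  unfolding ISR_property_def
proof (intro allI impI)
  fix M assume M: "invariant_subalgebra G M"
  interpret group G by fact
  interpret invariant_vn_subalgebra G M
    using M by unfold_locales (auto simp: invariant_subalgebra_def vn_subalgebra_def)
  obtain S where S: "finite S" "S \<subseteq> carrier G" "generate G S = carrier G"
    "gromov_hyperbolic (carrier G) (word_metric G S)"
    using assms(4) unfolding hyperbolic_group_def by blast
  obtain \<delta> where "hyperbolic_length G (word_length G S) \<delta>"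
    using hyperbolic_length_word_length[OF S] .
  then interpret hyperbolic_length G "word_length G S" \<delta> .
  have "P (basis g) = 0 \<or> P (basis g) = basis g" if g: "g \<in> carrier G" for g
  proof (cases "g = \<one>\<^bsub>G\<^esub>")
    case True
    then show ?thesis using K.proj_id[OF basis_one_in_K] by (simp add: P_def)
  next
    case False
    show ?thesis
      by (rule P_basis_cases, rule P_basis_concentrated[OF g False])
        (rule separating_conjugator[OF assms(2,3) g False])
  qed
  then show "\<exists>H. H \<lhd> G \<and> M = subgroup_vn_algebra G H" by (rule generated_by_normal_subgroup)
qed

end
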